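(* Let $X$ be a smooth complex projective variety, $r\ge 2$ an integer, $Z\subset X$ a (possibly empty) locally complete intersection subscheme of codimension two, and $\mathcal{A}\in\mathrm{Pic}(X)$ a line bundle with $H^0(T_X\otimes\mathcal{A}^\vee)\neq 0$. Let $\mathcal{E}$ be a torsion-free sheaf on $X$ fitting into an exact sequence $$0\to\mathcal{O}_X^{\oplus(r-1)}\to\mathcal{E}\to\mathcal{I}_Z\otimes\mathcal{A}\to 0 .$$ Then there exists a $2$-nilpotent co-Higgs structure $\Phi$ on $\mathcal{E}$ with $\ker(\Phi)\cong\mathcal{O}_X^{\oplus(r-1)}$.
   Context: A $2$-nilpotent co-Higgs structure on a torsion-free sheaf $\mathcal{E}$ is a non-zero $\mathcal{O}_X$-linear map $\Phi:\mathcal{E}\to\mathcal{E}\otimes T_X$ with $\Phi\circ\Phi:=(\Phi\otimes\mathrm{id})\circ\Phi=0$ as a map $\mathcal{E}\to\mathcal{E}\otimes T_X\otimes T_X$ (this implies $\Phi\wedge\Phi=0$). $\mathcal{I}_Z$ is the ideal sheaf of $Z$. *)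

theory Defs
  imports
    "HOL-Algebra.Module"
    "HOL-Algebra.Ideal"
    "HOL-Algebra.Free_Abelian_Groups"
    "HOL-Analysis.Finite_Cartesian_Product"
    "HOL-Analysis.Abstract_Topology"
    "HOL-Library.Extended_Nat"
begin

section \<open>Spaces with functions\<close>

text \<open>
  A variety is given in the classical way: a topological space together with, for every open
  set \<open>U\<close>, a set of complex-valued functions on \<open>U\<close>. Functions on \<open>U\<close>
  are \<open>extensional\<close>, so restricting a function to a smaller open set is \<open>restrict\<close>.
  Passing from a variety in the scheme sense to its closed points changes neither the lattice of
  open sets nor the structure sheaf, hence not the category of sheaves of modules either.
\<close>

record 'p space_with_functions =
  topo :: "'p topology"
  regular :: "'p set \<Rightarrow> ('p \<Rightarrow> complex) set"

abbreviation space_open :: "('p, 'z) space_with_functions_scheme \<Rightarrow> 'p set \<Rightarrow> bool" where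
  "space_open X U \<equiv> openin (topo X) U"

definition opens_in :: "'p space_with_functions \<Rightarrow> 'p set \<Rightarrow> 'p set set" where
  "opens_in X U = {V. space_open X V \<and> V \<subseteq> U}"

definition open_subspace :: "'p space_with_functions \<Rightarrow> 'p set \<Rightarrow> 'p space_with_functions" where
  "open_subspace X U = X\<lparr>topo := subtopology (topo X) U\<rparr>"

definition function_ring :: "'p space_with_functions \<Rightarrow> 'p set \<Rightarrow> ('p \<Rightarrow> complex) ring" where
  "function_ring X U = \<lparr>carrier = regular X U,
     monoid.mult = (\<lambda>f g. \<lambda>x\<in>U. f x * g x), monoid.one = (\<lambda>x\<in>U. 1),
     ring.zero = (\<lambda>x\<in>U. 0), ring.add = (\<lambda>f g. \<lambda>x\<in>U. f x + g x)\<rparr>"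


section \<open>Sheaves of modules\<close>

text \<open>
  The record type \<open>module\<close> extends \<open>ring\<close>; the fields \<open>mult\<close> and
  \<open>one\<close> play no role for modules and are left unspecified.
\<close>

definition mk_module ::
    "'m set \<Rightarrow> 'm \<Rightarrow> ('m \<Rightarrow> 'm \<Rightarrow> 'm) \<Rightarrow> ('r \<Rightarrow> 'm \<Rightarrow> 'm) \<Rightarrow> ('r, 'm) module" where
  "mk_module C z a s =
     \<lparr>carrier = C, monoid.mult = undefined, monoid.one = undefined,
      ring.zero = z, ring.add = a, module.smult = s\<rparr>"

record ('p, 'm) module_presheaf =
  sec :: "'p set \<Rightarrow> ('p \<Rightarrow> complex, 'm) module"
  res :: "'p set \<Rightarrow> 'p set \<Rightarrow> 'm \<Rightarrow> 'm"

abbreviation sections :: "('p, 'm) module_presheaf \<Rightarrow> 'p set \<Rightarrow> 'm set" where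
  "sections F U \<equiv> carrier (sec F U)"

definition presheaf_of_modules ::
    "'p space_with_functions \<Rightarrow> ('p, 'm) module_presheaf \<Rightarrow> bool" where
  "presheaf_of_modules X F \<longleftrightarrow>
     (\<forall>U. space_open X U \<longrightarrow> Module.module (function_ring X U) (sec F U)) \<and>
     (\<forall>U V. space_open X U \<and> space_open X V \<and> V \<subseteq> U \<longrightarrow>
        res F U V \<in> sections F U \<rightarrow> sections F V \<and>
        (\<forall>s\<in>sections F U. \<forall>t\<in>sections F U.
           res F U V (s \<oplus>\<^bsub>sec F U\<^esub> t) = res F U V s \<oplus>\<^bsub>sec F V\<^esub> res F U V t) \<and>
        (\<forall>f\<in>regular X U. \<forall>s\<in>sections F U.
           res F U V (f \<odot>\<^bsub>sec F U\<^esub> s) = restrict f V \<odot>\<^bsub>sec F V\<^esub> res F U V s)) \<and>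
     (\<forall>U. space_open X U \<longrightarrow> (\<forall>s\<in>sections F U. res F U U s = s)) \<and>
     (\<forall>U V W. space_open X U \<and> space_open X V \<and> space_open X W \<and> W \<subseteq> V \<and> V \<subseteq> U \<longrightarrow>
        (\<forall>s\<in>sections F U. res F V W (res F U V s) = res F U W s))"

definition sheaf_of_modules ::
    "'p space_with_functions \<Rightarrow> ('p, 'm) module_presheaf \<Rightarrow> bool" where
  "sheaf_of_modules X F \<longleftrightarrow> presheaf_of_modules X F \<and>
     (\<forall>\<U>. (\<forall>U\<in>\<U>. space_open X U) \<longrightarrow>
        (\<forall>s\<in>sections F (\<Union>\<U>). \<forall>t\<in>sections F (\<Union>\<U>).
           (\<forall>U\<in>\<U>. res F (\<Union>\<U>) U s = res F (\<Union>\<U>) U t) \<longrightarrow> s = t) \<and>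
        (\<forall>s. (\<forall>U\<in>\<U>. s U \<in> sections F U) \<and>
             (\<forall>U\<in>\<U>. \<forall>V\<in>\<U>. res F U (U \<inter> V) (s U) = res F V (U \<inter> V) (s V)) \<longrightarrow>
           (\<exists>t\<in>sections F (\<Union>\<U>). \<forall>U\<in>\<U>. res F (\<Union>\<U>) U t = s U)))"

definition sheaf_hom ::
    "'p space_with_functions \<Rightarrow> ('p, 'm) module_presheaf \<Rightarrow> ('p, 'n) module_presheaf \<Rightarrow>
     ('p set \<Rightarrow> 'm \<Rightarrow> 'n) \<Rightarrow> bool" where
  "sheaf_hom X F G \<phi> \<longleftrightarrow>
     (\<forall>U. space_open X U \<longrightarrow>
        \<phi> U \<in> sections F U \<rightarrow> sections G U \<and>
        (\<forall>s\<in>sections F U. \<forall>t\<in>sections F U.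
           \<phi> U (s \<oplus>\<^bsub>sec F U\<^esub> t) = \<phi> U s \<oplus>\<^bsub>sec G U\<^esub> \<phi> U t) \<and>
        (\<forall>f\<in>regular X U. \<forall>s\<in>sections F U.
           \<phi> U (f \<odot>\<^bsub>sec F U\<^esub> s) = f \<odot>\<^bsub>sec G U\<^esub> \<phi> U s)) \<and>
     (\<forall>U V. space_open X U \<and> space_open X V \<and> V \<subseteq> U \<longrightarrow>
        (\<forall>s\<in>sections F U. \<phi> V (res F U V s) = res G U V (\<phi> U s)))"

definition isomorphic_sheaves ::
    "'p space_with_functions \<Rightarrow> ('p, 'm) module_presheaf \<Rightarrow> ('p, 'n) module_presheaf \<Rightarrow> bool" where
  "isomorphic_sheaves X F G \<longleftrightarrow>
     (\<exists>\<phi>. sheaf_hom X F G \<phi> \<and>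
        (\<forall>U. space_open X U \<longrightarrow> bij_betw (\<phi> U) (sections F U) (sections G U)))"

definition subsheaf ::
    "('p, 'm) module_presheaf \<Rightarrow> ('p set \<Rightarrow> 'm set) \<Rightarrow> ('p, 'm) module_presheaf" where
  "subsheaf F S = \<lparr>sec = (\<lambda>U. (sec F U)\<lparr>carrier := S U\<rparr>), res = res F\<rparr>"

definition kernel_sheaf ::
    "('p, 'm) module_presheaf \<Rightarrow> ('p, 'n) module_presheaf \<Rightarrow> ('p set \<Rightarrow> 'm \<Rightarrow> 'n) \<Rightarrow>
     ('p, 'm) module_presheaf" where
  "kernel_sheaf F G \<phi> = subsheaf F (\<lambda>U. {s \<in> sections F U. \<phi> U s = \<zero>\<^bsub>sec G U\<^esub>})"

definition image_sections ::
    "'p space_with_functions \<Rightarrow> ('p, 'm) module_presheaf \<Rightarrow> ('p, 'n) module_presheaf \<Rightarrow>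
     ('p set \<Rightarrow> 'm \<Rightarrow> 'n) \<Rightarrow> 'p set \<Rightarrow> 'n set" where
  "image_sections X F G \<phi> U =
     {t \<in> sections G U. \<forall>x\<in>U. \<exists>V\<in>opens_in X U. x \<in> V \<and> res G U V t \<in> \<phi> V ` sections F V}"

definition injective_hom ::
    "'p space_with_functions \<Rightarrow> ('p, 'm) module_presheaf \<Rightarrow> ('p set \<Rightarrow> 'm \<Rightarrow> 'n) \<Rightarrow> bool" where
  "injective_hom X F \<phi> \<longleftrightarrow> (\<forall>U. space_open X U \<longrightarrow> inj_on (\<phi> U) (sections F U))"

definition surjective_hom ::
    "'p space_with_functions \<Rightarrow> ('p, 'm) module_presheaf \<Rightarrow> ('p, 'n) module_presheaf \<Rightarrow>
     ('p set \<Rightarrow> 'm \<Rightarrow> 'n) \<Rightarrow> bool" where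
  "surjective_hom X F G \<phi> \<longleftrightarrow>
     (\<forall>U. space_open X U \<longrightarrow> image_sections X F G \<phi> U = sections G U)"

definition exact_at ::
    "'p space_with_functions \<Rightarrow> ('p, 'l) module_presheaf \<Rightarrow> ('p, 'm) module_presheaf \<Rightarrow>
     ('p, 'n) module_presheaf \<Rightarrow> ('p set \<Rightarrow> 'l \<Rightarrow> 'm) \<Rightarrow> ('p set \<Rightarrow> 'm \<Rightarrow> 'n) \<Rightarrow> bool" where
  "exact_at X F G H \<phi> \<psi> \<longleftrightarrow>
     (\<forall>U. space_open X U \<longrightarrow> image_sections X F G \<phi> U = sections (kernel_sheaf G H \<psi>) U)"

definition short_exact ::
    "'p space_with_functions \<Rightarrow> ('p, 'l) module_presheaf \<Rightarrow> ('p, 'm) module_presheaf \<Rightarrow>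
     ('p, 'n) module_presheaf \<Rightarrow> ('p set \<Rightarrow> 'l \<Rightarrow> 'm) \<Rightarrow> ('p set \<Rightarrow> 'm \<Rightarrow> 'n) \<Rightarrow> bool" where
  "short_exact X F G H \<phi> \<psi> \<longleftrightarrow>
     sheaf_hom X F G \<phi> \<and> sheaf_hom X G H \<psi> \<and>
     injective_hom X F \<phi> \<and> exact_at X F G H \<phi> \<psi> \<and> surjective_hom X G H \<psi>"

definition structure_sheaf ::
    "'p space_with_functions \<Rightarrow> ('p, 'p \<Rightarrow> complex) module_presheaf" where
  "structure_sheaf X =
     \<lparr>sec = (\<lambda>U. mk_module (regular X U) (\<lambda>x\<in>U. 0)
        (\<lambda>f g. \<lambda>x\<in>U. f x + g x) (\<lambda>f g. \<lambda>x\<in>U. f x * g x)),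
      res = (\<lambda>U V f. restrict f V)\<rparr>"

definition free_sheaf ::
    "'p space_with_functions \<Rightarrow> nat \<Rightarrow> ('p, nat \<Rightarrow> 'p \<Rightarrow> complex) module_presheaf" where
  "free_sheaf X n =
     \<lparr>sec = (\<lambda>U. mk_module ({..<n} \<rightarrow>\<^sub>E regular X U) (\<lambda>i\<in>{..<n}. \<lambda>x\<in>U. 0)
        (\<lambda>s t. \<lambda>i\<in>{..<n}. \<lambda>x\<in>U. s i x + t i x) (\<lambda>f s. \<lambda>i\<in>{..<n}. \<lambda>x\<in>U. f x * s i x)),
      res = (\<lambda>U V s. \<lambda>i\<in>{..<n}. restrict (s i) V)\<rparr>"

text \<open>Coherence on a variety (a locally Noetherian space): local finite presentation.\<close>

definition coherent ::
    "'p space_with_functions \<Rightarrow> ('p, 'm) module_presheaf \<Rightarrow> bool" where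
  "coherent X F \<longleftrightarrow> sheaf_of_modules X F \<and>
     (\<forall>x\<in>topspace (topo X). \<exists>U. space_open X U \<and> x \<in> U \<and>
        (\<exists>m n \<phi> \<psi>. let Y = open_subspace X U in
           sheaf_hom Y (free_sheaf Y m) (free_sheaf Y n) \<phi> \<and> sheaf_hom Y (free_sheaf Y n) F \<psi> \<and>
           exact_at Y (free_sheaf Y m) (free_sheaf Y n) F \<phi> \<psi> \<and>
           surjective_hom Y (free_sheaf Y n) F \<psi>))"

definition torsion_free_sheaf ::
    "'p space_with_functions \<Rightarrow> ('p, 'm) module_presheaf \<Rightarrow> bool" where
  "torsion_free_sheaf X F \<longleftrightarrow> coherent X F \<and>
     (\<forall>U. space_open X U \<longrightarrow> (\<forall>f\<in>regular X U. \<forall>s\<in>sections F U.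
        f \<odot>\<^bsub>sec F U\<^esub> s = \<zero>\<^bsub>sec F U\<^esub> \<longrightarrow> f = (\<lambda>x\<in>U. 0) \<or> s = \<zero>\<^bsub>sec F U\<^esub>))"

definition line_bundle ::
    "'p space_with_functions \<Rightarrow> ('p, 'm) module_presheaf \<Rightarrow> bool" where
  "line_bundle X L \<longleftrightarrow> sheaf_of_modules X L \<and>
     (\<forall>x\<in>topspace (topo X). \<exists>U. space_open X U \<and> x \<in> U \<and>
        isomorphic_sheaves (open_subspace X U) L (structure_sheaf (open_subspace X U)))"

text \<open>The sheaf of homomorphisms, whose sections over \<open>U\<close> are the maps \<open>F|U \<rightarrow> G|U\<close>.\<close>

definition hom_sheaf ::
    "'p space_with_functions \<Rightarrow> ('p, 'm) module_presheaf \<Rightarrow> ('p, 'n) module_presheaf \<Rightarrow>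
     ('p, 'p set \<Rightarrow> 'm \<Rightarrow> 'n) module_presheaf" where
  "hom_sheaf X F G =
     \<lparr>sec = (\<lambda>U. mk_module
        {\<phi> \<in> extensional (opens_in X U).
           (\<forall>V\<in>opens_in X U. \<phi> V \<in> extensional (sections F V)) \<and>
           sheaf_hom (open_subspace X U) F G \<phi>}
        (\<lambda>V\<in>opens_in X U. \<lambda>s\<in>sections F V. \<zero>\<^bsub>sec G V\<^esub>)
        (\<lambda>\<phi> \<psi>. \<lambda>V\<in>opens_in X U. \<lambda>s\<in>sections F V. \<phi> V s \<oplus>\<^bsub>sec G V\<^esub> \<psi> V s)
        (\<lambda>f \<phi>. \<lambda>V\<in>opens_in X U. \<lambda>s\<in>sections F V. restrict f V \<odot>\<^bsub>sec G V\<^esub> \<phi> V s)),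
      res = (\<lambda>U V \<phi>. restrict \<phi> (opens_in X V))\<rparr>"

definition dual_sheaf ::
    "'p space_with_functions \<Rightarrow> ('p, 'm) module_presheaf \<Rightarrow>
     ('p, 'p set \<Rightarrow> 'm \<Rightarrow> 'p \<Rightarrow> complex) module_presheaf" where
  "dual_sheaf X F = hom_sheaf X F (structure_sheaf X)"

text \<open>
  The tangent sheaf \<open>T\<^sub>X = Der\<^sub>\<complex>(O\<^sub>X, O\<^sub>X)\<close>: a section over \<open>U\<close> is a
  \<open>\<complex>\<close>-linear derivation of the sheaf of algebras \<open>O\<^sub>X|U\<close>.
\<close>

definition sheaf_derivation ::
    "'p space_with_functions \<Rightarrow> 'p set \<Rightarrow> ('p set \<Rightarrow> ('p \<Rightarrow> complex) \<Rightarrow> ('p \<Rightarrow> complex)) \<Rightarrow> bool" where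
  "sheaf_derivation X U D \<longleftrightarrow>
     D \<in> extensional (opens_in X U) \<and>
     (\<forall>V\<in>opens_in X U. D V \<in> regular X V \<rightarrow>\<^sub>E regular X V \<and>
        (\<forall>f\<in>regular X V. \<forall>g\<in>regular X V.
           D V (\<lambda>x\<in>V. f x + g x) = (\<lambda>x\<in>V. D V f x + D V g x) \<and>
           D V (\<lambda>x\<in>V. f x * g x) = (\<lambda>x\<in>V. f x * D V g x + g x * D V f x)) \<and>
        (\<forall>c. \<forall>f\<in>regular X V. D V (\<lambda>x\<in>V. c * f x) = (\<lambda>x\<in>V. c * D V f x)) \<and>
        (\<forall>W\<in>opens_in X V. \<forall>f\<in>regular X V. D W (restrict f W) = restrict (D V f) W))"

definition tangent_sheaf ::
    "'p space_with_functions \<Rightarrow>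
     ('p, 'p set \<Rightarrow> ('p \<Rightarrow> complex) \<Rightarrow> ('p \<Rightarrow> complex)) module_presheaf" where
  "tangent_sheaf X =
     \<lparr>sec = (\<lambda>U. mk_module {D. sheaf_derivation X U D}
        (\<lambda>V\<in>opens_in X U. \<lambda>f\<in>regular X V. \<lambda>x\<in>V. 0)
        (\<lambda>D E. \<lambda>V\<in>opens_in X U. \<lambda>f\<in>regular X V. \<lambda>x\<in>V. D V f x + E V f x)
        (\<lambda>g D. \<lambda>V\<in>opens_in X U. \<lambda>f\<in>regular X V. \<lambda>x\<in>V. g x * D V f x)),
      res = (\<lambda>U V D. restrict D (opens_in X V))\<rparr>"


section \<open>Stalks and sheafification\<close>

type_synonym ('p, 'm) germ = "('p set \<times> 'm) set"

definition germ ::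
    "'p space_with_functions \<Rightarrow> ('p, 'm) module_presheaf \<Rightarrow> 'p \<Rightarrow> 'p set \<Rightarrow> 'm \<Rightarrow> ('p, 'm) germ" where
  "germ X F x U s = {(V, t). space_open X V \<and> x \<in> V \<and> t \<in> sections F V \<and>
     (\<exists>W. space_open X W \<and> x \<in> W \<and> W \<subseteq> U \<inter> V \<and> res F U W s = res F V W t)}"

definition stalk ::
    "'p space_with_functions \<Rightarrow> ('p, 'm) module_presheaf \<Rightarrow> 'p \<Rightarrow> ('p, 'm) germ set" where
  "stalk X F x = {germ X F x U s | U s. space_open X U \<and> x \<in> U \<and> s \<in> sections F U}"

text \<open>
  Operations on germs are computed on representatives. The union is over a family of sets that
  are all equal, because the result does not depend on the representatives.
\<close>

definition germ_add ::
    "'p space_with_functions \<Rightarrow> ('p, 'm) module_presheaf \<Rightarrow> 'p \<Rightarrow>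
     ('p, 'm) germ \<Rightarrow> ('p, 'm) germ \<Rightarrow> ('p, 'm) germ" where
  "germ_add X F x g h = (\<Union>(V, s)\<in>g. \<Union>(W, t)\<in>h.
     germ X F x (V \<inter> W) (res F V (V \<inter> W) s \<oplus>\<^bsub>sec F (V \<inter> W)\<^esub> res F W (V \<inter> W) t))"

definition germ_smult ::
    "'p space_with_functions \<Rightarrow> ('p, 'm) module_presheaf \<Rightarrow> 'p \<Rightarrow> 'p set \<Rightarrow> ('p \<Rightarrow> complex) \<Rightarrow>
     ('p, 'm) germ \<Rightarrow> ('p, 'm) germ" where
  "germ_smult X F x U f g = (\<Union>(V, s)\<in>g.
     germ X F x (U \<inter> V) (restrict f (U \<inter> V) \<odot>\<^bsub>sec F (U \<inter> V)\<^esub> res F V (U \<inter> V) s))"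

definition germ_map ::
    "'p space_with_functions \<Rightarrow> ('p, 'n) module_presheaf \<Rightarrow> ('p set \<Rightarrow> 'm \<Rightarrow> 'n) \<Rightarrow> 'p \<Rightarrow>
     ('p, 'm) germ \<Rightarrow> ('p, 'n) germ" where
  "germ_map X G \<phi> x g = (\<Union>(V, s)\<in>g. germ X G x V (\<phi> V s))"

type_synonym ('p, 'm) germ_section = "'p \<Rightarrow> ('p, 'm) germ"

definition sheafify ::
    "'p space_with_functions \<Rightarrow> ('p, 'm) module_presheaf \<Rightarrow>
     ('p, ('p, 'm) germ_section) module_presheaf" where
  "sheafify X F =
     \<lparr>sec = (\<lambda>U. mk_module
        {\<sigma> \<in> (\<Pi>\<^sub>E x\<in>U. stalk X F x).
           \<forall>x\<in>U. \<exists>V\<in>opens_in X U. x \<in> V \<and> (\<exists>s\<in>sections F V. \<forall>y\<in>V. \<sigma> y = germ X F y V s)}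
        (\<lambda>x\<in>U. germ X F x U \<zero>\<^bsub>sec F U\<^esub>)
        (\<lambda>\<sigma> \<tau>. \<lambda>x\<in>U. germ_add X F x (\<sigma> x) (\<tau> x))
        (\<lambda>f \<sigma>. \<lambda>x\<in>U. germ_smult X F x U f (\<sigma> x))),
      res = (\<lambda>U V \<sigma>. restrict \<sigma> V)\<rparr>"

definition sheafify_map ::
    "'p space_with_functions \<Rightarrow> ('p, 'n) module_presheaf \<Rightarrow> ('p set \<Rightarrow> 'm \<Rightarrow> 'n) \<Rightarrow>
     'p set \<Rightarrow> ('p, 'm) germ_section \<Rightarrow> ('p, 'n) germ_section" where
  "sheafify_map X G \<phi> U \<sigma> = (\<lambda>x\<in>U. germ_map X G \<phi> x (\<sigma> x))"


section \<open>Tensor products\<close>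

text \<open>
  \<open>M \<otimes>\<^sub>R N\<close> is the free abelian group on \<open>M \<times> N\<close> modulo the subgroup generated by
  the bilinearity relations.
\<close>

type_synonym ('m, 'n) tensor = "(('m \<times> 'n) \<Rightarrow>\<^sub>0 int) set"

definition tensor_relations ::
    "('r, 'z) ring_scheme \<Rightarrow> ('r, 'm) module \<Rightarrow> ('r, 'n) module \<Rightarrow> (('m \<times> 'n) \<Rightarrow>\<^sub>0 int) set" where
  "tensor_relations R M N = generate (free_Abelian_group (carrier M \<times> carrier N))
     ({frag_of (m \<oplus>\<^bsub>M\<^esub> m', n) - frag_of (m, n) - frag_of (m', n) | m m' n.
         m \<in> carrier M \<and> m' \<in> carrier M \<and> n \<in> carrier N} \<union>
      {frag_of (m, n \<oplus>\<^bsub>N\<^esub> n') - frag_of (m, n) - frag_of (m, n') | m n n'.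
         m \<in> carrier M \<and> n \<in> carrier N \<and> n' \<in> carrier N} \<union>
      {frag_of (a \<odot>\<^bsub>M\<^esub> m, n) - frag_of (m, a \<odot>\<^bsub>N\<^esub> n) | a m n.
         a \<in> carrier R \<and> m \<in> carrier M \<and> n \<in> carrier N})"

text \<open>
  \<open>tensor_hom R M N \<phi> \<psi>\<close> is the map \<open>m \<otimes> n \<mapsto> \<phi> m \<otimes> \<psi> n\<close>
  into \<open>M \<otimes>\<^sub>R N\<close>; the cosets in the union all agree if \<open>\<phi>\<close> and \<open>\<psi>\<close>
  are additive and semilinear over a common ring homomorphism.
\<close>

definition tensor_hom ::
    "('r, 'z) ring_scheme \<Rightarrow> ('r, 'm) module \<Rightarrow> ('r, 'n) module \<Rightarrow>
     ('k \<Rightarrow> 'm) \<Rightarrow> ('l \<Rightarrow> 'n) \<Rightarrow> ('k, 'l) tensor \<Rightarrow> ('m, 'n) tensor" where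
  "tensor_hom R M N \<phi> \<psi> C =
     (\<Union>c\<in>C. tensor_relations R M N #>\<^bsub>free_Abelian_group (carrier M \<times> carrier N)\<^esub>
        frag_extend (\<lambda>(m, n). frag_of (\<phi> m, \<psi> n)) c)"

definition tensor_module ::
    "('r, 'z) ring_scheme \<Rightarrow> ('r, 'm) module \<Rightarrow> ('r, 'n) module \<Rightarrow> ('r, ('m, 'n) tensor) module" where
  "tensor_module R M N =
     (let Q = free_Abelian_group (carrier M \<times> carrier N) Mod tensor_relations R M N
      in mk_module (carrier Q) (monoid.one Q) (monoid.mult Q)
           (\<lambda>a. tensor_hom R M N (\<lambda>m. a \<odot>\<^bsub>M\<^esub> m) (\<lambda>n. n)))"

definition tensor_presheaf ::
    "'p space_with_functions \<Rightarrow> ('p, 'm) module_presheaf \<Rightarrow> ('p, 'n) module_presheaf \<Rightarrow>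
     ('p, ('m, 'n) tensor) module_presheaf" where
  "tensor_presheaf X F G =
     \<lparr>sec = (\<lambda>U. tensor_module (function_ring X U) (sec F U) (sec G U)),
      res = (\<lambda>U V. tensor_hom (function_ring X V) (sec F V) (sec G V) (res F U V) (res G U V))\<rparr>"

definition tensor_sheaf ::
    "'p space_with_functions \<Rightarrow> ('p, 'm) module_presheaf \<Rightarrow> ('p, 'n) module_presheaf \<Rightarrow>
     ('p, ('p, ('m, 'n) tensor) germ_section) module_presheaf" where
  "tensor_sheaf X F G = sheafify X (tensor_presheaf X F G)"

text \<open>The map \<open>\<phi> \<otimes> \<psi>\<close> with target \<open>F \<otimes> G\<close>.\<close>

definition tensor_sheaf_map ::
    "'p space_with_functions \<Rightarrow> ('p, 'm) module_presheaf \<Rightarrow> ('p, 'n) module_presheaf \<Rightarrow>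
     ('p set \<Rightarrow> 'k \<Rightarrow> 'm) \<Rightarrow> ('p set \<Rightarrow> 'l \<Rightarrow> 'n) \<Rightarrow>
     'p set \<Rightarrow> ('p, ('k, 'l) tensor) germ_section \<Rightarrow> ('p, ('m, 'n) tensor) germ_section" where
  "tensor_sheaf_map X F G \<phi> \<psi> = sheafify_map X (tensor_presheaf X F G)
     (\<lambda>U. tensor_hom (function_ring X U) (sec F U) (sec G U) (\<phi> U) (\<psi> U))"


section \<open>Dimension and smoothness\<close>

text \<open>The supremum of the lengths \<open>n\<close> of finite chains \<open>C\<^sub>0 \<subset> \<dots> \<subset> C\<^sub>n\<close> in a family of sets.\<close>

definition chain_length :: "'a set set \<Rightarrow> enat" where
  "chain_length \<S> =
     (SUP \<C>\<in>{\<C>. finite \<C> \<and> \<C> \<noteq> {} \<and> subset.chain \<S> \<C>}. enat (card \<C> - 1))"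

definition krull_dim :: "('a, 'z) ring_scheme \<Rightarrow> enat" where
  "krull_dim R = chain_length {P. primeideal P R}"

definition irreducible_closed :: "'p topology \<Rightarrow> 'p set \<Rightarrow> bool" where
  "irreducible_closed T C \<longleftrightarrow> closedin T C \<and> C \<noteq> {} \<and>
     (\<forall>A B. closedin T A \<and> closedin T B \<and> C \<subseteq> A \<union> B \<longrightarrow> C \<subseteq> A \<or> C \<subseteq> B)"

text \<open>The codimension of the empty set is infinite.\<close>

definition codimension :: "'p topology \<Rightarrow> 'p set \<Rightarrow> enat" where
  "codimension T Z = (INF C\<in>{C. irreducible_closed T C \<and> C \<subseteq> Z}.
     chain_length {D. irreducible_closed T D \<and> C \<subseteq> D})"

definition local_ring :: "'p space_with_functions \<Rightarrow> 'p \<Rightarrow> ('p, 'p \<Rightarrow> complex) germ ring" where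
  "local_ring X x =
     \<lparr>carrier = stalk X (structure_sheaf X) x,
      monoid.mult = (\<lambda>g h. \<Union>(V, a)\<in>g. \<Union>(W, b)\<in>h.
        germ X (structure_sheaf X) x (V \<inter> W) (\<lambda>y\<in>V \<inter> W. a y * b y)),
      monoid.one = germ X (structure_sheaf X) x (topspace (topo X)) (\<lambda>y\<in>topspace (topo X). 1),
      ring.zero = germ X (structure_sheaf X) x (topspace (topo X)) (\<lambda>y\<in>topspace (topo X). 0),
      ring.add = germ_add X (structure_sheaf X) x\<rparr>"

definition vanishing_germs :: "'p space_with_functions \<Rightarrow> 'p \<Rightarrow> ('p, 'p \<Rightarrow> complex) germ set" where
  "vanishing_germs X x =
     {germ X (structure_sheaf X) x U f | U f. space_open X U \<and> x \<in> U \<and> f \<in> regular X U \<and> f x = 0}"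

text \<open>
  Smoothness: all local rings are regular, that is, the maximal ideal (the germs vanishing
  at the point) is generated by as many elements as the dimension of the local ring. Local rings
  of varieties are Noetherian, so this need not be demanded.
\<close>

definition smooth :: "'p space_with_functions \<Rightarrow> bool" where
  "smooth X \<longleftrightarrow> (\<forall>x\<in>topspace (topo X).
     \<exists>S. finite S \<and> S \<subseteq> vanishing_germs X x \<and> enat (card S) = krull_dim (local_ring X x) \<and>
         vanishing_germs X x = genideal (local_ring X x) S)"


section \<open>Projective varieties\<close>

text \<open>Complex projective space of dimension \<open>CARD('n) - 1\<close>; its points are lines in \<open>\<complex>^'n\<close>.\<close>

definition proj_space :: "(complex ^ 'n) set set" where
  "proj_space = {{c *s v | c. True} | v. v \<noteq> 0}"

definition form :: "nat \<Rightarrow> (complex ^ 'n \<Rightarrow> complex) \<Rightarrow> bool" where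
  "form d F \<longleftrightarrow> (\<exists>a :: ('n \<Rightarrow> nat) \<Rightarrow> complex.
     \<forall>v. F v = (\<Sum>\<alpha> | (\<Sum>i\<in>UNIV. \<alpha> i) = d. a \<alpha> * (\<Prod>i\<in>UNIV. v $ i ^ \<alpha> i)))"

definition zariski :: "(complex ^ 'n) set topology" where
  "zariski = topology_generated_by
     {{p \<in> proj_space. \<forall>v\<in>p - {0}. F v \<noteq> 0} | F. \<exists>d. form d F}"

definition variety :: "(complex ^ 'n) set set \<Rightarrow> (complex ^ 'n) set space_with_functions" where
  "variety V =
     \<lparr>topo = subtopology zariski V,
      regular = (\<lambda>U. {f \<in> extensional U. \<forall>p\<in>U. \<exists>W F G d.
         openin (subtopology zariski V) W \<and> p \<in> W \<and> W \<subseteq> U \<and> form d F \<and> form d G \<and>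
         (\<forall>q\<in>W. \<forall>v\<in>q - {0}. G v \<noteq> 0 \<and> f q = F v / G v)})\<rparr>"

definition smooth_projective_variety :: "(complex ^ 'n) set space_with_functions \<Rightarrow> bool" where
  "smooth_projective_variety X \<longleftrightarrow>
     (\<exists>V. irreducible_closed zariski V \<and> X = variety V) \<and> smooth X"


section \<open>Subschemes\<close>

text \<open>
  A closed subscheme \<open>Z\<close> is given by its ideal sheaf \<open>I\<close>, a coherent subsheaf of the structure
  sheaf. Its underlying set consists of the points where the stalk of \<open>I\<close> is proper, i.e. where
  all sections of \<open>I\<close> vanish.
\<close>

definition ideal_sheaf ::
    "'p space_with_functions \<Rightarrow> ('p set \<Rightarrow> ('p \<Rightarrow> complex) set) \<Rightarrow>
     ('p, 'p \<Rightarrow> complex) module_presheaf" where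
  "ideal_sheaf X I = subsheaf (structure_sheaf X) I"

definition closed_subscheme ::
    "'p space_with_functions \<Rightarrow> ('p set \<Rightarrow> ('p \<Rightarrow> complex) set) \<Rightarrow> bool" where
  "closed_subscheme X I \<longleftrightarrow>
     (\<forall>U. space_open X U \<longrightarrow> I U \<subseteq> regular X U) \<and> coherent X (ideal_sheaf X I)"

definition subscheme_points ::
    "'p space_with_functions \<Rightarrow> ('p set \<Rightarrow> ('p \<Rightarrow> complex) set) \<Rightarrow> 'p set" where
  "subscheme_points X I =
     {x \<in> topspace (topo X). \<forall>U f. space_open X U \<and> x \<in> U \<and> f \<in> I U \<longrightarrow> f x = 0}"

text \<open>
  On a smooth variety, a closed subscheme of codimension \<open>k\<close> is a local complete intersection
  if its ideal sheaf is locally generated by \<open>k\<close> sections.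
\<close>

definition lci_of_codim ::
    "nat \<Rightarrow> 'p space_with_functions \<Rightarrow> ('p set \<Rightarrow> ('p \<Rightarrow> complex) set) \<Rightarrow> bool" where
  "lci_of_codim k X I \<longleftrightarrow> closed_subscheme X I \<and>
     (subscheme_points X I = {} \<or> codimension (topo X) (subscheme_points X I) = enat k) \<and>
     (\<forall>x\<in>topspace (topo X). \<exists>U. space_open X U \<and> x \<in> U \<and>
        (\<exists>\<phi>. let Y = open_subspace X U in
           sheaf_hom Y (free_sheaf Y k) (ideal_sheaf X I) \<phi> \<and>
           surjective_hom Y (free_sheaf Y k) (ideal_sheaf X I) \<phi>))"


section \<open>Co-Higgs structures\<close>

definition two_nilpotent_co_Higgs ::
    "'p space_with_functions \<Rightarrow> ('p, 'm) module_presheaf \<Rightarrow>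
     ('p set \<Rightarrow> 'm \<Rightarrow> ('p, ('m, 'p set \<Rightarrow> ('p \<Rightarrow> complex) \<Rightarrow> ('p \<Rightarrow> complex)) tensor) germ_section) \<Rightarrow>
     bool" where
  "two_nilpotent_co_Higgs X E \<Phi> \<longleftrightarrow>
     (let T = tangent_sheaf X; ET = tensor_sheaf X E T; ETT = tensor_sheaf X ET T in
      sheaf_hom X E ET \<Phi> \<and>
      (\<exists>U. space_open X U \<and> (\<exists>e\<in>sections E U. \<Phi> U e \<noteq> \<zero>\<^bsub>sec ET U\<^esub>)) \<and>
      (\<forall>U. space_open X U \<longrightarrow> (\<forall>e\<in>sections E U.
         tensor_sheaf_map X ET T \<Phi> (\<lambda>_ t. t) U (\<Phi> U e) = \<zero>\<^bsub>sec ETT U\<^esub>)))"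

end

theory Submission
  imports Defs
begin

text \<open>
  A nonzero section \<open>s\<close> of \<open>T\<^sub>X \<otimes> A\<^sup>\<or>\<close> is a homomorphism \<open>A \<rightarrow> T\<^sub>X\<close>, injective because
  \<open>T\<^sub>X\<close> is torsion-free. Hence \<open>f \<otimes> a \<mapsto> f \<cdot> s(a)\<close> embeds \<open>I\<^sub>Z \<otimes> A\<close> into \<open>T\<^sub>X\<close>, and
  \<open>\<delta>: E \<rightarrow> I\<^sub>Z \<otimes> A \<rightarrow> T\<^sub>X\<close> has the kernel of \<open>\<beta>\<close>. With \<open>e = \<alpha>(1, 0, \<dots>, 0)\<close> put
  \<open>\<Phi>(m) = e \<otimes> \<delta>(m)\<close>; then \<open>\<Phi> \<circ> \<Phi> = 0\<close> since \<open>\<delta>(e) = 0\<close>. The kernel of \<open>\<Phi>\<close> is that of \<open>\<delta>\<close>: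
  there is a functional on \<open>E\<close> with values in rational functions which does not vanish at \<open>e\<close>,
  and a derivation is determined by its values on functions, so \<open>e \<otimes> t = 0\<close> forces \<open>t = 0\<close>.
  Finally \<open>\<Phi> \<noteq> 0\<close> because \<open>I\<^sub>Z \<noteq> 0\<close>, \<open>Z\<close> being of codimension two.
\<close>

section \<open>Tensor products of modules\<close>

text \<open>Sections of a tensor sheaf are families of germs of cosets of formal sums, so both
  defining a map on them and showing one of them nonzero need care. The test throughout is by
  complex numbers. A derivation is determined by the numbers \<open>D V h x\<close>, so a map into
  the tangent sheaf becomes a family of balanced pairings with values in \<complex>, extended to
  formal sums and trivial on the bilinearity relations. When one factor is locally generated by a
  single section, as \<open>A\<close> and its dual are, every local tensor is pure and its vanishing
  can be read off the other factor. This does not help with e \<otimes> t: neither factor comes with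
  a single local generator, and a tensor product of torsion-free modules may have torsion. Hence the
  detour through a functional with values in fractions. It comes from Zorn's lemma, and its values
  make sense only on nonempty open sets; irreducibility makes any two of these meet and lets the
  vanishing of a regular function on one of them spread to all points.\<close>

definition frag_eval :: "('a \<Rightarrow> 'c::comm_ring_1) \<Rightarrow> ('a \<Rightarrow>\<^sub>0 int) \<Rightarrow> 'c" where
  "frag_eval b c = (\<Sum>i\<in>Poly_Mapping.keys c. of_int (Poly_Mapping.lookup c i) * b i)"

text \<open>Cancellation can make the support of \<open>c - d\<close> smaller than the union of the
  supports. Summing over a fixed larger set, where the extra coefficients are zero, makes additivity
  a matter of finite sums.\<close>

lemma frag_eval_superset:
  assumes "finite S" "Poly_Mapping.keys c \<subseteq> S"
  shows "frag_eval b c = (\<Sum>i\<in>S. of_int (Poly_Mapping.lookup c i) * b i)"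
  unfolding frag_eval_def using assms
  by (intro sum.mono_neutral_left) (auto simp: in_keys_iff)

lemma frag_eval_0 [simp]: "frag_eval b 0 = 0"
  by (simp add: frag_eval_def)

lemma frag_eval_of [simp]: "frag_eval b (frag_of i) = b i"
  by (simp add: frag_eval_def)

lemma frag_eval_diff: "frag_eval b (c - d) = frag_eval b c - frag_eval b d"
proof -
  let ?S = "Poly_Mapping.keys c \<union> Poly_Mapping.keys d"
  have "Poly_Mapping.keys (c - d) \<subseteq> ?S"
    by (auto simp: in_keys_iff lookup_minus)
  then show ?thesis
    by (simp add: frag_eval_superset[of ?S] lookup_minus sum_subtractf left_diff_distrib)
qed

lemma frag_eval_minus: "frag_eval b (- c) = - frag_eval b c"
  using frag_eval_diff[of b 0 c] by simp

lemma frag_eval_add: "frag_eval b (c + d) = frag_eval b c + frag_eval b d"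
  using frag_eval_diff[of b c "- d"] by (simp add: frag_eval_minus)

lemma frag_eval_cong:
  assumes "\<And>i. i \<in> Poly_Mapping.keys c \<Longrightarrow> b i = b' i"
  shows "frag_eval b c = frag_eval b' c"
  unfolding frag_eval_def using assms by (intro sum.cong) auto

text \<open>The map on formal sums behind \<phi> \<otimes> \<psi>: it occurs literally in
  \<open>tensor_hom\<close>, before passing to cosets.\<close>

abbreviation frag_map2 ::
    "('k \<Rightarrow> 'm) \<Rightarrow> ('l \<Rightarrow> 'n) \<Rightarrow> ('k \<times> 'l \<Rightarrow>\<^sub>0 int) \<Rightarrow> ('m \<times> 'n \<Rightarrow>\<^sub>0 int)" where
  "frag_map2 \<phi> \<psi> \<equiv> frag_extend (\<lambda>(m, n). frag_of (\<phi> m, \<psi> n))"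

lemma frag_map2_compose:
  "frag_map2 \<phi> \<psi> (frag_map2 \<phi>' \<psi>' c) = frag_map2 (\<lambda>m. \<phi> (\<phi>' m)) (\<lambda>n. \<psi> (\<psi>' n)) c"
  by (rule frag_induction[of c UNIV]) (auto simp: frag_extend_diff)

lemma frag_map2_cong:
  assumes "Poly_Mapping.keys c \<subseteq> A \<times> B"
    and "\<And>m. m \<in> A \<Longrightarrow> \<phi> m = \<phi>' m" "\<And>n. n \<in> B \<Longrightarrow> \<psi> n = \<psi>' n"
  shows "frag_map2 \<phi> \<psi> c = frag_map2 \<phi>' \<psi>' c"
  using assms by (intro frag_extend_eq) (auto split: prod.splits)

lemma frag_map2_ident:
  assumes "Poly_Mapping.keys c \<subseteq> A \<times> B"
    and "\<And>m. m \<in> A \<Longrightarrow> \<phi> m = m" "\<And>n. n \<in> B \<Longrightarrow> \<psi> n = n"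
  shows "frag_map2 \<phi> \<psi> c = c"
proof -
  have "frag_map2 \<phi> \<psi> c = frag_extend frag_of c"
    using assms by (intro frag_extend_eq) (auto split: prod.splits)
  then show ?thesis using frag_expansion[of c] by simp
qed

lemma keys_frag_map2:
  assumes "Poly_Mapping.keys c \<subseteq> A \<times> B" "\<phi> \<in> A \<rightarrow> A'" "\<psi> \<in> B \<rightarrow> B'"
  shows "Poly_Mapping.keys (frag_map2 \<phi> \<psi> c) \<subseteq> A' \<times> B'"
  using keys_frag_extend[of "\<lambda>(m, n). frag_of (\<phi> m, \<psi> n)" c] assms
  by (fastforce simp: keys_frag_of)

lemma frag_eval_map2:
  "frag_eval b (frag_map2 \<phi> \<psi> c) = frag_eval (\<lambda>(m, n). b (\<phi> m, \<psi> n)) c"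
  by (rule frag_induction[of c UNIV]) (auto simp: frag_extend_diff frag_eval_diff)

text \<open>Closure keeps the bilinearity relations supported on the carriers, and 0 + 0 = 0 makes 0
  \<otimes> n vanish. Both pass to sheafified tensor products.\<close>

definition premodule :: "('r, 'z) ring_scheme \<Rightarrow> ('r, 'm) module \<Rightarrow> bool" where
  "premodule R M \<longleftrightarrow> \<zero>\<^bsub>M\<^esub> \<in> carrier M \<and> \<zero>\<^bsub>M\<^esub> \<oplus>\<^bsub>M\<^esub> \<zero>\<^bsub>M\<^esub> = \<zero>\<^bsub>M\<^esub> \<and>
     (\<forall>m\<in>carrier M. \<forall>m'\<in>carrier M. m \<oplus>\<^bsub>M\<^esub> m' \<in> carrier M) \<and>
     (\<forall>a\<in>carrier R. \<forall>m\<in>carrier M. a \<odot>\<^bsub>M\<^esub> m \<in> carrier M)"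

lemma premodule_if_module: "Module.module R M \<Longrightarrow> premodule R M"
  by (simp add: premodule_def Module.module_def module_axioms_def abelian_groupE(1,2)
      abelian_group.axioms(1) abelian_monoid.l_zero)

text \<open>One notion serves two purposes: with \<rho> the restriction of functions it describes
  restriction maps of sheaves, and with \<rho> the identity it describes linear maps over a fixed
  open set.\<close>

definition semilinear ::
    "('r, 'z) ring_scheme \<Rightarrow> ('s, 'y) ring_scheme \<Rightarrow> ('r \<Rightarrow> 's) \<Rightarrow> ('r, 'm) module \<Rightarrow>
     ('s, 'n) module \<Rightarrow> ('m \<Rightarrow> 'n) \<Rightarrow> bool" where
  "semilinear R S \<rho> M N \<phi> \<longleftrightarrow> \<rho> \<in> carrier R \<rightarrow> carrier S \<and> \<phi> \<in> carrier M \<rightarrow> carrier N \<and>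
     (\<forall>m\<in>carrier M. \<forall>m'\<in>carrier M. \<phi> (m \<oplus>\<^bsub>M\<^esub> m') = \<phi> m \<oplus>\<^bsub>N\<^esub> \<phi> m') \<and>
     (\<forall>a\<in>carrier R. \<forall>m\<in>carrier M. \<phi> (a \<odot>\<^bsub>M\<^esub> m) = \<rho> a \<odot>\<^bsub>N\<^esub> \<phi> m)"

lemma keys_frag_of_diff:
  "x \<in> S \<Longrightarrow> y \<in> S \<Longrightarrow> Poly_Mapping.keys (frag_of x - frag_of y) \<subseteq> S"
  "x \<in> S \<Longrightarrow> y \<in> S \<Longrightarrow> z \<in> S \<Longrightarrow> Poly_Mapping.keys (frag_of x - frag_of y - frag_of z) \<subseteq> S"
  by (auto simp: in_keys_iff lookup_minus split: if_splits)

text \<open>Membership in the carrier is what makes the generated set a subgroup and identifies the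
  group inverse of a generator with its negative.\<close>

lemma tensor_generators_carrier:
  assumes "premodule R M" "premodule R N"
  assumes "g \<in> {frag_of (m \<oplus>\<^bsub>M\<^esub> m', n) - frag_of (m, n) - frag_of (m', n) | m m' n.
         m \<in> carrier M \<and> m' \<in> carrier M \<and> n \<in> carrier N} \<union>
      {frag_of (m, n \<oplus>\<^bsub>N\<^esub> n') - frag_of (m, n) - frag_of (m, n') | m n n'.
         m \<in> carrier M \<and> n \<in> carrier N \<and> n' \<in> carrier N} \<union>
      {frag_of (a \<odot>\<^bsub>M\<^esub> m, n) - frag_of (m, a \<odot>\<^bsub>N\<^esub> n) | a m n.
         a \<in> carrier R \<and> m \<in> carrier M \<and> n \<in> carrier N}"
  shows "g \<in> carrier (free_Abelian_group (carrier M \<times> carrier N))"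
proof -
  have M': "m \<oplus>\<^bsub>M\<^esub> m' \<in> carrier M" if "m \<in> carrier M" "m' \<in> carrier M" for m m'
    using assms(1) that by (auto simp: premodule_def)
  have M'': "a \<odot>\<^bsub>M\<^esub> m \<in> carrier M" if "m \<in> carrier M" "a \<in> carrier R" for m a
    using assms(1) that by (auto simp: premodule_def)
  have N': "m \<oplus>\<^bsub>N\<^esub> m' \<in> carrier N" if "m \<in> carrier N" "m' \<in> carrier N" for m m'
    using assms(2) that by (auto simp: premodule_def)
  have N'': "a \<odot>\<^bsub>N\<^esub> m \<in> carrier N" if "m \<in> carrier N" "a \<in> carrier R" for m a
    using assms(2) that by (auto simp: premodule_def)
  show ?thesis
    unfolding carrier_free_Abelian_group_iff
    using assms(3) M' M'' N' N''
    by (elim UnE CollectE exE conjE) (simp only:, rule keys_frag_of_diff; blast)+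
qed

text \<open>A single case for differences replaces the cases for inverses and products of
  \<open>generate\<close>: in additive notation the inverse of h is 0 - h, and h + h' is h - (0 -
  h').\<close>

lemma tensor_relations_induct [consumes 3, case_names zero diff add_left add_right smult]:
  assumes "premodule R M" "premodule R N" "k \<in> tensor_relations R M N"
    and "P 0" "\<And>x y. P x \<Longrightarrow> P y \<Longrightarrow> P (x - y)"
    and "\<And>m m' n. m \<in> carrier M \<Longrightarrow> m' \<in> carrier M \<Longrightarrow> n \<in> carrier N \<Longrightarrow>
           P (frag_of (m \<oplus>\<^bsub>M\<^esub> m', n) - frag_of (m, n) - frag_of (m', n))"
    and "\<And>m n n'. m \<in> carrier M \<Longrightarrow> n \<in> carrier N \<Longrightarrow> n' \<in> carrier N \<Longrightarrow>
           P (frag_of (m, n \<oplus>\<^bsub>N\<^esub> n') - frag_of (m, n) - frag_of (m, n'))"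
    and "\<And>a m n. a \<in> carrier R \<Longrightarrow> m \<in> carrier M \<Longrightarrow> n \<in> carrier N \<Longrightarrow>
           P (frag_of (a \<odot>\<^bsub>M\<^esub> m, n) - frag_of (m, a \<odot>\<^bsub>N\<^esub> n))"
  shows "P k"
proof -
  let ?F = "free_Abelian_group (carrier M \<times> carrier N)"
  let ?G = "{frag_of (m \<oplus>\<^bsub>M\<^esub> m', n) - frag_of (m, n) - frag_of (m', n) | m m' n.
         m \<in> carrier M \<and> m' \<in> carrier M \<and> n \<in> carrier N} \<union>
      {frag_of (m, n \<oplus>\<^bsub>N\<^esub> n') - frag_of (m, n) - frag_of (m, n') | m n n'.
         m \<in> carrier M \<and> n \<in> carrier N \<and> n' \<in> carrier N} \<union>
      {frag_of (a \<odot>\<^bsub>M\<^esub> m, n) - frag_of (m, a \<odot>\<^bsub>N\<^esub> n) | a m n.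
         a \<in> carrier R \<and> m \<in> carrier M \<and> n \<in> carrier N}"
  have G: "P g" "Poly_Mapping.keys g \<subseteq> carrier M \<times> carrier N" if "g \<in> ?G" for g
  proof -
    show "P g" using that assms(6-8) by blast
    show "Poly_Mapping.keys g \<subseteq> carrier M \<times> carrier N"
      using tensor_generators_carrier[OF assms(1,2)] that by simp
  qed
  have "k \<in> generate ?F ?G" using assms(3) by (simp add: tensor_relations_def)
  then show "P k"
  proof (induction rule: generate.induct)
    case one then show ?case using assms(4) by simp
  next
    case (incl h) then show ?case by (rule G(1))
  next
    case (inv h)
    then have "inv\<^bsub>?F\<^esub> h = 0 - h" using G by simp
    then show ?case using assms(4,5) G(1)[OF inv] by metis
  next
    case (eng h1 h2)
    have "h1 \<otimes>\<^bsub>?F\<^esub> h2 = h1 - (0 - h2)" by simp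
    then show ?case using assms(4,5) eng by metis
  qed
qed

lemma tensor_relations_generators:
  "m \<in> carrier M \<Longrightarrow> m' \<in> carrier M \<Longrightarrow> n \<in> carrier N \<Longrightarrow>
     frag_of (m \<oplus>\<^bsub>M\<^esub> m', n) - frag_of (m, n) - frag_of (m', n) \<in> tensor_relations R M N"
  "m \<in> carrier M \<Longrightarrow> n \<in> carrier N \<Longrightarrow> n' \<in> carrier N \<Longrightarrow>
     frag_of (m, n \<oplus>\<^bsub>N\<^esub> n') - frag_of (m, n) - frag_of (m, n') \<in> tensor_relations R M N"
  "a \<in> carrier R \<Longrightarrow> m \<in> carrier M \<Longrightarrow> n \<in> carrier N \<Longrightarrow>
     frag_of (a \<odot>\<^bsub>M\<^esub> m, n) - frag_of (m, a \<odot>\<^bsub>N\<^esub> n) \<in> tensor_relations R M N"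
  unfolding tensor_relations_def by (rule generate.incl, blast)+

section \<open>Classes of formal sums modulo the bilinearity relations\<close>

locale premodule_pair =
  fixes R :: "('r, 'z) ring_scheme" and M :: "('r, 'm) module" and N :: "('r, 'n) module"
  assumes premodules: "premodule R M" "premodule R N"
begin

abbreviation frags :: "('m \<times> 'n \<Rightarrow>\<^sub>0 int) monoid" where
  "frags \<equiv> free_Abelian_group (carrier M \<times> carrier N)"

text \<open>Formed for every formal sum, not only for those supported on the carriers. Thus equality
  of classes is membership of a difference, with no side conditions.\<close>

definition tcl :: "('m \<times> 'n \<Rightarrow>\<^sub>0 int) \<Rightarrow> ('m, 'n) tensor" where
  "tcl k = tensor_relations R M N #>\<^bsub>frags\<^esub> k"

lemma subgroup_relations: "subgroup (tensor_relations R M N) frags"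
  unfolding tensor_relations_def
  by (rule group.generate_is_subgroup[OF group_free_Abelian_group])
    (intro subsetI tensor_generators_carrier[OF premodules], assumption)

lemma relations_carrier: "k \<in> tensor_relations R M N \<Longrightarrow> Poly_Mapping.keys k \<subseteq> carrier M \<times> carrier N"
  by (metis carrier_free_Abelian_group_iff subgroup.mem_carrier subgroup_relations)

lemma relations_0: "0 \<in> tensor_relations R M N"
  using subgroup.one_closed[OF subgroup_relations] by simp

lemma relations_add:
  "k \<in> tensor_relations R M N \<Longrightarrow> l \<in> tensor_relations R M N \<Longrightarrow> k + l \<in> tensor_relations R M N"
  using subgroup.m_closed[OF subgroup_relations] by simp

lemma relations_minus: "k \<in> tensor_relations R M N \<Longrightarrow> - k \<in> tensor_relations R M N"
  using subgroup.m_inv_closed[OF subgroup_relations] relations_carrier by fastforce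

lemma relations_diff:
  "k \<in> tensor_relations R M N \<Longrightarrow> l \<in> tensor_relations R M N \<Longrightarrow> k - l \<in> tensor_relations R M N"
  using relations_add relations_minus by fastforce

lemma in_tcl_iff: "l \<in> tcl k \<longleftrightarrow> l - k \<in> tensor_relations R M N"
  unfolding tcl_def r_coset_def by (auto simp: algebra_simps intro!: bexI[of _ "l - k"])

lemma self_in_tcl: "k \<in> tcl k"
  by (simp add: in_tcl_iff relations_0)

lemma tcl_eq_iff: "tcl k = tcl l \<longleftrightarrow> k - l \<in> tensor_relations R M N"
proof
  assume "tcl k = tcl l" then show "k - l \<in> tensor_relations R M N"
    using self_in_tcl in_tcl_iff by blast
next
  assume kl: "k - l \<in> tensor_relations R M N"
  have "x - k \<in> tensor_relations R M N \<longleftrightarrow> x - l \<in> tensor_relations R M N" for x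
    using relations_add[of "x - k" "k - l"] relations_diff[of "x - l" "k - l"] kl by auto
  then show "tcl k = tcl l" by (auto simp: in_tcl_iff)
qed

lemma normal_relations: "tensor_relations R M N \<lhd> frags"
  using comm_group.subgroup_imp_normal[OF abelian_free_Abelian_group subgroup_relations] .

lemma carrier_tensor_module:
  "carrier (tensor_module R M N) = tcl ` {k. Poly_Mapping.keys k \<subseteq> carrier M \<times> carrier N}"
  unfolding tensor_module_def Let_def mk_module_def FactGroup_def RCOSETS_def
  by (auto simp: tcl_def)

lemma zero_tensor_module: "\<zero>\<^bsub>tensor_module R M N\<^esub> = tcl 0"
proof -
  have "tcl 0 = tensor_relations R M N"
    by (rule Set.set_eqI) (simp add: in_tcl_iff)
  then show ?thesis
    unfolding tensor_module_def Let_def mk_module_def FactGroup_def by simp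
qed

lemma add_tensor_module:
  assumes "Poly_Mapping.keys k \<subseteq> carrier M \<times> carrier N" "Poly_Mapping.keys l \<subseteq> carrier M \<times> carrier N"
  shows "tcl k \<oplus>\<^bsub>tensor_module R M N\<^esub> tcl l = tcl (k + l)"
  using normal.rcos_sum[OF normal_relations, of k l] assms
  unfolding tensor_module_def Let_def mk_module_def FactGroup_def by (simp add: tcl_def)

lemma tcl_pure_add_left:
  "m \<in> carrier M \<Longrightarrow> m' \<in> carrier M \<Longrightarrow> n \<in> carrier N \<Longrightarrow>
     tcl (frag_of (m \<oplus>\<^bsub>M\<^esub> m', n)) = tcl (frag_of (m, n) + frag_of (m', n))"
  using tensor_relations_generators(1)[of m M m' n N R] by (simp add: tcl_eq_iff diff_diff_eq)

lemma tcl_pure_add_right: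
  "m \<in> carrier M \<Longrightarrow> n \<in> carrier N \<Longrightarrow> n' \<in> carrier N \<Longrightarrow>
     tcl (frag_of (m, n \<oplus>\<^bsub>N\<^esub> n')) = tcl (frag_of (m, n) + frag_of (m, n'))"
  using tensor_relations_generators(2)[of m M n N n' R] by (simp add: tcl_eq_iff diff_diff_eq)

lemma tcl_pure_smult:
  "a \<in> carrier R \<Longrightarrow> m \<in> carrier M \<Longrightarrow> n \<in> carrier N \<Longrightarrow>
     tcl (frag_of (a \<odot>\<^bsub>M\<^esub> m, n)) = tcl (frag_of (m, a \<odot>\<^bsub>N\<^esub> n))"
  using tensor_relations_generators(3)[of a R m M n N] by (simp add: tcl_eq_iff)

text \<open>With x the symbol of (0, n), the additivity relation for 0 + 0 = 0 is x - x - x = -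
  x.\<close>

lemma tcl_pure_zero_left:
  assumes "n \<in> carrier N" shows "tcl (frag_of (\<zero>\<^bsub>M\<^esub>, n)) = tcl 0"
  using tensor_relations_generators(1)[of "\<zero>\<^bsub>M\<^esub>" M "\<zero>\<^bsub>M\<^esub>" n N R] premodules(1) assms
  by (auto simp: premodule_def tcl_eq_iff dest: relations_minus)

lemma tcl_pure_zero_right:
  assumes "m \<in> carrier M" shows "tcl (frag_of (m, \<zero>\<^bsub>N\<^esub>)) = tcl 0"
  using tensor_relations_generators(2)[of m M "\<zero>\<^bsub>N\<^esub>" N "\<zero>\<^bsub>N\<^esub>" R] premodules(2) assms
  by (auto simp: premodule_def tcl_eq_iff dest: relations_minus)

text \<open>Generators go to generators of the same kind; in the last kind the scalar
  \<open>a\<close> is replaced by \<open>\<rho> a\<close>.\<close>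

lemma frag_map2_relations:
  assumes "semilinear S R \<rho> M' M \<phi>" "semilinear S R \<rho> N' N \<psi>"
    and "premodule S M'" "premodule S N'" "k \<in> tensor_relations S M' N'"
  shows "frag_map2 \<phi> \<psi> k \<in> tensor_relations R M N"
  using assms(3-5)
proof (induction rule: tensor_relations_induct)
  case zero then show ?case by (simp add: relations_0)
next
  case (diff x y) then show ?case by (simp add: frag_extend_diff relations_diff)
next
  case (add_left m m' n) then show ?case
    using assms(1,2) by (auto simp: frag_extend_diff semilinear_def Pi_iff intro!: tensor_relations_generators)
next
  case (add_right m n n') then show ?case
    using assms(1,2) by (auto simp: frag_extend_diff semilinear_def Pi_iff intro!: tensor_relations_generators)
next
  case (smult a m n) then show ?case
    using assms(1,2) by (auto simp: frag_extend_diff semilinear_def Pi_iff intro!: tensor_relations_generators)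
qed

lemma tensor_hom_tcl:
  assumes "semilinear S R \<rho> M' M \<phi>" "semilinear S R \<rho> N' N \<psi>"
    and "premodule S M'" "premodule S N'"
  shows "tensor_hom R M N \<phi> \<psi> (premodule_pair.tcl S M' N' k) = tcl (frag_map2 \<phi> \<psi> k)"
proof -
  interpret P: premodule_pair S M' N' by unfold_locales fact+
  have "tcl (frag_map2 \<phi> \<psi> l) = tcl (frag_map2 \<phi> \<psi> k)" if "l \<in> P.tcl k" for l
    using frag_map2_relations[OF assms, of "l - k"] that
    by (simp add: tcl_eq_iff P.in_tcl_iff frag_extend_diff)
  then have "(\<Union>l\<in>P.tcl k. tcl (frag_map2 \<phi> \<psi> l)) = (\<Union>l\<in>P.tcl k. tcl (frag_map2 \<phi> \<psi> k))"
    by (intro SUP_cong) simp_all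
  also have "\<dots> = tcl (frag_map2 \<phi> \<psi> k)"
    using P.self_in_tcl[of k] by (metis UN_constant empty_iff)
  finally show ?thesis by (simp only: tensor_hom_def tcl_def)
qed

text \<open>Scalars act through the left factor. Multiplication by \<open>a\<close> has to be linear
  there, which follows from the axioms of a module over a commutative ring but not from those of a
  premodule; hence the hypothesis.\<close>

lemma smult_tensor_module:
  assumes "semilinear R R (\<lambda>b. b) M M (\<lambda>m. a \<odot>\<^bsub>M\<^esub> m)"
  shows "a \<odot>\<^bsub>tensor_module R M N\<^esub> tcl k = tcl (frag_map2 (\<lambda>m. a \<odot>\<^bsub>M\<^esub> m) (\<lambda>n. n) k)"
proof -
  have "semilinear R R (\<lambda>b. b) N N (\<lambda>n. n)" by (auto simp: semilinear_def)
  from tensor_hom_tcl[OF assms this premodules]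
  show ?thesis unfolding tensor_module_def Let_def mk_module_def by simp
qed

text \<open>If \<open>n\<^sub>0\<close> generates \<open>N\<close>, scalars move to the left by m
  \<otimes> a n = a m \<otimes> n and the sum collects there. Induction over formal sums produces
  differences, so \<open>M\<close> must have negatives, which premodules do not provide. The lemma
  makes tensors with a line bundle or its dual locally pure.\<close>

lemma tcl_cyclic:
  assumes neg: "\<And>m. m \<in> carrier M \<Longrightarrow> \<exists>m'\<in>carrier M. m \<oplus>\<^bsub>M\<^esub> m' = \<zero>\<^bsub>M\<^esub>"
    and n0: "n\<^sub>0 \<in> carrier N" and cyc: "\<And>n. n \<in> carrier N \<Longrightarrow> \<exists>a\<in>carrier R. n = a \<odot>\<^bsub>N\<^esub> n\<^sub>0"
    and k: "Poly_Mapping.keys k \<subseteq> carrier M \<times> carrier N"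
  shows "\<exists>m\<in>carrier M. tcl k = tcl (frag_of (m, n\<^sub>0))"
  using k
proof (induction k rule: frag_induction)
  case zero
  then show ?case using tcl_pure_zero_left[OF n0] premodules(1) by (auto simp: premodule_def)
next
  case (one x)
  obtain m n where x: "x = (m, n)" "m \<in> carrier M" "n \<in> carrier N" using one by auto
  obtain a where a: "a \<in> carrier R" "n = a \<odot>\<^bsub>N\<^esub> n\<^sub>0" using cyc x by blast
  then show ?case
    using tcl_pure_smult[OF a(1) x(2) n0] x premodules(1)
    by (intro bexI[of _ "a \<odot>\<^bsub>M\<^esub> m"]) (auto simp: premodule_def)
next
  case (diff k l)
  then obtain m m' where m: "m \<in> carrier M" "tcl k = tcl (frag_of (m, n\<^sub>0))"
    "m' \<in> carrier M" "tcl l = tcl (frag_of (m', n\<^sub>0))" by blast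
  obtain m'' where m'': "m'' \<in> carrier M" "m' \<oplus>\<^bsub>M\<^esub> m'' = \<zero>\<^bsub>M\<^esub>" using neg m by blast
  have 1: "k - frag_of (m, n\<^sub>0) \<in> tensor_relations R M N" "l - frag_of (m', n\<^sub>0) \<in> tensor_relations R M N"
    using m by (simp_all add: tcl_eq_iff)
  have 2: "frag_of (m', n\<^sub>0) + frag_of (m'', n\<^sub>0) \<in> tensor_relations R M N"
    using tcl_pure_add_left[of m' m'' n\<^sub>0] tcl_pure_zero_left[OF n0] m m'' n0
    by (metis diff_zero tcl_eq_iff)
  have 3: "frag_of (m, n\<^sub>0) + frag_of (m'', n\<^sub>0) - frag_of (m \<oplus>\<^bsub>M\<^esub> m'', n\<^sub>0) \<in> tensor_relations R M N"
    using tcl_pure_add_left[of m m'' n\<^sub>0] m m'' n0 by (metis tcl_eq_iff)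
  \<comment> \<open>Subtracting m' is replaced by adding its negative m''. After cancellation of the
    inserted symbols both sides agree, and each bracket is a relation already known.\<close>
  have "k - l - frag_of (m \<oplus>\<^bsub>M\<^esub> m'', n\<^sub>0) =
      (k - frag_of (m, n\<^sub>0)) - (l - frag_of (m', n\<^sub>0)) - (frag_of (m', n\<^sub>0) + frag_of (m'', n\<^sub>0))
      + (frag_of (m, n\<^sub>0) + frag_of (m'', n\<^sub>0) - frag_of (m \<oplus>\<^bsub>M\<^esub> m'', n\<^sub>0))" by simp
  also have "\<dots> \<in> tensor_relations R M N"
    by (rule relations_add[OF relations_diff[OF relations_diff[OF 1] 2] 3])
  finally have "tcl (k - l) = tcl (frag_of (m \<oplus>\<^bsub>M\<^esub> m'', n\<^sub>0))" by (simp add: tcl_eq_iff)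
  then show ?case using m m'' premodules(1) by (auto simp: premodule_def)
qed

end

text \<open>
  Modulo \<open>N\<close> every \<open>m\<close> is a multiple of \<open>e\<close> by the fraction \<open>- b / a\<close>, which yields a functional
  on \<open>M\<close> with values in the field of fractions that does not vanish at \<open>e\<close>.
\<close>

lemma (in Module.module) maximal_complement_of_line:
  assumes e: "e \<in> carrier M" and tf: "\<And>a. a \<in> carrier R \<Longrightarrow> a \<odot>\<^bsub>M\<^esub> e = \<zero>\<^bsub>M\<^esub> \<Longrightarrow> a = \<zero>"
    and nontriv: "\<one> \<noteq> \<zero>"
  shows "\<exists>N. submodule N R M \<and> (\<forall>b\<in>carrier R. b \<odot>\<^bsub>M\<^esub> e \<in> N \<longrightarrow> b = \<zero>) \<and>
     (\<forall>m\<in>carrier M. \<exists>a\<in>carrier R. \<exists>b\<in>carrier R. a \<noteq> \<zero> \<and> a \<odot>\<^bsub>M\<^esub> m \<oplus>\<^bsub>M\<^esub> b \<odot>\<^bsub>M\<^esub> e \<in> N)"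
proof -
  \<comment> \<open>Submodules containing b e for no b other than zero. Torsion-freeness of
    \<open>e\<close> puts the zero submodule among them, and unions of nonempty chains stay among
    them.\<close>
  define \<S> where "\<S> = {N. submodule N R M \<and> (\<forall>b\<in>carrier R. b \<odot>\<^bsub>M\<^esub> e \<in> N \<longrightarrow> b = \<zero>)}"
  have sub0: "submodule {\<zero>\<^bsub>M\<^esub>} R M" by (rule submoduleI) auto
  then have ne: "\<S> \<noteq> {}" unfolding \<S>_def using tf by auto
  have chain: "\<Union>\<C> \<in> \<S>" if C: "\<C> \<noteq> {}" "subset.chain \<S> \<C>" for \<C>
  proof -
    have CS: "N \<in> \<S>" if "N \<in> \<C>" for N using C that by (auto simp: subset.chain_def)
    have tot: "N \<subseteq> N' \<or> N' \<subseteq> N" if "N \<in> \<C>" "N' \<in> \<C>" for N N'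
      using C that by (auto simp: subset.chain_def)
    have sm: "submodule N R M" if "N \<in> \<C>" for N using CS[OF that] by (simp add: \<S>_def)
    have "submodule (\<Union>\<C>) R M"
    proof (rule submoduleI)
      show "\<Union>\<C> \<subseteq> carrier M" using submoduleE(1)[OF sm] by blast
      show "\<zero>\<^bsub>M\<^esub> \<in> \<Union>\<C>" using C(1) sm subgroup.one_closed[OF submodule.axioms(1)] by fastforce
      show "\<ominus>\<^bsub>M\<^esub> a \<in> \<Union>\<C>" if "a \<in> \<Union>\<C>" for a using submoduleE(3)[OF sm] that by blast
      show "a \<oplus>\<^bsub>M\<^esub> b \<in> \<Union>\<C>" if "a \<in> \<Union>\<C>" "b \<in> \<Union>\<C>" for a b
        using submoduleE(5)[OF sm] that tot by (smt (verit) UnionE UnionI subsetD)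
      show "a \<odot>\<^bsub>M\<^esub> x \<in> \<Union>\<C>" if "a \<in> carrier R" "x \<in> \<Union>\<C>" for a x
        using submoduleE(4)[OF sm] that by blast
    qed
    then show ?thesis using CS by (auto simp: \<S>_def)
  qed
  obtain N where N: "N \<in> \<S>" and max: "\<And>N'. N' \<in> \<S> \<Longrightarrow> N \<subseteq> N' \<Longrightarrow> N' = N"
    using subset_Zorn_nonempty[OF ne chain] by blast
  have subN: "submodule N R M" and eN: "\<And>b. b \<in> carrier R \<Longrightarrow> b \<odot>\<^bsub>M\<^esub> e \<in> N \<Longrightarrow> b = \<zero>"
    using N by (auto simp: \<S>_def)
  note NE = submoduleE[OF subN]
  have N0: "\<zero>\<^bsub>M\<^esub> \<in> N" using subgroup.one_closed[OF submodule.axioms(1)[OF subN]] by simp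
  have "\<exists>a\<in>carrier R. \<exists>b\<in>carrier R. a \<noteq> \<zero> \<and> a \<odot>\<^bsub>M\<^esub> m \<oplus>\<^bsub>M\<^esub> b \<odot>\<^bsub>M\<^esub> e \<in> N"
    if m: "m \<in> carrier M" for m
  proof (cases "m \<in> N")
    case True
    then show ?thesis using nontriv e m
      by (intro bexI[of _ \<one>] bexI[of _ \<zero>]) auto
  next
    case False
    \<comment> \<open>The submodule N + R m is strictly larger, so by maximality it contains b e for
      some nonzero b.\<close>
    define N' where "N' = {n \<oplus>\<^bsub>M\<^esub> a \<odot>\<^bsub>M\<^esub> m | n a. n \<in> N \<and> a \<in> carrier R}"
    have sub': "submodule N' R M"
    proof (rule submoduleI)
      show "N' \<subseteq> carrier M" using NE(1) m by (auto simp: N'_def)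
      show "\<zero>\<^bsub>M\<^esub> \<in> N'" unfolding N'_def using N0 m
        by (intro CollectI exI[of _ "\<zero>\<^bsub>M\<^esub>"] exI[of _ \<zero>]) auto
      show "\<ominus>\<^bsub>M\<^esub> x \<in> N'" if "x \<in> N'" for x
      proof -
        obtain n a where x: "x = n \<oplus>\<^bsub>M\<^esub> a \<odot>\<^bsub>M\<^esub> m" "n \<in> N" "a \<in> carrier R" using \<open>x \<in> N'\<close> N'_def by auto
        then have "\<ominus>\<^bsub>M\<^esub> x = \<ominus>\<^bsub>M\<^esub> n \<oplus>\<^bsub>M\<^esub> (\<ominus> a) \<odot>\<^bsub>M\<^esub> m"
          using NE(1) m by (simp add: subset_iff M.minus_add smult_l_minus M.a_comm)
        then show ?thesis using x NE(3) unfolding N'_def by blast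
      qed
      show "x \<oplus>\<^bsub>M\<^esub> y \<in> N'" if xy: "x \<in> N'" "y \<in> N'" for x y
      proof -
        obtain n a where x: "x = n \<oplus>\<^bsub>M\<^esub> a \<odot>\<^bsub>M\<^esub> m" "n \<in> N" "a \<in> carrier R" using xy N'_def by auto
        obtain n' a' where y: "y = n' \<oplus>\<^bsub>M\<^esub> a' \<odot>\<^bsub>M\<^esub> m" "n' \<in> N" "a' \<in> carrier R" using xy N'_def by auto
        have "x \<oplus>\<^bsub>M\<^esub> y = (n \<oplus>\<^bsub>M\<^esub> n') \<oplus>\<^bsub>M\<^esub> (a \<oplus> a') \<odot>\<^bsub>M\<^esub> m"
          using NE(1) m x y by (simp add: subset_iff smult_l_distr M.a_ac)
        then show ?thesis using x y NE(5) unfolding N'_def by blast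
      qed
      show "c \<odot>\<^bsub>M\<^esub> x \<in> N'" if c: "c \<in> carrier R" "x \<in> N'" for c x
      proof -
        obtain n a where x: "x = n \<oplus>\<^bsub>M\<^esub> a \<odot>\<^bsub>M\<^esub> m" "n \<in> N" "a \<in> carrier R" using c N'_def by auto
        then have "c \<odot>\<^bsub>M\<^esub> x = c \<odot>\<^bsub>M\<^esub> n \<oplus>\<^bsub>M\<^esub> (c \<otimes> a) \<odot>\<^bsub>M\<^esub> m"
          using NE(1) m c by (simp add: subset_iff smult_r_distr smult_assoc1)
        then show ?thesis using x c NE(4) unfolding N'_def by blast
      qed
    qed
    have "N \<subseteq> N'"
    proof
      fix n assume "n \<in> N"
      then show "n \<in> N'" unfolding N'_def using NE(1) m
        by (intro CollectI exI[of _ n] exI[of _ \<zero>]) auto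
    qed
    moreover have "m \<in> N'" unfolding N'_def using N0 m
      by (intro CollectI exI[of _ "\<zero>\<^bsub>M\<^esub>"] exI[of _ \<one>]) auto
    ultimately have "N' \<notin> \<S>" using max False by metis
    then obtain b where b: "b \<in> carrier R" "b \<odot>\<^bsub>M\<^esub> e \<in> N'" "b \<noteq> \<zero>" using sub' by (auto simp: \<S>_def)
    then obtain n a where na: "b \<odot>\<^bsub>M\<^esub> e = n \<oplus>\<^bsub>M\<^esub> a \<odot>\<^bsub>M\<^esub> m" "n \<in> N" "a \<in> carrier R" by (auto simp: N'_def)
    \<comment> \<open>Otherwise b e = n would lie in \<open>N\<close>.\<close>
    have "a \<noteq> \<zero>"
    proof
      assume "a = \<zero>"
      then have "b \<odot>\<^bsub>M\<^esub> e \<in> N" using na m NE(1) by auto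
      then show False using b eN by blast
    qed
    moreover have "a \<odot>\<^bsub>M\<^esub> m \<oplus>\<^bsub>M\<^esub> (\<ominus> b) \<odot>\<^bsub>M\<^esub> e = \<ominus>\<^bsub>M\<^esub> n"
    proof -
      have c: "n \<in> carrier M" "a \<odot>\<^bsub>M\<^esub> m \<in> carrier M" using na m NE(1) by auto
      have "a \<odot>\<^bsub>M\<^esub> m \<oplus>\<^bsub>M\<^esub> (\<ominus> b) \<odot>\<^bsub>M\<^esub> e = a \<odot>\<^bsub>M\<^esub> m \<oplus>\<^bsub>M\<^esub> \<ominus>\<^bsub>M\<^esub> (n \<oplus>\<^bsub>M\<^esub> a \<odot>\<^bsub>M\<^esub> m)"
        using b e na by (simp add: smult_l_minus)
      also have "\<dots> = \<ominus>\<^bsub>M\<^esub> n" using c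
        by (simp add: M.minus_add M.a_comm[of "\<ominus>\<^bsub>M\<^esub> n"] M.a_assoc[symmetric] M.r_neg)
      finally show ?thesis .
    qed
    ultimately show ?thesis using na b NE(3) by (intro bexI[of _ a] bexI[of _ "\<ominus> b"]) auto
  qed
  then show ?thesis using subN eN by blast
qed

section \<open>Germs and sheafification\<close>

lemma carrier_function_ring [simp]: "carrier (function_ring X U) = regular X U"
  by (simp add: function_ring_def)

locale function_space =
  fixes X :: "'p space_with_functions"
  assumes regular_extensional: "space_open X U \<Longrightarrow> f \<in> regular X U \<Longrightarrow> f \<in> extensional U"
    and regular_const: "space_open X U \<Longrightarrow> (\<lambda>x\<in>U. c) \<in> regular X U"
    and regular_add: "space_open X U \<Longrightarrow> f \<in> regular X U \<Longrightarrow> g \<in> regular X U \<Longrightarrow>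
          (\<lambda>x\<in>U. f x + g x) \<in> regular X U"
    and regular_mult: "space_open X U \<Longrightarrow> f \<in> regular X U \<Longrightarrow> g \<in> regular X U \<Longrightarrow>
          (\<lambda>x\<in>U. f x * g x) \<in> regular X U"
    and regular_restrict: "space_open X U \<Longrightarrow> space_open X V \<Longrightarrow> V \<subseteq> U \<Longrightarrow> f \<in> regular X U \<Longrightarrow>
          restrict f V \<in> regular X V"
    and regular_local: "space_open X U \<Longrightarrow> f \<in> extensional U \<Longrightarrow>
          (\<And>x. x \<in> U \<Longrightarrow> \<exists>V. space_open X V \<and> x \<in> V \<and> V \<subseteq> U \<and> restrict f V \<in> regular X V) \<Longrightarrow>
          f \<in> regular X U"

text \<open>Germs depend only on restriction being functorial. Keeping this apart from the algebra
  allows germs of tensor presheaves to be used where only premodules are given, as in (E \<otimes>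
  T) \<otimes> T.\<close>

definition set_presheaf ::
    "'p space_with_functions \<Rightarrow> ('p, 'm) module_presheaf \<Rightarrow> bool" where
  "set_presheaf X F \<longleftrightarrow>
     (\<forall>U V. space_open X U \<and> space_open X V \<and> V \<subseteq> U \<longrightarrow>
        res F U V \<in> sections F U \<rightarrow> sections F V) \<and>
     (\<forall>U. space_open X U \<longrightarrow> (\<forall>s\<in>sections F U. res F U U s = s)) \<and>
     (\<forall>U V W. space_open X U \<and> space_open X V \<and> space_open X W \<and> W \<subseteq> V \<and> V \<subseteq> U \<longrightarrow>
        (\<forall>s\<in>sections F U. res F V W (res F U V s) = res F U W s))"

text \<open>
  The closure and compatibility properties that computing with germs requires. For the iterated
  tensor product \<open>(E \<otimes> T) \<otimes> T\<close> this spares us the module axioms of sheafified tensor products.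
\<close>

definition prelinear_presheaf ::
    "'p space_with_functions \<Rightarrow> ('p, 'm) module_presheaf \<Rightarrow> bool" where
  "prelinear_presheaf X F \<longleftrightarrow> set_presheaf X F \<and>
     (\<forall>U. space_open X U \<longrightarrow> premodule (function_ring X U) (sec F U)) \<and>
     (\<forall>U V. space_open X U \<and> space_open X V \<and> V \<subseteq> U \<longrightarrow>
        semilinear (function_ring X U) (function_ring X V) (\<lambda>f. restrict f V)
          (sec F U) (sec F V) (res F U V) \<and>
        res F U V \<zero>\<^bsub>sec F U\<^esub> = \<zero>\<^bsub>sec F V\<^esub>)"

text \<open>Preservation of zero is not among the axioms of a presheaf of modules: it follows
  because x = x + x forces x = 0 in an abelian group.\<close>

lemma (in function_space) prelinear_if_presheaf_of_modules:
  assumes F: "presheaf_of_modules X F" shows "prelinear_presheaf X F"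
proof -
  have mod: "Module.module (function_ring X U) (sec F U)" if "space_open X U" for U
    using F that by (simp add: presheaf_of_modules_def)
  have zero: "res F U V \<zero>\<^bsub>sec F U\<^esub> = \<zero>\<^bsub>sec F V\<^esub>"
    if UV: "space_open X U" "space_open X V" "V \<subseteq> U" for U V
  proof -
    interpret U: abelian_group "sec F U" using mod[OF UV(1)] by (simp add: Module.module_def)
    interpret V: abelian_group "sec F V" using mod[OF UV(2)] by (simp add: Module.module_def)
    have c: "res F U V \<zero>\<^bsub>sec F U\<^esub> \<in> sections F V"
      using F UV funcset_mem[of "res F U V" "sections F U"] by (simp add: presheaf_of_modules_def)
    have "res F U V (\<zero>\<^bsub>sec F U\<^esub> \<oplus>\<^bsub>sec F U\<^esub> \<zero>\<^bsub>sec F U\<^esub>) =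
        res F U V \<zero>\<^bsub>sec F U\<^esub> \<oplus>\<^bsub>sec F V\<^esub> res F U V \<zero>\<^bsub>sec F U\<^esub>"
      using F UV U.zero_closed by (simp add: presheaf_of_modules_def del: U.l_zero U.r_zero)
    then show ?thesis using c by simp
  qed
  have sl: "semilinear (function_ring X U) (function_ring X V) (\<lambda>f. restrict f V)
      (sec F U) (sec F V) (res F U V)" if UV: "space_open X U" "space_open X V" "V \<subseteq> U" for U V
    using F UV regular_restrict[OF UV] by (simp add: presheaf_of_modules_def semilinear_def Pi_iff)
  have "set_presheaf X F"
    using F by (simp add: presheaf_of_modules_def set_presheaf_def)
  then show ?thesis
    unfolding prelinear_presheaf_def using zero sl premodule_if_module[OF mod] by simp
qed

lemma prelinear_presheafD:
  assumes "prelinear_presheaf X F" "space_open X U"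
  shows "\<zero>\<^bsub>sec F U\<^esub> \<in> sections F U" "\<zero>\<^bsub>sec F U\<^esub> \<oplus>\<^bsub>sec F U\<^esub> \<zero>\<^bsub>sec F U\<^esub> = \<zero>\<^bsub>sec F U\<^esub>"
    "s \<in> sections F U \<Longrightarrow> t \<in> sections F U \<Longrightarrow> s \<oplus>\<^bsub>sec F U\<^esub> t \<in> sections F U"
    "f \<in> regular X U \<Longrightarrow> s \<in> sections F U \<Longrightarrow> f \<odot>\<^bsub>sec F U\<^esub> s \<in> sections F U"
    "premodule (function_ring X U) (sec F U)"
  using assms unfolding prelinear_presheaf_def premodule_def by auto

lemma prelinear_presheaf_resD:
  assumes "prelinear_presheaf X F" "space_open X U" "space_open X V" "V \<subseteq> U"
  shows "s \<in> sections F U \<Longrightarrow> t \<in> sections F U \<Longrightarrow>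
       res F U V (s \<oplus>\<^bsub>sec F U\<^esub> t) = res F U V s \<oplus>\<^bsub>sec F V\<^esub> res F U V t"
    "f \<in> regular X U \<Longrightarrow> s \<in> sections F U \<Longrightarrow>
       res F U V (f \<odot>\<^bsub>sec F U\<^esub> s) = restrict f V \<odot>\<^bsub>sec F V\<^esub> res F U V s"
    "res F U V \<zero>\<^bsub>sec F U\<^esub> = \<zero>\<^bsub>sec F V\<^esub>"
    "semilinear (function_ring X U) (function_ring X V) (\<lambda>f. restrict f V)
       (sec F U) (sec F V) (res F U V)"
  using assms unfolding prelinear_presheaf_def semilinear_def by auto

lemma set_presheafD:
  assumes "set_presheaf X F"
  shows "space_open X U \<Longrightarrow> space_open X V \<Longrightarrow> V \<subseteq> U \<Longrightarrow> s \<in> sections F U \<Longrightarrow> res F U V s \<in> sections F V"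
    "space_open X U \<Longrightarrow> s \<in> sections F U \<Longrightarrow> res F U U s = s"
    "space_open X U \<Longrightarrow> space_open X V \<Longrightarrow> space_open X W \<Longrightarrow> W \<subseteq> V \<Longrightarrow> V \<subseteq> U \<Longrightarrow> s \<in> sections F U \<Longrightarrow>
       res F V W (res F U V s) = res F U W s"
  using assms by (simp_all add: set_presheaf_def Pi_iff)

lemma prelinear_imp_set_presheaf: "prelinear_presheaf X F \<Longrightarrow> set_presheaf X F"
  by (simp add: prelinear_presheaf_def)

text \<open>A germ is the set of all pairs that agree with \<open>(U, s)\<close> near the point, so
  it is an equivalence class: transitivity holds because two witnessing neighbourhoods can be
  intersected.\<close>

lemma germ_eq_iff:
  assumes F: "set_presheaf X F" and s: "space_open X U" "x \<in> U" "s \<in> sections F U"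
    and t: "space_open X V" "x \<in> V" "t \<in> sections F V"
  shows "germ X F x U s = germ X F x V t \<longleftrightarrow>
    (\<exists>W. space_open X W \<and> x \<in> W \<and> W \<subseteq> U \<inter> V \<and> res F U W s = res F V W t)" (is "_ \<longleftrightarrow> ?R")
proof
  assume eq: "germ X F x U s = germ X F x V t"
  have "(V, t) \<in> germ X F x V t" using t by (auto simp: germ_def)
  then have "(V, t) \<in> germ X F x U s" using eq by simp
  then show ?R by (auto simp: germ_def)
next
  assume ?R
  then obtain W where W: "space_open X W" "x \<in> W" "W \<subseteq> U" "W \<subseteq> V" "res F U W s = res F V W t" by auto
  \<comment> \<open>One half of transitivity, to be used in both directions with the roles of
    \<open>s\<close> and \<open>t\<close> exchanged.\<close>
  have sub: "(\<exists>W'. space_open X W' \<and> x \<in> W' \<and> W' \<subseteq> V' \<inter> C \<and> res F V' W' t' = res F C W' c)"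
    if W: "space_open X W" "x \<in> W" "W \<subseteq> U'" "W \<subseteq> V'" "res F U' W s' = res F V' W t'"
      and o: "space_open X U'" "space_open X V'" "s' \<in> sections F U'" "t' \<in> sections F V'"
      and ex: "\<exists>W'. space_open X W' \<and> x \<in> W' \<and> W' \<subseteq> U' \<inter> C \<and> res F U' W' s' = res F C W' c"
      and c: "space_open X C" "c \<in> sections F C" for U' V' s' t' C c W
  proof -
    obtain W' where W': "space_open X W'" "x \<in> W'" "W' \<subseteq> U'" "W' \<subseteq> C" "res F U' W' s' = res F C W' c"
      using ex by auto
    have o': "space_open X (W \<inter> W')" using W W' by auto
    have "res F V' (W \<inter> W') t' = res F W (W \<inter> W') (res F V' W t')"
      using W o o' by (intro set_presheafD(3)[OF F, symmetric]) auto
    also have "\<dots> = res F U' (W \<inter> W') s'"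
      using W o o' by (simp add: set_presheafD(3)[OF F] flip: W(5))
    also have "\<dots> = res F W' (W \<inter> W') (res F U' W' s')"
      using W' o o' by (intro set_presheafD(3)[OF F, symmetric]) auto
    also have "\<dots> = res F C (W \<inter> W') c"
      using W' c o' by (simp add: set_presheafD(3)[OF F])
    finally show ?thesis using o' W W' by (intro exI[of _ "W \<inter> W'"]) auto
  qed
  have "(\<exists>W'. space_open X W' \<and> x \<in> W' \<and> W' \<subseteq> U \<inter> C \<and> res F U W' s = res F C W' c) \<longleftrightarrow>
      (\<exists>W'. space_open X W' \<and> x \<in> W' \<and> W' \<subseteq> V \<inter> C \<and> res F V W' t = res F C W' c)"
    if "space_open X C" "c \<in> sections F C" for C c
    using sub[OF W s(1) t(1) s(3) t(3) _ that] sub[OF W(1,2,4,3) W(5)[symmetric] t(1) s(1) t(3) s(3) _ that]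
    by (rule iffI)
  then show "germ X F x U s = germ X F x V t"
    unfolding germ_def by (intro Collect_cong) (simp del: Int_subset_iff add: split_def cong: conj_cong)
qed

lemma germ_restrict:
  assumes F: "set_presheaf X F" and "space_open X U" "space_open X V" "V \<subseteq> U" "x \<in> V" "s \<in> sections F U"
  shows "germ X F x V (res F U V s) = germ X F x U s"
  using assms by (subst germ_eq_iff[OF F])
    (auto intro!: exI[of _ V] simp: set_presheafD[OF F])

lemma germ_local:
  assumes F: "set_presheaf X F" and s: "space_open X U" "x \<in> U" "s \<in> sections F U"
    and t: "space_open X V" "x \<in> V" "t \<in> sections F V" and eq: "germ X F x U s = germ X F x V t"
  obtains W where "space_open X W" "x \<in> W" "W \<subseteq> U" "W \<subseteq> V" "res F U W s = res F V W t"
  using germ_eq_iff[OF F s t] eq by auto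

lemma mem_germ_iff:
  assumes F: "set_presheaf X F" and s: "space_open X U" "x \<in> U" "s \<in> sections F U"
  shows "(V, t) \<in> germ X F x U s \<longleftrightarrow>
    space_open X V \<and> x \<in> V \<and> t \<in> sections F V \<and> germ X F x V t = germ X F x U s"
proof -
  have "(V, t) \<in> germ X F x U s \<longleftrightarrow> space_open X V \<and> x \<in> V \<and> t \<in> sections F V \<and>
      (\<exists>W. space_open X W \<and> x \<in> W \<and> W \<subseteq> U \<inter> V \<and> res F U W s = res F V W t)"
    by (simp add: germ_def)
  then show ?thesis using germ_eq_iff[OF F s, of V t] by metis
qed

text \<open>The unions in the germ operations run over a nonempty family, since a germ contains its
  own representative. Independence of the representative therefore turns the union into the common
  value.\<close>

lemma UN_germ_eq:
  assumes F: "set_presheaf X F" and s: "space_open X U" "x \<in> U" "s \<in> sections F U"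
    and "\<And>V t. space_open X V \<Longrightarrow> x \<in> V \<Longrightarrow> t \<in> sections F V \<Longrightarrow>
           germ X F x V t = germ X F x U s \<Longrightarrow> h V t = c"
  shows "(\<Union>(V, t)\<in>germ X F x U s. h V t) = c"
proof -
  have ne: "(U, s) \<in> germ X F x U s" using s by (simp add: mem_germ_iff[OF F s])
  have "h V t = c" if "(V, t) \<in> germ X F x U s" for V t
    using that assms(5) by (simp add: mem_germ_iff[OF F s])
  then have "(\<Union>(V, t)\<in>germ X F x U s. h V t) = (\<Union>p\<in>germ X F x U s. c)"
    by (intro SUP_cong) auto
  then show ?thesis using ne by (metis UN_constant empty_iff)
qed

text \<open>Two representatives of the same germ coincide on a smaller neighbourhood, and sums
  commute with restriction to it.\<close>

lemma germ_add_germ: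
  assumes F: "prelinear_presheaf X F" and s: "space_open X U" "x \<in> U" "s \<in> sections F U"
    and t: "space_open X V" "x \<in> V" "t \<in> sections F V"
  shows "germ_add X F x (germ X F x U s) (germ X F x V t) =
    germ X F x (U \<inter> V) (res F U (U \<inter> V) s \<oplus>\<^bsub>sec F (U \<inter> V)\<^esub> res F V (U \<inter> V) t)"
  unfolding germ_add_def
proof (rule UN_germ_eq[OF prelinear_imp_set_presheaf[OF F] s], rule UN_germ_eq[OF prelinear_imp_set_presheaf[OF F] t])
  note sF = prelinear_imp_set_presheaf[OF F] and FD = prelinear_presheafD[OF F] and FR = prelinear_presheaf_resD[OF F]
  fix U' s' V' t'
  assume s': "space_open X U'" "x \<in> U'" "s' \<in> sections F U'" "germ X F x U' s' = germ X F x U s"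
    and t': "space_open X V'" "x \<in> V'" "t' \<in> sections F V'" "germ X F x V' t' = germ X F x V t"
  obtain W where W: "space_open X W" "x \<in> W" "W \<subseteq> U'" "W \<subseteq> U" "res F U' W s' = res F U W s"
    using germ_local[OF sF s'(1-3) s s'(4)] .
  obtain W' where W': "space_open X W'" "x \<in> W'" "W' \<subseteq> V'" "W' \<subseteq> V" "res F V' W' t' = res F V W' t"
    using germ_local[OF sF t'(1-3) t t'(4)] .
  have o: "space_open X (U' \<inter> V')" "space_open X (U \<inter> V)" "space_open X (W \<inter> W')"
    using s t s' t' W W' by auto
  have 1: "res F U' (W \<inter> W') s' = res F U (W \<inter> W') s"
    using set_presheafD(3)[OF sF, of U' W "W \<inter> W'" s'] set_presheafD(3)[OF sF, of U W "W \<inter> W'" s] W o s s' by simp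
  have 2: "res F V' (W \<inter> W') t' = res F V (W \<inter> W') t"
    using set_presheafD(3)[OF sF, of V' W' "W \<inter> W'" t'] set_presheafD(3)[OF sF, of V W' "W \<inter> W'" t] W' o t t' by simp
  have c: "res F U' (U' \<inter> V') s' \<in> sections F (U' \<inter> V')" "res F V' (U' \<inter> V') t' \<in> sections F (U' \<inter> V')"
    "res F U (U \<inter> V) s \<in> sections F (U \<inter> V)" "res F V (U \<inter> V) t \<in> sections F (U \<inter> V)"
    using s t s' t' o by (auto intro!: set_presheafD(1)[OF sF])
  have sub: "W \<inter> W' \<subseteq> U' \<inter> V'" "W \<inter> W' \<subseteq> U \<inter> V" using W W' by auto
  have "res F (U' \<inter> V') (W \<inter> W') (res F U' (U' \<inter> V') s' \<oplus>\<^bsub>sec F (U' \<inter> V')\<^esub> res F V' (U' \<inter> V') t')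
     = res F U' (W \<inter> W') s' \<oplus>\<^bsub>sec F (W \<inter> W')\<^esub> res F V' (W \<inter> W') t'"
    using FR(1)[OF o(1,3) sub(1) c(1,2)] o sub s' t' by (simp add: set_presheafD(3)[OF sF])
  moreover have "res F (U \<inter> V) (W \<inter> W') (res F U (U \<inter> V) s \<oplus>\<^bsub>sec F (U \<inter> V)\<^esub> res F V (U \<inter> V) t)
     = res F U (W \<inter> W') s \<oplus>\<^bsub>sec F (W \<inter> W')\<^esub> res F V (W \<inter> W') t"
    using FR(1)[OF o(2,3) sub(2) c(3,4)] o sub s t by (simp add: set_presheafD(3)[OF sF])
  ultimately show "germ X F x (U' \<inter> V') (res F U' (U' \<inter> V') s' \<oplus>\<^bsub>sec F (U' \<inter> V')\<^esub> res F V' (U' \<inter> V') t') =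
      germ X F x (U \<inter> V) (res F U (U \<inter> V) s \<oplus>\<^bsub>sec F (U \<inter> V)\<^esub> res F V (U \<inter> V) t)"
    using o sub s t s' t' c W W' 1 2
    by (subst germ_eq_iff[OF sF]) (auto intro!: FD exI[of _ "W \<inter> W'"])
qed

lemma germ_add_germ_same:
  assumes F: "prelinear_presheaf X F" and "space_open X U" "x \<in> U" "s \<in> sections F U" "t \<in> sections F U"
  shows "germ_add X F x (germ X F x U s) (germ X F x U t) = germ X F x U (s \<oplus>\<^bsub>sec F U\<^esub> t)"
  using germ_add_germ[OF assms(1-4,2,3,5)] assms
  by (simp add: set_presheafD(2)[OF prelinear_imp_set_presheaf[OF F]])

lemma (in function_space) germ_smult_germ:
  assumes F: "prelinear_presheaf X F" and f: "space_open X U" "x \<in> U" "f \<in> regular X U"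
    and s: "space_open X V" "x \<in> V" "s \<in> sections F V"
  shows "germ_smult X F x U f (germ X F x V s) =
    germ X F x (U \<inter> V) (restrict f (U \<inter> V) \<odot>\<^bsub>sec F (U \<inter> V)\<^esub> res F V (U \<inter> V) s)"
  unfolding germ_smult_def
proof (rule UN_germ_eq[OF prelinear_imp_set_presheaf[OF F] s])
  note sF = prelinear_imp_set_presheaf[OF F] and FD = prelinear_presheafD[OF F] and FR = prelinear_presheaf_resD[OF F]
  fix V' s'
  assume s': "space_open X V'" "x \<in> V'" "s' \<in> sections F V'" "germ X F x V' s' = germ X F x V s"
  obtain W where W: "space_open X W" "x \<in> W" "W \<subseteq> V'" "W \<subseteq> V" "res F V' W s' = res F V W s"
    using germ_local[OF sF s'(1-3) s s'(4)] .
  have o: "space_open X (U \<inter> V')" "space_open X (U \<inter> V)" "space_open X (U \<inter> W)"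
    using f s s' W by auto
  have 1: "res F V' (U \<inter> W) s' = res F V (U \<inter> W) s"
    using set_presheafD(3)[OF sF, of V' W "U \<inter> W" s'] set_presheafD(3)[OF sF, of V W "U \<inter> W" s] W o s s' by simp
  have c: "res F V' (U \<inter> V') s' \<in> sections F (U \<inter> V')" "res F V (U \<inter> V) s \<in> sections F (U \<inter> V)"
    using s s' o by (auto intro!: set_presheafD(1)[OF sF])
  have r: "restrict f (U \<inter> V') \<in> regular X (U \<inter> V')" "restrict f (U \<inter> V) \<in> regular X (U \<inter> V)"
    using f o by (auto intro!: regular_restrict[of U])
  have sub: "U \<inter> W \<subseteq> U \<inter> V'" "U \<inter> W \<subseteq> U \<inter> V" using W by auto
  have rr: "restrict (restrict f (U \<inter> V')) (U \<inter> W) = restrict f (U \<inter> W)"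
     "restrict (restrict f (U \<inter> V)) (U \<inter> W) = restrict f (U \<inter> W)"
    using sub by (auto simp: restrict_def fun_eq_iff)
  have "res F (U \<inter> V') (U \<inter> W) (restrict f (U \<inter> V') \<odot>\<^bsub>sec F (U \<inter> V')\<^esub> res F V' (U \<inter> V') s')
     = restrict f (U \<inter> W) \<odot>\<^bsub>sec F (U \<inter> W)\<^esub> res F V' (U \<inter> W) s'"
    using FR(2)[OF o(1,3) sub(1) r(1) c(1)] o sub s' rr by (simp add: set_presheafD(3)[OF sF])
  moreover have "res F (U \<inter> V) (U \<inter> W) (restrict f (U \<inter> V) \<odot>\<^bsub>sec F (U \<inter> V)\<^esub> res F V (U \<inter> V) s)
     = restrict f (U \<inter> W) \<odot>\<^bsub>sec F (U \<inter> W)\<^esub> res F V (U \<inter> W) s"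
    using FR(2)[OF o(2,3) sub(2) r(2) c(2)] o sub s rr by (simp add: set_presheafD(3)[OF sF])
  ultimately show "germ X F x (U \<inter> V') (restrict f (U \<inter> V') \<odot>\<^bsub>sec F (U \<inter> V')\<^esub> res F V' (U \<inter> V') s') =
      germ X F x (U \<inter> V) (restrict f (U \<inter> V) \<odot>\<^bsub>sec F (U \<inter> V)\<^esub> res F V (U \<inter> V) s)"
    using o sub f s s' c r W 1
    by (subst germ_eq_iff[OF sF]) (auto intro!: FD exI[of _ "U \<inter> W"])
qed

lemma (in function_space) germ_smult_germ_same:
  assumes F: "prelinear_presheaf X F" and "space_open X U" "x \<in> U" "f \<in> regular X U" "s \<in> sections F U"
  shows "germ_smult X F x U f (germ X F x U s) = germ X F x U (f \<odot>\<^bsub>sec F U\<^esub> s)"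
  using germ_smult_germ[OF assms(1-4,2,3,5)] assms regular_extensional
  by (simp add: set_presheafD(2)[OF prelinear_imp_set_presheaf[OF F]] extensional_restrict)

text \<open>The condition that values lie in the stalks is implied by the local condition. What
  remains is a family of germs which is locally given by one section.\<close>

lemma sections_sheafify:
  "sections (sheafify X F) U = {\<sigma> \<in> extensional U. \<forall>x\<in>U. \<exists>V. space_open X V \<and> x \<in> V \<and> V \<subseteq> U \<and>
     (\<exists>s\<in>sections F V. \<forall>y\<in>V. \<sigma> y = germ X F y V s)}" (is "?L = ?R")
proof -
  define P where "P = (\<lambda>\<sigma>. \<forall>x\<in>U. \<exists>V\<in>opens_in X U. x \<in> V \<and>
      (\<exists>s\<in>sections F V. \<forall>y\<in>V. \<sigma> y = germ X F y V s))"
  have st: "\<sigma> x \<in> stalk X F x" if "P \<sigma>" "x \<in> U" for \<sigma> x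
  proof -
    from bspec[OF that(1)[unfolded P_def] that(2)]
    obtain V s where "V \<in> opens_in X U" "x \<in> V" "s \<in> sections F V" "\<sigma> x = germ X F x V s"
      by blast
    then show ?thesis by (auto simp: stalk_def opens_in_def)
  qed
  have "?L = {\<sigma> \<in> (\<Pi>\<^sub>E x\<in>U. stalk X F x). P \<sigma>}"
    unfolding sheafify_def mk_module_def P_def by simp
  also have "\<dots> = {\<sigma> \<in> extensional U. P \<sigma>}"
    using st by (auto simp: PiE_iff)
  also have "\<dots> = ?R"
    unfolding opens_in_def P_def by (simp add: Bex_def conj_ac cong: conj_cong)
  finally show ?thesis .
qed

lemma sheafify_simps:
  "\<zero>\<^bsub>sec (sheafify X F) U\<^esub> = (\<lambda>x\<in>U. germ X F x U \<zero>\<^bsub>sec F U\<^esub>)"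
  "\<sigma> \<oplus>\<^bsub>sec (sheafify X F) U\<^esub> \<tau> = (\<lambda>x\<in>U. germ_add X F x (\<sigma> x) (\<tau> x))"
  "f \<odot>\<^bsub>sec (sheafify X F) U\<^esub> \<sigma> = (\<lambda>x\<in>U. germ_smult X F x U f (\<sigma> x))"
  "res (sheafify X F) U V \<sigma> = restrict \<sigma> V"
  by (simp_all add: sheafify_def mk_module_def)

lemma germs_in_sheafify:
  assumes "space_open X U" "s \<in> sections F U"
  shows "(\<lambda>x\<in>U. germ X F x U s) \<in> sections (sheafify X F) U"
  using assms by (auto simp: sections_sheafify)

lemma sheafify_restrict:
  assumes F: "set_presheaf X F" and UV: "space_open X U" "space_open X V" "V \<subseteq> U"
    and s: "\<sigma> \<in> sections (sheafify X F) U"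
  shows "restrict \<sigma> V \<in> sections (sheafify X F) V"
  unfolding sections_sheafify
proof (intro CollectI conjI ballI)
  fix x assume x: "x \<in> V"
  then obtain W s where W: "space_open X W" "x \<in> W" "W \<subseteq> U" "s \<in> sections F W" "\<forall>y\<in>W. \<sigma> y = germ X F y W s"
    using s UV unfolding sections_sheafify by blast
  have "space_open X (V \<inter> W)" using W UV by auto
  then show "\<exists>W. space_open X W \<and> x \<in> W \<and> W \<subseteq> V \<and> (\<exists>s\<in>sections F W. \<forall>y\<in>W. restrict \<sigma> V y = germ X F y W s)"
    using W x by (intro exI[of _ "V \<inter> W"]) (auto intro!: bexI[of _ "res F W (V \<inter> W) s"]
        simp: germ_restrict[OF F] set_presheafD(1)[OF F])
qed auto

lemma (in function_space) prelinear_sheafify: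
  assumes F: "prelinear_presheaf X F" shows "prelinear_presheaf X (sheafify X F)"
proof -
  note sF = prelinear_imp_set_presheaf[OF F] and FD = prelinear_presheafD[OF F] and FR = prelinear_presheaf_resD[OF F]
  have rr: "restrict (restrict f V) W = restrict f W" if "W \<subseteq> V" for f :: "'p \<Rightarrow> 'z" and V W
    using that by (auto simp: restrict_def fun_eq_iff)
  have "set_presheaf X (sheafify X F)"
    unfolding set_presheaf_def
  proof (intro conjI allI impI ballI)
    fix U s assume "s \<in> sections (sheafify X F) U"
    then show "res (sheafify X F) U U s = s"
      by (simp add: sheafify_simps sections_sheafify extensional_restrict)
  qed (auto simp: sheafify_simps sheafify_restrict[OF sF] Int_absorb1)
  moreover have "premodule (function_ring X U) (sec (sheafify X F) U)" if U: "space_open X U" for U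
    unfolding premodule_def
  proof (intro conjI ballI)
    show "\<zero>\<^bsub>sec (sheafify X F) U\<^esub> \<in> sections (sheafify X F) U"
      using germs_in_sheafify[OF U] FD(1)[OF U] by (simp add: sheafify_simps)
    show "\<zero>\<^bsub>sec (sheafify X F) U\<^esub> \<oplus>\<^bsub>sec (sheafify X F) U\<^esub> \<zero>\<^bsub>sec (sheafify X F) U\<^esub> = \<zero>\<^bsub>sec (sheafify X F) U\<^esub>"
      using FD(1,2)[OF U] by (auto simp: sheafify_simps germ_add_germ_same[OF F U] intro!: restrict_ext)
  next
    fix \<sigma> \<tau> assume s: "\<sigma> \<in> sections (sheafify X F) U" and t: "\<tau> \<in> sections (sheafify X F) U"
    show "\<sigma> \<oplus>\<^bsub>sec (sheafify X F) U\<^esub> \<tau> \<in> sections (sheafify X F) U"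
      unfolding sections_sheafify
    proof (intro CollectI conjI ballI)
      fix x assume x: "x \<in> U"
      obtain V s where V: "space_open X V" "x \<in> V" "V \<subseteq> U" "s \<in> sections F V" "\<forall>y\<in>V. \<sigma> y = germ X F y V s"
        using s x unfolding sections_sheafify by blast
      obtain W t where W: "space_open X W" "x \<in> W" "W \<subseteq> U" "t \<in> sections F W" "\<forall>y\<in>W. \<tau> y = germ X F y W t"
        using t x unfolding sections_sheafify by blast
      have o: "space_open X (V \<inter> W)" using V W by auto
      show "\<exists>V. space_open X V \<and> x \<in> V \<and> V \<subseteq> U \<and> (\<exists>s\<in>sections F V. \<forall>y\<in>V.
          (\<sigma> \<oplus>\<^bsub>sec (sheafify X F) U\<^esub> \<tau>) y = germ X F y V s)"
        using V W x o
        by (intro exI[of _ "V \<inter> W"] conjI bexI[of _ "res F V (V \<inter> W) s \<oplus>\<^bsub>sec F (V \<inter> W)\<^esub> res F W (V \<inter> W) t"])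
          (auto simp: sheafify_simps germ_add_germ[OF F] intro!: FD set_presheafD(1)[OF sF])
    qed (simp add: sheafify_simps)
  next
    fix f \<sigma> assume f: "f \<in> carrier (function_ring X U)" and s: "\<sigma> \<in> sections (sheafify X F) U"
    show "f \<odot>\<^bsub>sec (sheafify X F) U\<^esub> \<sigma> \<in> sections (sheafify X F) U"
      unfolding sections_sheafify
    proof (intro CollectI conjI ballI)
      fix x assume x: "x \<in> U"
      obtain V s where V: "space_open X V" "x \<in> V" "V \<subseteq> U" "s \<in> sections F V" "\<forall>y\<in>V. \<sigma> y = germ X F y V s"
        using s x unfolding sections_sheafify by blast
      then have UV: "U \<inter> V = V" by auto
      have r: "restrict f V \<in> regular X V" using regular_restrict[OF U V(1,3)] f by simp
      show "\<exists>V. space_open X V \<and> x \<in> V \<and> V \<subseteq> U \<and> (\<exists>s\<in>sections F V. \<forall>y\<in>V.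
          (f \<odot>\<^bsub>sec (sheafify X F) U\<^esub> \<sigma>) y = germ X F y V s)"
        using V U f r UV FD(4)[OF V(1) r V(4)]
        by (intro exI[of _ V] conjI bexI[of _ "restrict f V \<odot>\<^bsub>sec F V\<^esub> s"])
          (auto simp: sheafify_simps germ_smult_germ[OF F] set_presheafD(2)[OF sF] subset_iff)
    qed (simp add: sheafify_simps)
  qed
  moreover have "semilinear (function_ring X U) (function_ring X V) (\<lambda>f. restrict f V)
      (sec (sheafify X F) U) (sec (sheafify X F) V) (res (sheafify X F) U V) \<and>
      res (sheafify X F) U V \<zero>\<^bsub>sec (sheafify X F) U\<^esub> = \<zero>\<^bsub>sec (sheafify X F) V\<^esub>"
    if UV: "space_open X U" "space_open X V" "V \<subseteq> U" for U V
  proof -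
    have add: "restrict (\<lambda>x\<in>U. germ_add X F x (\<sigma> x) (\<tau> x)) V =
        (\<lambda>x\<in>V. germ_add X F x (restrict \<sigma> V x) (restrict \<tau> V x))" for \<sigma> \<tau>
      using UV by (auto simp: restrict_def fun_eq_iff)
    \<comment> \<open>\<open>germ_smult\<close> mentions the open set on which \<open>f\<close> is
      given, so restricting a multiple is not a mere restriction of functions: both sides are
      compared on \<open>V \<inter> W\<close>, where \<open>\<sigma>\<close> consists of the germs
      of one section.\<close>
    have smult: "restrict (\<lambda>x\<in>U. germ_smult X F x U f (\<sigma> x)) V =
        (\<lambda>x\<in>V. germ_smult X F x V (restrict f V) (restrict \<sigma> V x))"
      if f: "f \<in> regular X U" and s: "\<sigma> \<in> sections (sheafify X F) U" for f \<sigma>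
    proof (rule ext)
      fix x
      show "restrict (\<lambda>x\<in>U. germ_smult X F x U f (\<sigma> x)) V x =
        (\<lambda>x\<in>V. germ_smult X F x V (restrict f V) (restrict \<sigma> V x)) x"
      proof (cases "x \<in> V")
        case True
        have "x \<in> U" using True UV by auto
        then obtain W s where W: "space_open X W" "x \<in> W" "W \<subseteq> U" "s \<in> sections F W" "\<forall>y\<in>W. \<sigma> y = germ X F y W s"
          using s unfolding sections_sheafify by blast
        have sx: "\<sigma> x = germ X F x W s" using W by blast
        have o: "space_open X (U \<inter> W)" "space_open X (V \<inter> W)" using UV W by auto
        have c: "res F W (U \<inter> W) s \<in> sections F (U \<inter> W)" using W o by (intro set_presheafD(1)[OF sF]) auto
        have r: "restrict f (U \<inter> W) \<in> regular X (U \<inter> W)" "restrict f V \<in> regular X V"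
          using f o UV by (auto intro!: regular_restrict[of U])
        have "germ_smult X F x U f (germ X F x W s) =
            germ X F x (U \<inter> W) (restrict f (U \<inter> W) \<odot>\<^bsub>sec F (U \<inter> W)\<^esub> res F W (U \<inter> W) s)"
          by (rule germ_smult_germ[OF F UV(1) \<open>x \<in> U\<close> f W(1,2,4)])
        also have "\<dots> = germ X F x (V \<inter> W) (res F (U \<inter> W) (V \<inter> W)
            (restrict f (U \<inter> W) \<odot>\<^bsub>sec F (U \<inter> W)\<^esub> res F W (U \<inter> W) s))"
          using o W True UV FD(4)[OF o(1) r(1) c] by (intro germ_restrict[OF sF, symmetric]) auto
        also have "\<dots> = germ X F x (V \<inter> W) (restrict (restrict f V) (V \<inter> W) \<odot>\<^bsub>sec F (V \<inter> W)\<^esub> res F W (V \<inter> W) s)"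
        proof -
          have sub: "V \<inter> W \<subseteq> U \<inter> W" using UV by auto
          moreover have "U \<inter> W \<inter> (V \<inter> W) = V \<inter> W" using UV by auto
          ultimately show ?thesis
            using FR(2)[OF o sub r(1) c] W o by (simp add: set_presheafD(3)[OF sF] rr)
        qed
        also have "\<dots> = germ_smult X F x V (restrict f V) (germ X F x W s)"
          by (rule germ_smult_germ[OF F UV(2) True r(2) W(1,2,4), symmetric])
        finally show ?thesis using True \<open>x \<in> U\<close> sx by simp
      qed simp
    qed
    have zero: "restrict (\<lambda>x\<in>U. germ X F x U \<zero>\<^bsub>sec F U\<^esub>) V = (\<lambda>x\<in>V. germ X F x V \<zero>\<^bsub>sec F V\<^esub>)"
    proof (rule ext)
      fix x show "restrict (\<lambda>x\<in>U. germ X F x U \<zero>\<^bsub>sec F U\<^esub>) V x = (\<lambda>x\<in>V. germ X F x V \<zero>\<^bsub>sec F V\<^esub>) x"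
        using UV germ_restrict[OF sF UV _ FD(1)[OF UV(1)], of x] FR(3)[OF UV] by (auto simp: restrict_def)
    qed
    show ?thesis
      unfolding semilinear_def
      using add smult zero sheafify_restrict[OF sF UV] regular_restrict[OF UV]
      by (simp add: sheafify_simps Pi_iff)
  qed
  ultimately show ?thesis by (simp add: prelinear_presheaf_def)
qed

section \<open>Tensor products of presheaves\<close>

locale prelinear_pair = function_space X
  for X :: "'p space_with_functions" +
  fixes F :: "('p, 'm) module_presheaf" and G :: "('p, 'n) module_presheaf"
  assumes prelinear_left: "prelinear_presheaf X F" and prelinear_right: "prelinear_presheaf X G"
begin

lemma premodule_pair: "space_open X U \<Longrightarrow> premodule_pair (function_ring X U) (sec F U) (sec G U)"
  using prelinear_presheafD(5)[OF prelinear_left] prelinear_presheafD(5)[OF prelinear_right]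
  by unfold_locales auto

definition tc :: "'p set \<Rightarrow> ('m \<times> 'n \<Rightarrow>\<^sub>0 int) \<Rightarrow> ('m, 'n) tensor" where
  "tc U = premodule_pair.tcl (function_ring X U) (sec F U) (sec G U)"

lemma sections_tensor:
  "space_open X U \<Longrightarrow> sections (tensor_presheaf X F G) U =
     tc U ` {k. Poly_Mapping.keys k \<subseteq> sections F U \<times> sections G U}"
  using premodule_pair.carrier_tensor_module[OF premodule_pair] by (simp add: tensor_presheaf_def tc_def)

lemma tc_in_tensor:
  "space_open X U \<Longrightarrow> Poly_Mapping.keys k \<subseteq> sections F U \<times> sections G U \<Longrightarrow>
    tc U k \<in> sections (tensor_presheaf X F G) U"
  by (auto simp: sections_tensor)

lemma zero_tensor: "space_open X U \<Longrightarrow> \<zero>\<^bsub>sec (tensor_presheaf X F G) U\<^esub> = tc U 0"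
  using premodule_pair.zero_tensor_module[OF premodule_pair] by (simp add: tensor_presheaf_def tc_def)

lemma add_tensor:
  "space_open X U \<Longrightarrow> Poly_Mapping.keys k \<subseteq> sections F U \<times> sections G U \<Longrightarrow>
    Poly_Mapping.keys l \<subseteq> sections F U \<times> sections G U \<Longrightarrow>
    tc U k \<oplus>\<^bsub>sec (tensor_presheaf X F G) U\<^esub> tc U l = tc U (k + l)"
  using premodule_pair.add_tensor_module[OF premodule_pair] by (simp add: tensor_presheaf_def tc_def)

lemma tc_eq_iff:
  "space_open X U \<Longrightarrow> tc U k = tc U l \<longleftrightarrow>
    k - l \<in> tensor_relations (function_ring X U) (sec F U) (sec G U)"
  using premodule_pair.tcl_eq_iff[OF premodule_pair] by (simp add: tc_def)

lemma res_tensor: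
  "space_open X U \<Longrightarrow> space_open X V \<Longrightarrow> V \<subseteq> U \<Longrightarrow>
    res (tensor_presheaf X F G) U V (tc U k) = tc V (frag_map2 (res F U V) (res G U V) k)"
  using premodule_pair.tensor_hom_tcl[OF premodule_pair[of V]
      prelinear_presheaf_resD(4)[OF prelinear_left, of U V] prelinear_presheaf_resD(4)[OF prelinear_right, of U V]
      prelinear_presheafD(5)[OF prelinear_left, of U] prelinear_presheafD(5)[OF prelinear_right, of U], of k]
  by (simp add: tensor_presheaf_def tc_def)

lemma keys_res:
  assumes "space_open X U" "space_open X V" "V \<subseteq> U" "Poly_Mapping.keys k \<subseteq> sections F U \<times> sections G U"
  shows "Poly_Mapping.keys (frag_map2 (res F U V) (res G U V) k) \<subseteq> sections F V \<times> sections G V"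
  using assms set_presheafD(1)[OF prelinear_imp_set_presheaf[OF prelinear_left]]
    set_presheafD(1)[OF prelinear_imp_set_presheaf[OF prelinear_right]]
  by (intro keys_frag_map2) auto

lemma set_presheaf_tensor: "set_presheaf X (tensor_presheaf X F G)"
proof -
  note sF = prelinear_imp_set_presheaf[OF prelinear_left] and sG = prelinear_imp_set_presheaf[OF prelinear_right]
  show ?thesis
    unfolding set_presheaf_def
  proof (intro conjI allI impI ballI funcsetI)
    fix U V s assume UV: "space_open X U \<and> space_open X V \<and> V \<subseteq> U" and s: "s \<in> sections (tensor_presheaf X F G) U"
    then show "res (tensor_presheaf X F G) U V s \<in> sections (tensor_presheaf X F G) V"
      using keys_res by (auto simp: sections_tensor res_tensor)
  next
    fix U s assume U: "space_open X U" and s: "s \<in> sections (tensor_presheaf X F G) U"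
    then obtain k where k: "s = tc U k" "Poly_Mapping.keys k \<subseteq> sections F U \<times> sections G U" by (auto simp: sections_tensor)
    have "frag_map2 (res F U U) (res G U U) k = k"
      using U by (intro frag_map2_ident[OF k(2)]) (auto simp: set_presheafD(2)[OF sF] set_presheafD(2)[OF sG])
    then show "res (tensor_presheaf X F G) U U s = s" using U k by (simp add: res_tensor)
  next
    fix U V W s assume o: "space_open X U \<and> space_open X V \<and> space_open X W \<and> W \<subseteq> V \<and> V \<subseteq> U"
      and s: "s \<in> sections (tensor_presheaf X F G) U"
    then obtain k where k: "s = tc U k" "Poly_Mapping.keys k \<subseteq> sections F U \<times> sections G U" by (auto simp: sections_tensor)
    have "frag_map2 (\<lambda>m. res F V W (res F U V m)) (\<lambda>n. res G V W (res G U V n)) k = frag_map2 (res F U W) (res G U W) k"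
      using o by (intro frag_map2_cong[OF k(2)]) (auto simp: set_presheafD(3)[OF sF] set_presheafD(3)[OF sG])
    moreover have "W \<subseteq> U" using o by auto
    ultimately show "res (tensor_presheaf X F G) V W (res (tensor_presheaf X F G) U V s) = res (tensor_presheaf X F G) U W s"
      using o k by (simp add: res_tensor frag_map2_compose)
  qed
qed

end

text \<open>Scalars act on the left factor of a tensor product, so only the left factor has to
  consist of modules. This fits T tensored with the dual of A, I \<otimes> A and E \<otimes> T,
  while (E \<otimes> T) \<otimes> T is treated with \<open>prelinear_pair\<close> alone.\<close>

locale module_pair = prelinear_pair +
  assumes module_left: "presheaf_of_modules X F"
begin

text \<open>Here commutativity of the function ring enters: a (b m) = b (a m).\<close>

lemma smult_semilinear:
  assumes U: "space_open X U" and a: "a \<in> regular X U"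
  shows "semilinear (function_ring X U) (function_ring X U) (\<lambda>b. b) (sec F U) (sec F U) (\<lambda>m. a \<odot>\<^bsub>sec F U\<^esub> m)"
proof -
  interpret Module.module "function_ring X U" "sec F U"
    using module_left U by (simp add: presheaf_of_modules_def)
  show ?thesis
    unfolding semilinear_def using a
    by (auto simp: smult_r_distr smult_assoc1[symmetric] R.m_comm)
qed

lemma smult_tensor:
  "space_open X U \<Longrightarrow> a \<in> regular X U \<Longrightarrow>
    a \<odot>\<^bsub>sec (tensor_presheaf X F G) U\<^esub> tc U k = tc U (frag_map2 (\<lambda>m. a \<odot>\<^bsub>sec F U\<^esub> m) (\<lambda>n. n) k)"
  using premodule_pair.smult_tensor_module[OF premodule_pair smult_semilinear]
  by (simp add: tensor_presheaf_def tc_def)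

lemma prelinear_tensor: "prelinear_presheaf X (tensor_presheaf X F G)"
proof -
  note FD = prelinear_presheafD[OF prelinear_left] and FR = prelinear_presheaf_resD[OF prelinear_left]
  have k_add: "Poly_Mapping.keys (k + l) \<subseteq> S" if "Poly_Mapping.keys k \<subseteq> S" "Poly_Mapping.keys l \<subseteq> S"
    for k l and S :: "('b \<times> 'c) set" using that Poly_Mapping.keys_add[of k l] by blast
  have k_sm: "Poly_Mapping.keys (frag_map2 (\<lambda>m. a \<odot>\<^bsub>sec F U\<^esub> m) (\<lambda>n. n) k) \<subseteq> sections F U \<times> sections G U"
    if "space_open X U" "a \<in> regular X U" "Poly_Mapping.keys k \<subseteq> sections F U \<times> sections G U" for U a k
    using that FD(4) by (intro keys_frag_map2) auto
  have "premodule (function_ring X U) (sec (tensor_presheaf X F G) U)" if U: "space_open X U" for U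
    unfolding premodule_def
    using U by (auto simp: zero_tensor add_tensor smult_tensor sections_tensor k_add k_sm)
  moreover have "semilinear (function_ring X U) (function_ring X V) (\<lambda>f. restrict f V)
      (sec (tensor_presheaf X F G) U) (sec (tensor_presheaf X F G) V) (res (tensor_presheaf X F G) U V) \<and>
      res (tensor_presheaf X F G) U V \<zero>\<^bsub>sec (tensor_presheaf X F G) U\<^esub> = \<zero>\<^bsub>sec (tensor_presheaf X F G) V\<^esub>"
    if UV: "space_open X U" "space_open X V" "V \<subseteq> U" for U V
  proof -
    have sm: "res (tensor_presheaf X F G) U V (a \<odot>\<^bsub>sec (tensor_presheaf X F G) U\<^esub> s) =
        restrict a V \<odot>\<^bsub>sec (tensor_presheaf X F G) V\<^esub> res (tensor_presheaf X F G) U V s"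
      if a: "a \<in> regular X U" and s: "s \<in> sections (tensor_presheaf X F G) U" for a s
    proof -
      obtain k where k: "s = tc U k" "Poly_Mapping.keys k \<subseteq> sections F U \<times> sections G U"
        using s UV by (auto simp: sections_tensor)
      have "frag_map2 (\<lambda>m. res F U V (a \<odot>\<^bsub>sec F U\<^esub> m)) (res G U V) k =
          frag_map2 (\<lambda>m. restrict a V \<odot>\<^bsub>sec F V\<^esub> res F U V m) (res G U V) k"
        using FR(2)[OF UV a] by (intro frag_map2_cong[OF k(2)]) auto
      then show ?thesis
        using UV a k regular_restrict[OF UV a] by (simp add: smult_tensor res_tensor frag_map2_compose)
    qed
    have ad: "res (tensor_presheaf X F G) U V (s \<oplus>\<^bsub>sec (tensor_presheaf X F G) U\<^esub> t) =
        res (tensor_presheaf X F G) U V s \<oplus>\<^bsub>sec (tensor_presheaf X F G) V\<^esub> res (tensor_presheaf X F G) U V t"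
      if "s \<in> sections (tensor_presheaf X F G) U" "t \<in> sections (tensor_presheaf X F G) U" for s t
      using that UV keys_res[OF UV]
      by (auto simp: sections_tensor add_tensor res_tensor frag_extend_add)
    show ?thesis
      unfolding semilinear_def
      using sm ad UV regular_restrict[OF UV] set_presheafD(1)[OF set_presheaf_tensor UV]
      by (simp add: zero_tensor res_tensor)
  qed
  ultimately show ?thesis using set_presheaf_tensor by (simp add: prelinear_presheaf_def)
qed

end

section \<open>Tangent sheaf and dual sheaf\<close>

lemma function_ring_simps:
  "f \<otimes>\<^bsub>function_ring X U\<^esub> g = (\<lambda>x\<in>U. f x * g x)" "\<one>\<^bsub>function_ring X U\<^esub> = (\<lambda>x\<in>U. 1)"
  "\<zero>\<^bsub>function_ring X U\<^esub> = (\<lambda>x\<in>U. 0)" "f \<oplus>\<^bsub>function_ring X U\<^esub> g = (\<lambda>x\<in>U. f x + g x)"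
  by (simp_all add: function_ring_def)

lemma opens_in_iff: "V \<in> opens_in X U \<longleftrightarrow> space_open X V \<and> V \<subseteq> U"
  by (simp add: opens_in_def)

lemma space_open_open_subspace:
  "space_open X U \<Longrightarrow> space_open (open_subspace X U) V \<longleftrightarrow> space_open X V \<and> V \<subseteq> U"
  by (simp add: open_subspace_def openin_open_subtopology)

lemma regular_open_subspace [simp]: "regular (open_subspace X U) = regular X"
  by (simp add: open_subspace_def)

lemma structure_sheaf_open_subspace [simp]: "structure_sheaf (open_subspace X U) = structure_sheaf X"
  by (simp add: structure_sheaf_def)

lemma structure_sheaf_simps:
  "sections (structure_sheaf X) U = regular X U"
  "\<zero>\<^bsub>sec (structure_sheaf X) U\<^esub> = (\<lambda>x\<in>U. 0)"
  "f \<oplus>\<^bsub>sec (structure_sheaf X) U\<^esub> g = (\<lambda>x\<in>U. f x + g x)"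
  "f \<odot>\<^bsub>sec (structure_sheaf X) U\<^esub> g = (\<lambda>x\<in>U. f x * g x)"
  "res (structure_sheaf X) U V f = restrict f V"
  by (simp_all add: structure_sheaf_def mk_module_def)

context function_space
begin

lemma regular_scale: "space_open X U \<Longrightarrow> f \<in> regular X U \<Longrightarrow> (\<lambda>x\<in>U. c * f x) \<in> regular X U"
  using regular_mult[OF _ regular_const[of U c], of f] by (simp cong: restrict_cong)

lemma regular_eqI:
  "space_open X U \<Longrightarrow> f \<in> regular X U \<Longrightarrow> g \<in> regular X U \<Longrightarrow> (\<And>x. x \<in> U \<Longrightarrow> f x = g x) \<Longrightarrow> f = g"
  by (rule extensionalityI[of _ U]) (auto intro: regular_extensional)

lemma cring_function_ring:
  assumes U: "space_open X U" shows "cring (function_ring X U)"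
proof (rule cringI)
  show "abelian_group (function_ring X U)"
  proof (rule abelian_groupI)
    fix f assume f: "f \<in> carrier (function_ring X U)"
    have "(\<lambda>x\<in>U. - f x) \<in> regular X U" using regular_scale[OF U, of f "-1"] f by simp
    then show "\<exists>g\<in>carrier (function_ring X U). g \<oplus>\<^bsub>function_ring X U\<^esub> f = \<zero>\<^bsub>function_ring X U\<^esub>"
      by (intro bexI[of _ "\<lambda>x\<in>U. - f x"]) (auto simp: function_ring_simps intro!: restrict_ext)
    show "\<zero>\<^bsub>function_ring X U\<^esub> \<oplus>\<^bsub>function_ring X U\<^esub> f = f"
      unfolding function_ring_simps using f U regular_add[OF U regular_const[OF U, of 0], of f]
      by (intro regular_eqI[OF U]) simp_all
  qed (auto simp: function_ring_simps U intro!: regular_add regular_const restrict_ext)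
  show "Group.comm_monoid (function_ring X U)"
  proof (rule comm_monoidI)
    fix f assume f: "f \<in> carrier (function_ring X U)"
    show "\<one>\<^bsub>function_ring X U\<^esub> \<otimes>\<^bsub>function_ring X U\<^esub> f = f"
      unfolding function_ring_simps using f U regular_mult[OF U regular_const[OF U, of 1], of f]
      by (intro regular_eqI[OF U]) simp_all
  qed (auto simp: function_ring_simps U intro!: regular_mult regular_const restrict_ext)
qed (auto simp: function_ring_simps algebra_simps intro!: restrict_ext)

section \<open>Derivations of the structure sheaf\<close>

lemma sheaf_derivationD:
  assumes "sheaf_derivation X U D"
  shows "D \<in> extensional (opens_in X U)"
    "V \<in> opens_in X U \<Longrightarrow> D V \<in> extensional (regular X V)"
    "V \<in> opens_in X U \<Longrightarrow> f \<in> regular X V \<Longrightarrow> D V f \<in> regular X V"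
    "V \<in> opens_in X U \<Longrightarrow> f \<in> regular X V \<Longrightarrow> g \<in> regular X V \<Longrightarrow>
      D V (\<lambda>x\<in>V. f x + g x) = (\<lambda>x\<in>V. D V f x + D V g x)"
    "V \<in> opens_in X U \<Longrightarrow> f \<in> regular X V \<Longrightarrow> g \<in> regular X V \<Longrightarrow>
      D V (\<lambda>x\<in>V. f x * g x) = (\<lambda>x\<in>V. f x * D V g x + g x * D V f x)"
    "V \<in> opens_in X U \<Longrightarrow> f \<in> regular X V \<Longrightarrow> D V (\<lambda>x\<in>V. c * f x) = (\<lambda>x\<in>V. c * D V f x)"
    "V \<in> opens_in X U \<Longrightarrow> W \<in> opens_in X V \<Longrightarrow> f \<in> regular X V \<Longrightarrow> D W (restrict f W) = restrict (D V f) W"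
  using assms unfolding sheaf_derivation_def by (simp_all add: PiE_iff)

text \<open>Derivations are extensional in the open set, the function and the point, so the numbers
  \<open>D V f x\<close> determine them. Identities in the tangent sheaf are reduced to identities
  of complex numbers in this way.\<close>

lemma sheaf_derivation_eqI:
  assumes "sheaf_derivation X U D" "sheaf_derivation X U E"
    and eq: "\<And>V f x. space_open X V \<Longrightarrow> V \<subseteq> U \<Longrightarrow> f \<in> regular X V \<Longrightarrow> x \<in> V \<Longrightarrow> D V f x = E V f x"
  shows "D = E"
proof (rule extensionalityI[OF sheaf_derivationD(1)[OF assms(1)] sheaf_derivationD(1)[OF assms(2)]])
  fix V assume V: "V \<in> opens_in X U"
  show "D V = E V"
  proof (rule extensionalityI[OF sheaf_derivationD(2)[OF assms(1) V] sheaf_derivationD(2)[OF assms(2) V]])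
    fix f assume f: "f \<in> regular X V"
    show "D V f = E V f"
      using V f eq by (intro regular_eqI[of V] sheaf_derivationD(3)[OF assms(1)] sheaf_derivationD(3)[OF assms(2)])
        (auto simp: opens_in_iff)
  qed
qed

text \<open>The conditions on \<open>d\<close> are pointwise, so that \<open>d\<close> may be any
  family of values; the conclusion adds the truncations which the definition of a section
  demands.\<close>

lemma sheaf_derivationI:
  assumes U: "space_open X U"
    and reg: "\<And>V f. space_open X V \<Longrightarrow> V \<subseteq> U \<Longrightarrow> f \<in> regular X V \<Longrightarrow> (\<lambda>x\<in>V. d V f x) \<in> regular X V"
    and add: "\<And>V f g x. space_open X V \<Longrightarrow> V \<subseteq> U \<Longrightarrow> f \<in> regular X V \<Longrightarrow> g \<in> regular X V \<Longrightarrow> x \<in> V \<Longrightarrow>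
      d V (\<lambda>x\<in>V. f x + g x) x = d V f x + d V g x"
    and mult: "\<And>V f g x. space_open X V \<Longrightarrow> V \<subseteq> U \<Longrightarrow> f \<in> regular X V \<Longrightarrow> g \<in> regular X V \<Longrightarrow> x \<in> V \<Longrightarrow>
      d V (\<lambda>x\<in>V. f x * g x) x = f x * d V g x + g x * d V f x"
    and scale: "\<And>V f c x. space_open X V \<Longrightarrow> V \<subseteq> U \<Longrightarrow> f \<in> regular X V \<Longrightarrow> x \<in> V \<Longrightarrow>
      d V (\<lambda>x\<in>V. c * f x) x = c * d V f x"
    and restr: "\<And>V W f x. space_open X V \<Longrightarrow> V \<subseteq> U \<Longrightarrow> space_open X W \<Longrightarrow> W \<subseteq> V \<Longrightarrow> f \<in> regular X V \<Longrightarrow> x \<in> W \<Longrightarrow>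
      d W (restrict f W) x = d V f x"
  shows "sheaf_derivation X U (\<lambda>V\<in>opens_in X U. \<lambda>f\<in>regular X V. \<lambda>x\<in>V. d V f x)" (is "sheaf_derivation X U ?D")
proof -
  have D: "?D V f = (\<lambda>x\<in>V. d V f x)" if "space_open X V" "V \<subseteq> U" "f \<in> regular X V" for V f
    using that by (simp add: opens_in_iff)
  show ?thesis
    unfolding sheaf_derivation_def
  proof (intro conjI ballI allI)
    fix V assume "V \<in> opens_in X U"
    then have V: "space_open X V" "V \<subseteq> U" by (auto simp: opens_in_iff)
    show "?D V \<in> regular X V \<rightarrow>\<^sub>E regular X V"
      using V reg by (auto simp: opens_in_iff)
    fix f assume f: "f \<in> regular X V"
    show "?D V (\<lambda>x\<in>V. c * f x) = (\<lambda>x\<in>V. c * ?D V f x)" for c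
      unfolding D[OF V regular_scale[OF V(1) f]] D[OF V f] using scale[OF V f] by (auto intro!: restrict_ext)
    show "?D W (restrict f W) = restrict (?D V f) W" if "W \<in> opens_in X V" for W
    proof -
      have W: "space_open X W" "W \<subseteq> V" "W \<subseteq> U" using that V by (auto simp: opens_in_iff)
      show ?thesis
        unfolding D[OF W(1,3) regular_restrict[OF V(1) W(1,2) f]] D[OF V f]
        using restr[OF V W(1,2) f] W(2) by (auto simp: fun_eq_iff)
    qed
    fix g assume g: "g \<in> regular X V"
    show "?D V (\<lambda>x\<in>V. f x + g x) = (\<lambda>x\<in>V. ?D V f x + ?D V g x)"
      unfolding D[OF V regular_add[OF V(1) f g]] D[OF V f] D[OF V g]
      using add[OF V f g] by (auto intro!: restrict_ext)
    show "?D V (\<lambda>x\<in>V. f x * g x) = (\<lambda>x\<in>V. f x * ?D V g x + g x * ?D V f x)"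
      unfolding D[OF V regular_mult[OF V(1) f g]] D[OF V f] D[OF V g]
      using mult[OF V f g] by (auto intro!: restrict_ext)
  qed simp
qed

lemma tangent_simps:
  "D \<in> sections (tangent_sheaf X) U \<longleftrightarrow> sheaf_derivation X U D"
  "space_open X V \<Longrightarrow> V \<subseteq> U \<Longrightarrow> f \<in> regular X V \<Longrightarrow> x \<in> V \<Longrightarrow> \<zero>\<^bsub>sec (tangent_sheaf X) U\<^esub> V f x = 0"
  "space_open X V \<Longrightarrow> V \<subseteq> U \<Longrightarrow> f \<in> regular X V \<Longrightarrow> x \<in> V \<Longrightarrow>
    (D \<oplus>\<^bsub>sec (tangent_sheaf X) U\<^esub> E) V f x = D V f x + E V f x"
  "space_open X V \<Longrightarrow> V \<subseteq> U \<Longrightarrow> f \<in> regular X V \<Longrightarrow> x \<in> V \<Longrightarrow>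
    (g \<odot>\<^bsub>sec (tangent_sheaf X) U\<^esub> D) V f x = g x * D V f x"
  "res (tangent_sheaf X) U V D = restrict D (opens_in X V)"
  by (simp_all add: tangent_sheaf_def mk_module_def opens_in_iff)

lemma derivation_value:
  assumes "sheaf_derivation X U D" "space_open X V" "V \<subseteq> U" "f \<in> regular X V" "g \<in> regular X V" "x \<in> V"
  shows "D V (\<lambda>x\<in>V. f x + g x) x = D V f x + D V g x"
    "D V (\<lambda>x\<in>V. f x * g x) x = f x * D V g x + g x * D V f x"
    "D V (\<lambda>x\<in>V. c * f x) x = c * D V f x"
  using assms by (simp_all add: sheaf_derivationD opens_in_iff)

lemma derivation_restrict:
  assumes "sheaf_derivation X U D" "space_open X V" "V \<subseteq> U" "space_open X W" "W \<subseteq> V" "f \<in> regular X V" "x \<in> W"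
  shows "D W (restrict f W) x = D V f x"
  using assms by (simp add: sheaf_derivationD(7)[where V=V] opens_in_iff)

lemma tangent_closed:
  assumes U: "space_open X U"
  shows "sheaf_derivation X U \<zero>\<^bsub>sec (tangent_sheaf X) U\<^esub>"
    "sheaf_derivation X U D \<Longrightarrow> sheaf_derivation X U E \<Longrightarrow> sheaf_derivation X U (D \<oplus>\<^bsub>sec (tangent_sheaf X) U\<^esub> E)"
    "g \<in> regular X U \<Longrightarrow> sheaf_derivation X U D \<Longrightarrow> sheaf_derivation X U (g \<odot>\<^bsub>sec (tangent_sheaf X) U\<^esub> D)"
    "space_open X V \<Longrightarrow> V \<subseteq> U \<Longrightarrow> sheaf_derivation X U D \<Longrightarrow> sheaf_derivation X V (restrict D (opens_in X V))"
proof -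
  show "sheaf_derivation X U \<zero>\<^bsub>sec (tangent_sheaf X) U\<^esub>"
    by (simp add: tangent_sheaf_def mk_module_def, rule sheaf_derivationI[OF U]) (auto intro: regular_const)
  show "sheaf_derivation X U (D \<oplus>\<^bsub>sec (tangent_sheaf X) U\<^esub> E)" if "sheaf_derivation X U D" "sheaf_derivation X U E"
    by (simp add: tangent_sheaf_def mk_module_def, rule sheaf_derivationI[OF U])
      (auto simp: derivation_value[OF that(1)] derivation_value[OF that(2)] algebra_simps
        derivation_restrict[OF that(1)] derivation_restrict[OF that(2)] opens_in_iff
        intro!: regular_add sheaf_derivationD(3)[OF that(1)] sheaf_derivationD(3)[OF that(2)])
  show "sheaf_derivation X U (g \<odot>\<^bsub>sec (tangent_sheaf X) U\<^esub> D)" if g: "g \<in> regular X U" and D: "sheaf_derivation X U D"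
  proof (simp add: tangent_sheaf_def mk_module_def, rule sheaf_derivationI[OF U])
    fix V f assume V: "space_open X V" "V \<subseteq> U" "f \<in> regular X V"
    \<comment> \<open>\<open>g\<close> is regular on \<open>U\<close>; only its restriction is a
      factor in the ring over \<open>V\<close>.\<close>
    have "(\<lambda>x\<in>V. restrict g V x * D V f x) \<in> regular X V"
      using V by (intro regular_mult regular_restrict[OF U _ _ g] sheaf_derivationD(3)[OF D]) (auto simp: opens_in_iff)
    then show "(\<lambda>x\<in>V. g x * D V f x) \<in> regular X V" by (simp cong: restrict_cong)
  qed (auto simp: derivation_value[OF D] algebra_simps derivation_restrict[OF D])
  show "sheaf_derivation X V (restrict D (opens_in X V))"
    if V: "space_open X V" "V \<subseteq> U" and D: "sheaf_derivation X U D"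
  proof -
    have "sheaf_derivation X V (\<lambda>W\<in>opens_in X V. \<lambda>f\<in>regular X W. \<lambda>x\<in>W. D W f x)"
    proof (rule sheaf_derivationI[OF V(1)])
      fix W f assume W: "space_open X W" "W \<subseteq> V" "f \<in> regular X W"
      then have "D W f \<in> regular X W" using V by (intro sheaf_derivationD(3)[OF D]) (auto simp: opens_in_iff)
      then show "restrict (D W f) W \<in> regular X W"
        using regular_extensional[OF W(1)] by (simp add: extensional_restrict)
    next
      fix W W' f x assume "space_open X W" "W \<subseteq> V" "space_open X W'" "W' \<subseteq> W" "f \<in> regular X W" "x \<in> W'"
      then show "D W' (restrict f W') x = D W f x"
        using V by (intro derivation_restrict[OF D]) auto
    next
      fix W f g x assume "space_open X W" "W \<subseteq> V" "f \<in> regular X W" "g \<in> regular X W" "x \<in> W"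
      then show "D W (\<lambda>x\<in>W. f x + g x) x = D W f x + D W g x"
        "D W (\<lambda>x\<in>W. f x * g x) x = f x * D W g x + g x * D W f x"
        using V by (auto intro!: derivation_value[OF D])
    next
      fix W f c x assume "space_open X W" "W \<subseteq> V" "f \<in> regular X W" "x \<in> W"
      then show "D W (\<lambda>x\<in>W. c * f x) x = c * D W f x"
        using V by (auto intro!: derivation_value(3)[OF D])
    qed
    \<comment> \<open>The family delivered by \<open>sheaf_derivationI\<close> is truncated in every
      argument; a restricted derivation already has this form.\<close>
    moreover have "(\<lambda>W\<in>opens_in X V. \<lambda>f\<in>regular X W. \<lambda>x\<in>W. D W f x) = restrict D (opens_in X V)"
    proof (rule restrict_ext)
      fix W assume "W \<in> opens_in X V"
      then have W: "W \<in> opens_in X U" "space_open X W" using V by (auto simp: opens_in_iff)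
      have "(\<lambda>f\<in>regular X W. \<lambda>x\<in>W. D W f x) = restrict (D W) (regular X W)"
        using W regular_extensional[OF W(2) sheaf_derivationD(3)[OF D W(1)]]
        by (intro restrict_ext) (simp add: extensional_restrict)
      then show "(\<lambda>f\<in>regular X W. \<lambda>x\<in>W. D W f x) = D W"
        using sheaf_derivationD(2)[OF D W(1)] by (simp add: extensional_restrict)
    qed
    ultimately show ?thesis by simp
  qed
qed

lemma presheaf_of_modules_tangent: "presheaf_of_modules X (tangent_sheaf X)"
proof -
  have mod: "Module.module (function_ring X U) (sec (tangent_sheaf X) U)" if U: "space_open X U" for U
  proof -
    note cl = tangent_closed[OF U] regular_const[OF U] regular_add[OF U] regular_mult[OF U]
    have ag: "abelian_group (sec (tangent_sheaf X) U)"
    proof (rule abelian_groupI)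
      fix D assume D: "D \<in> sections (tangent_sheaf X) U"
      show "\<exists>E\<in>sections (tangent_sheaf X) U. E \<oplus>\<^bsub>sec (tangent_sheaf X) U\<^esub> D = \<zero>\<^bsub>sec (tangent_sheaf X) U\<^esub>"
        using D cl
        by (intro bexI[of _ "(\<lambda>x\<in>U. -1) \<odot>\<^bsub>sec (tangent_sheaf X) U\<^esub> D"] sheaf_derivation_eqI[of U])
          (auto simp: tangent_simps subset_iff)
    qed (auto simp: tangent_simps cl intro!: sheaf_derivation_eqI[of U])
    show ?thesis
      by (rule moduleI[OF cring_function_ring[OF U] ag])
        (auto simp: tangent_simps cl function_ring_simps subset_iff algebra_simps intro!: sheaf_derivation_eqI[of U])
  qed
  show ?thesis
    unfolding presheaf_of_modules_def
  proof (intro conjI allI impI ballI funcsetI)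
    fix U V D assume o: "space_open X U \<and> space_open X V \<and> V \<subseteq> U" and D: "D \<in> sections (tangent_sheaf X) U"
    show "res (tangent_sheaf X) U V D \<in> sections (tangent_sheaf X) V"
      using o D by (auto simp: tangent_simps intro: tangent_closed(4)[of U])
    fix f assume "f \<in> regular X U"
    with o D show "res (tangent_sheaf X) U V (f \<odot>\<^bsub>sec (tangent_sheaf X) U\<^esub> D) =
        restrict f V \<odot>\<^bsub>sec (tangent_sheaf X) V\<^esub> res (tangent_sheaf X) U V D"
      by (intro sheaf_derivation_eqI[of V])
        (auto simp: tangent_simps opens_in_iff subset_iff intro!: tangent_closed tangent_closed(4)[of U V] regular_restrict[of U V])
  next
    fix U V D E assume o: "space_open X U \<and> space_open X V \<and> V \<subseteq> U"
      and D: "D \<in> sections (tangent_sheaf X) U" "E \<in> sections (tangent_sheaf X) U"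
    then show "res (tangent_sheaf X) U V (D \<oplus>\<^bsub>sec (tangent_sheaf X) U\<^esub> E) =
        res (tangent_sheaf X) U V D \<oplus>\<^bsub>sec (tangent_sheaf X) V\<^esub> res (tangent_sheaf X) U V E"
      by (intro sheaf_derivation_eqI[of V])
        (auto simp: tangent_simps opens_in_iff subset_iff intro!: tangent_closed tangent_closed(4)[of U V])
  next
    fix U D assume "D \<in> sections (tangent_sheaf X) U"
    then show "res (tangent_sheaf X) U U D = D"
      by (simp add: tangent_simps extensional_restrict sheaf_derivationD(1))
  next
    fix U V W D assume "space_open X U \<and> space_open X V \<and> space_open X W \<and> W \<subseteq> V \<and> V \<subseteq> U"
    then have "opens_in X W \<subseteq> opens_in X V" unfolding opens_in_def by blast
    then show "res (tangent_sheaf X) V W (res (tangent_sheaf X) U V D) = res (tangent_sheaf X) U W D"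
      by (simp add: tangent_simps Int_absorb1)
  qed (use mod in auto)
qed

lemma prelinear_tangent: "prelinear_presheaf X (tangent_sheaf X)"
  by (rule prelinear_if_presheaf_of_modules[OF presheaf_of_modules_tangent])

section \<open>The dual sheaf\<close>

lemma sections_dual:
  assumes U: "space_open X U"
  shows "\<phi> \<in> sections (dual_sheaf X A) U \<longleftrightarrow> \<phi> \<in> extensional (opens_in X U) \<and>
    (\<forall>V. space_open X V \<and> V \<subseteq> U \<longrightarrow> \<phi> V \<in> extensional (sections A V) \<and>
       (\<forall>s\<in>sections A V. \<phi> V s \<in> regular X V \<and>
          (\<forall>t\<in>sections A V. \<phi> V (s \<oplus>\<^bsub>sec A V\<^esub> t) = (\<lambda>x\<in>V. \<phi> V s x + \<phi> V t x)) \<and>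
          (\<forall>f\<in>regular X V. \<phi> V (f \<odot>\<^bsub>sec A V\<^esub> s) = (\<lambda>x\<in>V. f x * \<phi> V s x)) \<and>
          (\<forall>W. space_open X W \<and> W \<subseteq> V \<longrightarrow> \<phi> W (res A V W s) = restrict (\<phi> V s) W)))" (is "_ \<longleftrightarrow> ?R")
proof -
  have "\<phi> \<in> sections (dual_sheaf X A) U \<longleftrightarrow> \<phi> \<in> extensional (opens_in X U) \<and>
      (\<forall>V. space_open X V \<and> V \<subseteq> U \<longrightarrow> \<phi> V \<in> extensional (sections A V)) \<and>
      sheaf_hom (open_subspace X U) A (structure_sheaf X) \<phi>"
    unfolding dual_sheaf_def hom_sheaf_def mk_module_def by (simp add: Ball_def opens_in_iff)
  also have "sheaf_hom (open_subspace X U) A (structure_sheaf X) \<phi> \<longleftrightarrow>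
     (\<forall>V. space_open X V \<and> V \<subseteq> U \<longrightarrow> (\<forall>s\<in>sections A V. \<phi> V s \<in> regular X V \<and>
          (\<forall>t\<in>sections A V. \<phi> V (s \<oplus>\<^bsub>sec A V\<^esub> t) = (\<lambda>x\<in>V. \<phi> V s x + \<phi> V t x)) \<and>
          (\<forall>f\<in>regular X V. \<phi> V (f \<odot>\<^bsub>sec A V\<^esub> s) = (\<lambda>x\<in>V. f x * \<phi> V s x)) \<and>
          (\<forall>W. space_open X W \<and> W \<subseteq> V \<longrightarrow> \<phi> W (res A V W s) = restrict (\<phi> V s) W)))" (is "?L \<longleftrightarrow> ?M")
  proof
    assume L: ?L
    show ?M
    proof (intro allI impI ballI)
      fix V s assume V: "space_open X V \<and> V \<subseteq> U" and s: "s \<in> sections A V"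
      then have "W \<subseteq> U" if "W \<subseteq> V" for W using that by auto
      with V s L show "\<phi> V s \<in> regular X V \<and>
          (\<forall>t\<in>sections A V. \<phi> V (s \<oplus>\<^bsub>sec A V\<^esub> t) = (\<lambda>x\<in>V. \<phi> V s x + \<phi> V t x)) \<and>
          (\<forall>f\<in>regular X V. \<phi> V (f \<odot>\<^bsub>sec A V\<^esub> s) = (\<lambda>x\<in>V. f x * \<phi> V s x)) \<and>
          (\<forall>W. space_open X W \<and> W \<subseteq> V \<longrightarrow> \<phi> W (res A V W s) = restrict (\<phi> V s) W)"
        unfolding sheaf_hom_def space_open_open_subspace[OF U] regular_open_subspace structure_sheaf_simps
        by (simp add: Pi_iff)
    qed
  next
    assume ?M then show ?L
      unfolding sheaf_hom_def space_open_open_subspace[OF U] regular_open_subspace structure_sheaf_simps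
      by (simp add: Pi_iff)
  qed
  finally show ?thesis by auto
qed

lemma dual_simps:
  "space_open X V \<Longrightarrow> V \<subseteq> U \<Longrightarrow> s \<in> sections A V \<Longrightarrow> \<zero>\<^bsub>sec (dual_sheaf X A) U\<^esub> V s = (\<lambda>x\<in>V. 0)"
  "space_open X V \<Longrightarrow> V \<subseteq> U \<Longrightarrow> s \<in> sections A V \<Longrightarrow>
    (\<phi> \<oplus>\<^bsub>sec (dual_sheaf X A) U\<^esub> \<psi>) V s = (\<lambda>x\<in>V. \<phi> V s x + \<psi> V s x)"
  "space_open X V \<Longrightarrow> V \<subseteq> U \<Longrightarrow> s \<in> sections A V \<Longrightarrow>
    (g \<odot>\<^bsub>sec (dual_sheaf X A) U\<^esub> \<phi>) V s = (\<lambda>x\<in>V. g x * \<phi> V s x)"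
  "res (dual_sheaf X A) U V \<phi> = restrict \<phi> (opens_in X V)"
  by (simp_all add: dual_sheaf_def hom_sheaf_def mk_module_def opens_in_iff structure_sheaf_simps cong: restrict_cong)

lemma dual_extensional:
  "\<zero>\<^bsub>sec (dual_sheaf X A) U\<^esub> \<in> extensional (opens_in X U)"
  "\<phi> \<oplus>\<^bsub>sec (dual_sheaf X A) U\<^esub> \<psi> \<in> extensional (opens_in X U)"
  "g \<odot>\<^bsub>sec (dual_sheaf X A) U\<^esub> \<phi> \<in> extensional (opens_in X U)"
  "space_open X V \<Longrightarrow> V \<subseteq> U \<Longrightarrow> \<zero>\<^bsub>sec (dual_sheaf X A) U\<^esub> V \<in> extensional (sections A V)"
  "space_open X V \<Longrightarrow> V \<subseteq> U \<Longrightarrow> (\<phi> \<oplus>\<^bsub>sec (dual_sheaf X A) U\<^esub> \<psi>) V \<in> extensional (sections A V)"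
  "space_open X V \<Longrightarrow> V \<subseteq> U \<Longrightarrow> (g \<odot>\<^bsub>sec (dual_sheaf X A) U\<^esub> \<phi>) V \<in> extensional (sections A V)"
  by (simp_all add: dual_sheaf_def hom_sheaf_def mk_module_def opens_in_iff)

lemma dualD:
  assumes "\<phi> \<in> sections (dual_sheaf X A) U" "space_open X U" "space_open X V" "V \<subseteq> U" "s \<in> sections A V"
  shows "\<phi> V s \<in> regular X V"
    "t \<in> sections A V \<Longrightarrow> \<phi> V (s \<oplus>\<^bsub>sec A V\<^esub> t) = (\<lambda>x\<in>V. \<phi> V s x + \<phi> V t x)"
    "f \<in> regular X V \<Longrightarrow> \<phi> V (f \<odot>\<^bsub>sec A V\<^esub> s) = (\<lambda>x\<in>V. f x * \<phi> V s x)"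
    "space_open X W \<Longrightarrow> W \<subseteq> V \<Longrightarrow> \<phi> W (res A V W s) = restrict (\<phi> V s) W"
  using assms by (simp_all add: sections_dual)

lemma dual_eqI:
  assumes "\<phi> \<in> sections (dual_sheaf X A) U" "\<psi> \<in> sections (dual_sheaf X A) U" and U: "space_open X U"
    and eq: "\<And>V s. space_open X V \<Longrightarrow> V \<subseteq> U \<Longrightarrow> s \<in> sections A V \<Longrightarrow> \<phi> V s = \<psi> V s"
  shows "\<phi> = \<psi>"
proof (rule extensionalityI[of _ "opens_in X U"])
  fix V assume "V \<in> opens_in X U"
  then show "\<phi> V = \<psi> V"
    using assms by (intro extensionalityI[of _ "sections A V"]) (auto simp: sections_dual opens_in_iff)
qed (use assms in \<open>simp_all add: sections_dual\<close>)

lemma dual_closed: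
  assumes A: "prelinear_presheaf X A" and U: "space_open X U"
  shows "\<zero>\<^bsub>sec (dual_sheaf X A) U\<^esub> \<in> sections (dual_sheaf X A) U"
    "\<phi> \<in> sections (dual_sheaf X A) U \<Longrightarrow> \<psi> \<in> sections (dual_sheaf X A) U \<Longrightarrow>
       \<phi> \<oplus>\<^bsub>sec (dual_sheaf X A) U\<^esub> \<psi> \<in> sections (dual_sheaf X A) U"
    "g \<in> regular X U \<Longrightarrow> \<phi> \<in> sections (dual_sheaf X A) U \<Longrightarrow>
       g \<odot>\<^bsub>sec (dual_sheaf X A) U\<^esub> \<phi> \<in> sections (dual_sheaf X A) U"
    "space_open X V \<Longrightarrow> V \<subseteq> U \<Longrightarrow> \<phi> \<in> sections (dual_sheaf X A) U \<Longrightarrow>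
       restrict \<phi> (opens_in X V) \<in> sections (dual_sheaf X A) V"
proof -
  note AD = prelinear_presheafD[OF A] and AR = set_presheafD(1)[OF prelinear_imp_set_presheaf[OF A]]
  show "\<zero>\<^bsub>sec (dual_sheaf X A) U\<^esub> \<in> sections (dual_sheaf X A) U"
    unfolding sections_dual[OF U]
  proof (intro conjI allI impI ballI)
    fix V s W assume "space_open X V \<and> V \<subseteq> U" "s \<in> sections A V" "space_open X W \<and> W \<subseteq> V"
    then show "\<zero>\<^bsub>sec (dual_sheaf X A) U\<^esub> W (res A V W s) = restrict (\<zero>\<^bsub>sec (dual_sheaf X A) U\<^esub> V s) W"
      using AR[of V W s] by (auto simp: dual_simps subset_iff restrict_def fun_eq_iff)
  qed (auto simp: dual_extensional dual_simps regular_const AD intro!: restrict_ext)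
  show "\<phi> \<oplus>\<^bsub>sec (dual_sheaf X A) U\<^esub> \<psi> \<in> sections (dual_sheaf X A) U"
    if p: "\<phi> \<in> sections (dual_sheaf X A) U" "\<psi> \<in> sections (dual_sheaf X A) U"
    unfolding sections_dual[OF U]
  proof (intro conjI allI impI ballI)
    fix V s W assume "space_open X V \<and> V \<subseteq> U" "s \<in> sections A V" "space_open X W \<and> W \<subseteq> V"
    moreover from this have "W \<subseteq> U" by auto
    ultimately show "(\<phi> \<oplus>\<^bsub>sec (dual_sheaf X A) U\<^esub> \<psi>) W (res A V W s) = restrict ((\<phi> \<oplus>\<^bsub>sec (dual_sheaf X A) U\<^esub> \<psi>) V s) W"
      using AR[of V W s] dualD(4)[OF p(1) U, of V s W] dualD(4)[OF p(2) U, of V s W]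
      by (auto simp: dual_simps restrict_def fun_eq_iff)
  qed (auto simp: dual_extensional dual_simps dualD[OF p(1) U] dualD[OF p(2) U] AD algebra_simps
      intro!: restrict_ext regular_add)
  show "g \<odot>\<^bsub>sec (dual_sheaf X A) U\<^esub> \<phi> \<in> sections (dual_sheaf X A) U"
    if g: "g \<in> regular X U" and p: "\<phi> \<in> sections (dual_sheaf X A) U"
    unfolding sections_dual[OF U]
  proof (intro conjI allI impI ballI)
    fix V s W assume "space_open X V \<and> V \<subseteq> U" "s \<in> sections A V" "space_open X W \<and> W \<subseteq> V"
    moreover from this have "W \<subseteq> U" by auto
    ultimately show "(g \<odot>\<^bsub>sec (dual_sheaf X A) U\<^esub> \<phi>) W (res A V W s) = restrict ((g \<odot>\<^bsub>sec (dual_sheaf X A) U\<^esub> \<phi>) V s) W"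
      using AR[of V W s] dualD(4)[OF p U, of V s W]
      by (auto simp: dual_simps restrict_def fun_eq_iff)
  next
    fix V s assume Vs: "space_open X V \<and> V \<subseteq> U" "s \<in> sections A V"
    then have "(\<lambda>x\<in>V. restrict g V x * \<phi> V s x) \<in> regular X V"
      by (intro regular_mult regular_restrict[OF U _ _ g] dualD(1)[OF p U]) auto
    then show "(g \<odot>\<^bsub>sec (dual_sheaf X A) U\<^esub> \<phi>) V s \<in> regular X V"
      using Vs by (simp add: dual_simps cong: restrict_cong)
  qed (auto simp: dual_extensional dual_simps dualD[OF p U] AD algebra_simps intro!: restrict_ext)
  show "restrict \<phi> (opens_in X V) \<in> sections (dual_sheaf X A) V"
    if V: "space_open X V" "V \<subseteq> U" and p: "\<phi> \<in> sections (dual_sheaf X A) U"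
    unfolding sections_dual[OF V(1)]
  proof (intro conjI allI impI ballI)
    fix W assume W: "space_open X W \<and> W \<subseteq> V"
    then have WU: "space_open X W" "W \<subseteq> U" "W \<in> opens_in X V" using V by (auto simp: opens_in_iff)
    show "restrict \<phi> (opens_in X V) W \<in> extensional (sections A W)"
      using p WU by (simp add: sections_dual[OF U])
    fix s assume s: "s \<in> sections A W"
    note d = dualD[OF p U WU(1,2) s]
    show "restrict \<phi> (opens_in X V) W s \<in> regular X W" using d WU by simp
    show "restrict \<phi> (opens_in X V) W (s \<oplus>\<^bsub>sec A W\<^esub> t) =
        (\<lambda>x\<in>W. restrict \<phi> (opens_in X V) W s x + restrict \<phi> (opens_in X V) W t x)" if "t \<in> sections A W" for t
      using d(2)[OF that] WU by simp
    show "restrict \<phi> (opens_in X V) W (f \<odot>\<^bsub>sec A W\<^esub> s) = (\<lambda>x\<in>W. f x * restrict \<phi> (opens_in X V) W s x)"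
      if "f \<in> regular X W" for f
      using d(3)[OF that] WU by simp
    show "restrict \<phi> (opens_in X V) W' (res A W W' s) = restrict (restrict \<phi> (opens_in X V) W s) W'"
      if "space_open X W' \<and> W' \<subseteq> W" for W'
      using d(4)[of W'] that W WU by (auto simp: opens_in_iff)
  qed simp
qed

text \<open>The dual occurs as the right factor of a tensor product, for which closure and
  compatibility with restriction suffice.\<close>

lemma prelinear_dual:
  assumes A: "prelinear_presheaf X A" shows "prelinear_presheaf X (dual_sheaf X A)"
proof -
  note cl = dual_closed[OF A]
  have "set_presheaf X (dual_sheaf X A)"
    unfolding set_presheaf_def
  proof (intro conjI allI impI ballI funcsetI)
    fix U V \<phi> assume "space_open X U \<and> space_open X V \<and> V \<subseteq> U" "\<phi> \<in> sections (dual_sheaf X A) U"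
    then show "res (dual_sheaf X A) U V \<phi> \<in> sections (dual_sheaf X A) V" by (auto simp: dual_simps intro: cl(4)[of U])
  next
    fix U \<phi> assume "space_open X U" "\<phi> \<in> sections (dual_sheaf X A) U"
    then show "res (dual_sheaf X A) U U \<phi> = \<phi>" by (simp add: dual_simps sections_dual extensional_restrict)
  next
    fix U V W \<phi> assume "space_open X U \<and> space_open X V \<and> space_open X W \<and> W \<subseteq> V \<and> V \<subseteq> U"
    then have "opens_in X W \<subseteq> opens_in X V" unfolding opens_in_def by blast
    then show "res (dual_sheaf X A) V W (res (dual_sheaf X A) U V \<phi>) = res (dual_sheaf X A) U W \<phi>"
      by (simp add: dual_simps Int_absorb1)
  qed
  moreover have "premodule (function_ring X U) (sec (dual_sheaf X A) U)" if U: "space_open X U" for U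
    unfolding premodule_def
    using cl(1,2,3)[OF U] by (auto simp: dual_simps intro!: dual_eqI[OF _ _ U] restrict_ext)
  moreover have "semilinear (function_ring X U) (function_ring X V) (\<lambda>f. restrict f V)
      (sec (dual_sheaf X A) U) (sec (dual_sheaf X A) V) (res (dual_sheaf X A) U V)"
    if UV: "space_open X U" "space_open X V" "V \<subseteq> U" for U V
    unfolding semilinear_def
  proof (intro conjI ballI funcsetI)
    fix \<phi> \<psi> assume p: "\<phi> \<in> sections (dual_sheaf X A) U" "\<psi> \<in> sections (dual_sheaf X A) U"
    show "res (dual_sheaf X A) U V (\<phi> \<oplus>\<^bsub>sec (dual_sheaf X A) U\<^esub> \<psi>) =
        res (dual_sheaf X A) U V \<phi> \<oplus>\<^bsub>sec (dual_sheaf X A) V\<^esub> res (dual_sheaf X A) U V \<psi>"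
      using cl(2)[OF UV(1) p] cl(2)[OF UV(2) cl(4)[OF UV p(1)] cl(4)[OF UV p(2)]] UV
      by (intro dual_eqI[where A = A, OF _ _ UV(2)]) (auto simp: dual_simps opens_in_iff cl(4)[OF UV])
  next
    fix f \<phi> assume p: "f \<in> carrier (function_ring X U)" "\<phi> \<in> sections (dual_sheaf X A) U"
    then have f: "f \<in> regular X U" by simp
    show "res (dual_sheaf X A) U V (f \<odot>\<^bsub>sec (dual_sheaf X A) U\<^esub> \<phi>) =
        restrict f V \<odot>\<^bsub>sec (dual_sheaf X A) V\<^esub> res (dual_sheaf X A) U V \<phi>"
    proof (rule dual_eqI[where A = A, OF _ _ UV(2)])
      fix W s assume "space_open X W" "W \<subseteq> V" "s \<in> sections A W"
      moreover from this have "W \<subseteq> U" using UV by auto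
      ultimately show "res (dual_sheaf X A) U V (f \<odot>\<^bsub>sec (dual_sheaf X A) U\<^esub> \<phi>) W s =
          (restrict f V \<odot>\<^bsub>sec (dual_sheaf X A) V\<^esub> res (dual_sheaf X A) U V \<phi>) W s"
        by (auto simp: dual_simps opens_in_iff intro!: restrict_ext)
    qed (use cl(3)[OF UV(1) f p(2)] cl(3)[OF UV(2) regular_restrict[OF UV f] cl(4)[OF UV p(2)]] in
        \<open>auto simp: dual_simps intro: cl(4)[OF UV]\<close>)
  qed (use UV regular_restrict[OF UV] cl(4)[OF UV(1)] in \<open>auto simp: dual_simps\<close>)
  moreover have "res (dual_sheaf X A) U V \<zero>\<^bsub>sec (dual_sheaf X A) U\<^esub> = \<zero>\<^bsub>sec (dual_sheaf X A) V\<^esub>"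
    if UV: "space_open X U" "space_open X V" "V \<subseteq> U" for U V
    using cl(1)[OF UV(1)] cl(1)[OF UV(2)] UV
    by (intro dual_eqI[where A = A, OF _ _ UV(2)]) (auto simp: dual_simps opens_in_iff cl(4)[OF UV])
  ultimately show ?thesis by (simp add: prelinear_presheaf_def)
qed

end

section \<open>Consequences of irreducibility\<close>

locale irreducible_function_space = function_space +
  assumes regular_nonzero_open: "space_open X U \<Longrightarrow> f \<in> regular X U \<Longrightarrow> space_open X {x \<in> U. f x \<noteq> 0}"
    and opens_meet: "space_open X U \<Longrightarrow> space_open X V \<Longrightarrow> U \<noteq> {} \<Longrightarrow> V \<noteq> {} \<Longrightarrow> U \<inter> V \<noteq> {}"
begin

text \<open>The set where \<open>f\<close> does not vanish is open and disjoint from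
  \<open>W\<close>; two nonempty open sets would meet.\<close>

lemma identity_principle:
  assumes "space_open X U" "f \<in> regular X U" "space_open X W" "W \<subseteq> U" "W \<noteq> {}"
    and "\<And>x. x \<in> W \<Longrightarrow> f x = 0" and "x \<in> U"
  shows "f x = 0"
  using opens_meet[OF regular_nonzero_open[OF assms(1,2)] assms(3)] assms by blast

text \<open>If neither factor vanished identically, the two sets of nonvanishing would be nonempty
  and open, hence share a point, and the product would be nonzero there.\<close>

lemma regular_domain:
  assumes "space_open X U" "f \<in> regular X U" "g \<in> regular X U" "\<And>x. x \<in> U \<Longrightarrow> f x * g x = 0"
  shows "(\<forall>x\<in>U. f x = 0) \<or> (\<forall>x\<in>U. g x = 0)"
  using opens_meet[OF regular_nonzero_open[OF assms(1,2)] regular_nonzero_open[OF assms(1,3)]] assms(4)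
  by fastforce

text \<open>For fixed \<open>V\<close> and \<open>f\<close> the function \<open>D V f\<close> is
  regular on \<open>V\<close> and vanishes on \<open>V \<inter> W\<close>, which is nonempty by
  irreducibility; the identity principle for functions applies.\<close>

lemma derivation_identity_principle:
  assumes D: "sheaf_derivation X U D" and U: "space_open X U" and W: "space_open X W" "W \<subseteq> U" "W \<noteq> {}"
    and z: "restrict D (opens_in X W) = \<zero>\<^bsub>sec (tangent_sheaf X) W\<^esub>"
  shows "D = \<zero>\<^bsub>sec (tangent_sheaf X) U\<^esub>"
proof (rule sheaf_derivation_eqI[OF D tangent_closed(1)[OF U]])
  fix V f x assume V: "space_open X V" "V \<subseteq> U" "f \<in> regular X V" "x \<in> V"
  have VW: "space_open X (V \<inter> W)" using V W by auto
  have "D V f y = 0" if y: "y \<in> V \<inter> W" for y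
  proof -
    have r: "restrict f (V \<inter> W) \<in> regular X (V \<inter> W)" using V VW by (intro regular_restrict[of V]) auto
    have "D V f y = D (V \<inter> W) (restrict f (V \<inter> W)) y"
      using V VW y by (intro derivation_restrict[OF D, symmetric]) auto
    also have "\<dots> = restrict D (opens_in X W) (V \<inter> W) (restrict f (V \<inter> W)) y"
      using VW by (simp add: opens_in_iff)
    also have "\<dots> = 0" unfolding z using VW r y by (intro tangent_simps) auto
    finally show ?thesis .
  qed
  moreover have "D V f \<in> regular X V" using V by (intro sheaf_derivationD(3)[OF D]) (auto simp: opens_in_iff)
  moreover have "V \<inter> W \<noteq> {}" using opens_meet[OF V(1) W(1)] V W by auto
  ultimately have "D V f x = 0" using identity_principle[OF V(1) _ VW] V(4) by blast
  then show "D V f x = \<zero>\<^bsub>sec (tangent_sheaf X) U\<^esub> V f x" using V by (simp add: tangent_simps)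
qed

end

section \<open>Homomorphisms from a tensor product to the tangent sheaf\<close>

lemma frag_eval_scale: "frag_eval (\<lambda>i. c * b i) k = c * frag_eval b k"
  by (simp add: frag_eval_def sum_distrib_left algebra_simps)

lemma frag_eval_add_fun: "frag_eval (\<lambda>i. b i + b' i) k = frag_eval b k + frag_eval b' k"
  by (simp add: frag_eval_def sum.distrib algebra_simps)

lemma (in function_space) regular_frag_eval:
  assumes U: "space_open X U" and g: "\<And>i. i \<in> Poly_Mapping.keys k \<Longrightarrow> g i \<in> regular X U"
  shows "(\<lambda>x\<in>U. frag_eval (\<lambda>i. g i x) k) \<in> regular X U"
proof -
  have "(\<lambda>x\<in>U. \<Sum>i\<in>S. of_int (Poly_Mapping.lookup k i) * g i x) \<in> regular X U"
    if "finite S" "S \<subseteq> Poly_Mapping.keys k" for S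
    using that
  proof (induction S rule: finite_induct)
    case empty
    then show ?case using regular_const[OF U, of 0] by (simp add: restrict_def)
  next
    case (insert i S)
    then show ?case
      using regular_add[OF U regular_scale[OF U g[of i], of "of_int (Poly_Mapping.lookup k i)"] insert.IH]
      by (simp add: restrict_def cong: if_cong)
  qed
  then show ?thesis unfolding frag_eval_def by simp
qed

context prelinear_pair
begin

text \<open>Made so that \<open>frag_eval\<close> kills the three kinds of relations and is
  unchanged under restriction. The third condition is balancedness rather than linearity over
  functions, since the scalar relation says no more.\<close>

definition pairing :: "'p set \<Rightarrow> ('p set \<Rightarrow> 'm \<Rightarrow> 'n \<Rightarrow> 'p \<Rightarrow> complex) \<Rightarrow> bool" where
  "pairing V b \<longleftrightarrow> (\<forall>W. space_open X W \<and> W \<subseteq> V \<longrightarrow> (\<forall>x\<in>W. \<forall>m\<in>sections F W. \<forall>n\<in>sections G W.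
     (\<forall>m'\<in>sections F W. b W (m \<oplus>\<^bsub>sec F W\<^esub> m') n x = b W m n x + b W m' n x) \<and>
     (\<forall>n'\<in>sections G W. b W m (n \<oplus>\<^bsub>sec G W\<^esub> n') x = b W m n x + b W m n' x) \<and>
     (\<forall>f\<in>regular X W. b W (f \<odot>\<^bsub>sec F W\<^esub> m) n x = b W m (f \<odot>\<^bsub>sec G W\<^esub> n) x) \<and>
     (\<forall>W'. space_open X W' \<and> x \<in> W' \<and> W' \<subseteq> W \<longrightarrow> b W' (res F W W' m) (res G W W' n) x = b W m n x)))"

lemma pairing_relations:
  assumes b: "pairing V b" and W: "space_open X W" "W \<subseteq> V" "x \<in> W"
    and k: "k \<in> tensor_relations (function_ring X W) (sec F W) (sec G W)"
  shows "frag_eval (\<lambda>(m, n). b W m n x) k = 0"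
  using prelinear_presheafD(5)[OF prelinear_left W(1)] prelinear_presheafD(5)[OF prelinear_right W(1)] k
proof (induction rule: tensor_relations_induct)
  case (add_left m m' n)
  then show ?case using b W by (simp add: pairing_def frag_eval_diff)
next
  case (add_right m n n')
  then show ?case using b W by (simp add: pairing_def frag_eval_diff)
next
  case (smult f m n)
  then show ?case using b W by (simp add: pairing_def frag_eval_diff)
qed (simp_all add: frag_eval_diff)

text \<open>Two representatives of a germ agree, up to relations, after restriction to a common
  neighbourhood. Restriction does not change the value, and relations have value zero.\<close>

lemma pairing_germ:
  assumes b: "pairing V b"
    and W: "space_open X W" "W \<subseteq> V" "x \<in> W" "Poly_Mapping.keys k \<subseteq> sections F W \<times> sections G W"
    and W': "space_open X W'" "W' \<subseteq> V" "x \<in> W'" "Poly_Mapping.keys k' \<subseteq> sections F W' \<times> sections G W'"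
    and eq: "germ X (tensor_presheaf X F G) x W (tc W k) = germ X (tensor_presheaf X F G) x W' (tc W' k')"
  shows "frag_eval (\<lambda>(m, n). b W m n x) k = frag_eval (\<lambda>(m, n). b W' m n x) k'"
proof -
  obtain N where N: "space_open X N" "x \<in> N" "N \<subseteq> W" "N \<subseteq> W'"
    "res (tensor_presheaf X F G) W N (tc W k) = res (tensor_presheaf X F G) W' N (tc W' k')"
    using germ_local[OF set_presheaf_tensor W(1,3) tc_in_tensor[OF W(1,4)] W'(1,3) tc_in_tensor[OF W'(1,4)] eq] .
  have nat: "frag_eval (\<lambda>(m, n). b N m n x) (frag_map2 (res F U N) (res G U N) l) = frag_eval (\<lambda>(m, n). b U m n x) l"
    if "space_open X U" "N \<subseteq> U" "U \<subseteq> V" "Poly_Mapping.keys l \<subseteq> sections F U \<times> sections G U" for U l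
  proof -
    have "b N (res F U N m) (res G U N n) x = b U m n x" if "(m, n) \<in> Poly_Mapping.keys l" for m n
    proof -
      have "m \<in> sections F U" "n \<in> sections G U" using that \<open>Poly_Mapping.keys l \<subseteq> _\<close> by auto
      then show ?thesis using b N(1,2) \<open>space_open X U\<close> \<open>N \<subseteq> U\<close> \<open>U \<subseteq> V\<close> unfolding pairing_def by (meson subsetD)
    qed
    then show ?thesis unfolding frag_eval_map2 by (intro frag_eval_cong) auto
  qed
  have "frag_map2 (res F W N) (res G W N) k - frag_map2 (res F W' N) (res G W' N) k'
      \<in> tensor_relations (function_ring X N) (sec F N) (sec G N)"
    using N(5) by (simp add: res_tensor W W' N(1-4) tc_eq_iff)
  from pairing_relations[OF b N(1) _ N(2) this] N(3) W(2)
  show ?thesis using W W' N by (simp add: frag_eval_diff nat)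
qed

text \<open>There is no canonical representative of a germ, so the value is taken from an arbitrary
  one; \<open>pairing_germ\<close> shows that the choice is immaterial.\<close>

definition pair_value :: "('p set \<Rightarrow> 'm \<Rightarrow> 'n \<Rightarrow> 'p \<Rightarrow> complex) \<Rightarrow> 'p set \<Rightarrow> ('p, ('m, 'n) tensor) germ_section \<Rightarrow> 'p \<Rightarrow> complex" where
  "pair_value b V \<sigma> x = (SOME z. \<exists>W k. space_open X W \<and> x \<in> W \<and> W \<subseteq> V \<and>
     Poly_Mapping.keys k \<subseteq> sections F W \<times> sections G W \<and>
     \<sigma> x = germ X (tensor_presheaf X F G) x W (tc W k) \<and> z = frag_eval (\<lambda>(m, n). b W m n x) k)"

lemma pair_value_eq:
  assumes b: "pairing V b"
    and W: "space_open X W" "W \<subseteq> V" "x \<in> W" "Poly_Mapping.keys k \<subseteq> sections F W \<times> sections G W"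
    and eq: "\<sigma> x = germ X (tensor_presheaf X F G) x W (tc W k)"
  shows "pair_value b V \<sigma> x = frag_eval (\<lambda>(m, n). b W m n x) k"
  unfolding pair_value_def
proof (rule some_equality)
  fix z assume "\<exists>W k. space_open X W \<and> x \<in> W \<and> W \<subseteq> V \<and>
     Poly_Mapping.keys k \<subseteq> sections F W \<times> sections G W \<and>
     \<sigma> x = germ X (tensor_presheaf X F G) x W (tc W k) \<and> z = frag_eval (\<lambda>(m, n). b W m n x) k"
  then obtain W' k' where W': "space_open X W'" "W' \<subseteq> V" "x \<in> W'" "Poly_Mapping.keys k' \<subseteq> sections F W' \<times> sections G W'"
     "\<sigma> x = germ X (tensor_presheaf X F G) x W' (tc W' k')" "z = frag_eval (\<lambda>(m, n). b W' m n x) k'" by blast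
  then show "z = frag_eval (\<lambda>(m, n). b W m n x) k"
    using pairing_germ[OF b W'(1-4) W] eq by simp
qed (use W eq in blast)

text \<open>Near any point a section is given by one formal sum, and the neighbourhood can be taken
  inside a prescribed \<open>N\<close>. This is how computations with sections of the sheaf return
  to formal sums.\<close>

lemma tensor_sheaf_local:
  assumes "\<sigma> \<in> sections (tensor_sheaf X F G) U" "x \<in> U" "space_open X N" "x \<in> N"
  obtains W k where "space_open X W" "x \<in> W" "W \<subseteq> U" "W \<subseteq> N"
    "Poly_Mapping.keys k \<subseteq> sections F W \<times> sections G W"
    "\<And>y. y \<in> W \<Longrightarrow> \<sigma> y = germ X (tensor_presheaf X F G) y W (tc W k)"
proof -
  obtain V t where V: "space_open X V" "x \<in> V" "V \<subseteq> U" "t \<in> sections (tensor_presheaf X F G) V"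
    "\<forall>y\<in>V. \<sigma> y = germ X (tensor_presheaf X F G) y V t"
    using assms(1,2) unfolding tensor_sheaf_def sections_sheafify by blast
  have W: "space_open X (V \<inter> N)" "V \<inter> N \<subseteq> V" using V assms by auto
  have "res (tensor_presheaf X F G) V (V \<inter> N) t \<in> sections (tensor_presheaf X F G) (V \<inter> N)"
    using set_presheafD(1)[OF set_presheaf_tensor V(1) W V(4)] .
  then obtain k where k: "Poly_Mapping.keys k \<subseteq> sections F (V \<inter> N) \<times> sections G (V \<inter> N)"
    "res (tensor_presheaf X F G) V (V \<inter> N) t = tc (V \<inter> N) k"
    by (auto simp: sections_tensor W)
  have "\<sigma> y = germ X (tensor_presheaf X F G) y (V \<inter> N) (tc (V \<inter> N) k)" if "y \<in> V \<inter> N" for y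
    using germ_restrict[OF set_presheaf_tensor V(1) W that V(4)] V(5) that k(2) by auto
  then show thesis using that[of "V \<inter> N" k] W V assms k by blast
qed

text \<open>A bilinear map F \<times> G \<rightarrow> T over the structure sheaf, spelled out
  through the numbers obtained from a function \<open>h\<close> at a point \<open>x\<close>. The
  last condition is naturality in the open set.\<close>

definition der_pairing :: "'p set \<Rightarrow>
    ('p set \<Rightarrow> 'm \<Rightarrow> 'n \<Rightarrow> 'p set \<Rightarrow> ('p \<Rightarrow> complex) \<Rightarrow> 'p \<Rightarrow> complex) \<Rightarrow> bool" where
  "der_pairing U B \<longleftrightarrow> (\<forall>W. space_open X W \<and> W \<subseteq> U \<longrightarrow> (\<forall>m\<in>sections F W. \<forall>n\<in>sections G W.
     sheaf_derivation X W (B W m n) \<and>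
     (\<forall>V h x. space_open X V \<and> V \<subseteq> W \<and> h \<in> regular X V \<and> x \<in> V \<longrightarrow>
       (\<forall>m'\<in>sections F W. B W (m \<oplus>\<^bsub>sec F W\<^esub> m') n V h x = B W m n V h x + B W m' n V h x) \<and>
       (\<forall>n'\<in>sections G W. B W m (n \<oplus>\<^bsub>sec G W\<^esub> n') V h x = B W m n V h x + B W m n' V h x) \<and>
       (\<forall>f\<in>regular X W. B W (f \<odot>\<^bsub>sec F W\<^esub> m) n V h x = f x * B W m n V h x \<and>
          B W m (f \<odot>\<^bsub>sec G W\<^esub> n) V h x = f x * B W m n V h x) \<and>
       (\<forall>W'. space_open X W' \<and> V \<subseteq> W' \<and> W' \<subseteq> W \<longrightarrow>
          B W' (res F W W' m) (res G W W' n) V h x = B W m n V h x))))"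

lemma der_pairingD:
  assumes "der_pairing U B" "space_open X W" "W \<subseteq> U" "m \<in> sections F W" "n \<in> sections G W"
  shows "sheaf_derivation X W (B W m n)"
    "space_open X V \<Longrightarrow> V \<subseteq> W \<Longrightarrow> h \<in> regular X V \<Longrightarrow> x \<in> V \<Longrightarrow> m' \<in> sections F W \<Longrightarrow>
      B W (m \<oplus>\<^bsub>sec F W\<^esub> m') n V h x = B W m n V h x + B W m' n V h x"
    "space_open X V \<Longrightarrow> V \<subseteq> W \<Longrightarrow> h \<in> regular X V \<Longrightarrow> x \<in> V \<Longrightarrow> n' \<in> sections G W \<Longrightarrow>
      B W m (n \<oplus>\<^bsub>sec G W\<^esub> n') V h x = B W m n V h x + B W m n' V h x"
    "space_open X V \<Longrightarrow> V \<subseteq> W \<Longrightarrow> h \<in> regular X V \<Longrightarrow> x \<in> V \<Longrightarrow> f \<in> regular X W \<Longrightarrow>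
      B W (f \<odot>\<^bsub>sec F W\<^esub> m) n V h x = f x * B W m n V h x"
    "space_open X V \<Longrightarrow> V \<subseteq> W \<Longrightarrow> h \<in> regular X V \<Longrightarrow> x \<in> V \<Longrightarrow> f \<in> regular X W \<Longrightarrow>
      B W m (f \<odot>\<^bsub>sec G W\<^esub> n) V h x = f x * B W m n V h x"
    "space_open X V \<Longrightarrow> V \<subseteq> W' \<Longrightarrow> h \<in> regular X V \<Longrightarrow> x \<in> V \<Longrightarrow> space_open X W' \<Longrightarrow> W' \<subseteq> W \<Longrightarrow>
      B W' (res F W W' m) (res G W W' n) V h x = B W m n V h x"
proof -
  have "sheaf_derivation X W (B W m n) \<and>
     (\<forall>V h x. space_open X V \<and> V \<subseteq> W \<and> h \<in> regular X V \<and> x \<in> V \<longrightarrow>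
       (\<forall>m'\<in>sections F W. B W (m \<oplus>\<^bsub>sec F W\<^esub> m') n V h x = B W m n V h x + B W m' n V h x) \<and>
       (\<forall>n'\<in>sections G W. B W m (n \<oplus>\<^bsub>sec G W\<^esub> n') V h x = B W m n V h x + B W m n' V h x) \<and>
       (\<forall>f\<in>regular X W. B W (f \<odot>\<^bsub>sec F W\<^esub> m) n V h x = f x * B W m n V h x \<and>
          B W m (f \<odot>\<^bsub>sec G W\<^esub> n) V h x = f x * B W m n V h x) \<and>
       (\<forall>W'. space_open X W' \<and> V \<subseteq> W' \<and> W' \<subseteq> W \<longrightarrow>
          B W' (res F W W' m) (res G W W' n) V h x = B W m n V h x))" (is "?P \<and> (\<forall>V h x. ?H V h x \<longrightarrow> ?Q V h x)")
    using assms unfolding der_pairing_def by (elim allE[of _ W]) simp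
  then have P: ?P and Q: "\<And>V h x. ?H V h x \<Longrightarrow> ?Q V h x" by blast+
  show ?P by (fact P)
  show "space_open X V \<Longrightarrow> V \<subseteq> W \<Longrightarrow> h \<in> regular X V \<Longrightarrow> x \<in> V \<Longrightarrow> m' \<in> sections F W \<Longrightarrow>
      B W (m \<oplus>\<^bsub>sec F W\<^esub> m') n V h x = B W m n V h x + B W m' n V h x"
    "space_open X V \<Longrightarrow> V \<subseteq> W \<Longrightarrow> h \<in> regular X V \<Longrightarrow> x \<in> V \<Longrightarrow> n' \<in> sections G W \<Longrightarrow>
      B W m (n \<oplus>\<^bsub>sec G W\<^esub> n') V h x = B W m n V h x + B W m n' V h x"
    "space_open X V \<Longrightarrow> V \<subseteq> W \<Longrightarrow> h \<in> regular X V \<Longrightarrow> x \<in> V \<Longrightarrow> f \<in> regular X W \<Longrightarrow>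
      B W (f \<odot>\<^bsub>sec F W\<^esub> m) n V h x = f x * B W m n V h x"
    "space_open X V \<Longrightarrow> V \<subseteq> W \<Longrightarrow> h \<in> regular X V \<Longrightarrow> x \<in> V \<Longrightarrow> f \<in> regular X W \<Longrightarrow>
      B W m (f \<odot>\<^bsub>sec G W\<^esub> n) V h x = f x * B W m n V h x"
    using Q[of V h x] by simp_all
  show "space_open X V \<Longrightarrow> V \<subseteq> W' \<Longrightarrow> h \<in> regular X V \<Longrightarrow> x \<in> V \<Longrightarrow> space_open X W' \<Longrightarrow> W' \<subseteq> W \<Longrightarrow>
      B W' (res F W W' m) (res G W W' n) V h x = B W m n V h x"
    using Q[of V h x] by auto
qed

text \<open>Fixing the function \<open>h\<close> turns a derivation-valued pairing into a
  complex-valued one. \<open>h\<close> has to be restricted to each \<open>W\<close>, so naturality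
  combines that of \<open>B\<close> with that of the derivation.\<close>

lemma pairing_of_der_pairing:
  assumes B: "der_pairing U B" and V: "space_open X V" "V \<subseteq> U" and h: "h \<in> regular X V"
  shows "pairing V (\<lambda>W m n. B W m n W (restrict h W))"
  unfolding pairing_def
proof (intro allI impI ballI)
  fix W x m n
  assume W: "space_open X W \<and> W \<subseteq> V" and x: "x \<in> W" and m: "m \<in> sections F W" and n: "n \<in> sections G W"
  have WU: "space_open X W" "W \<subseteq> U" using W V by auto
  have hW: "restrict h W \<in> regular X W" using V h W by (auto intro!: regular_restrict[of V])
  note d = der_pairingD[OF B WU m n]
  have "B W' (res F W W' m) (res G W W' n) W' (restrict h W') x = B W m n W (restrict h W) x"
    if W': "space_open X W' \<and> x \<in> W' \<and> W' \<subseteq> W" for W'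
  proof -
    have hW': "restrict h W' \<in> regular X W'" using V h W W' by (intro regular_restrict[of V]) auto
    have "B W' (res F W W' m) (res G W W' n) W' (restrict h W') x = B W m n W' (restrict h W') x"
      using W' hW' by (intro d(6)) auto
    also have "\<dots> = B W m n W' (restrict (restrict h W) W') x" using W' by (simp add: Int_absorb1)
    also have "\<dots> = B W m n W (restrict h W) x"
      using W' WU hW by (intro derivation_restrict[OF d(1)]) auto
    finally show ?thesis .
  qed
  moreover have "B W (m \<oplus>\<^bsub>sec F W\<^esub> m') n W (restrict h W) x =
      B W m n W (restrict h W) x + B W m' n W (restrict h W) x" if "m' \<in> sections F W" for m'
    using d(2)[OF WU(1) subset_refl hW x that] .
  moreover have "B W m (n \<oplus>\<^bsub>sec G W\<^esub> n') W (restrict h W) x =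
      B W m n W (restrict h W) x + B W m n' W (restrict h W) x" if "n' \<in> sections G W" for n'
    using d(3)[OF WU(1) subset_refl hW x that] .
  moreover have "B W (f \<odot>\<^bsub>sec F W\<^esub> m) n W (restrict h W) x = B W m (f \<odot>\<^bsub>sec G W\<^esub> n) W (restrict h W) x"
    if "f \<in> regular X W" for f
    using d(4)[OF WU(1) subset_refl hW x that] d(5)[OF WU(1) subset_refl hW x that] by simp
  ultimately show "(\<forall>m'\<in>sections F W. B W (m \<oplus>\<^bsub>sec F W\<^esub> m') n W (restrict h W) x =
          B W m n W (restrict h W) x + B W m' n W (restrict h W) x) \<and>
      (\<forall>n'\<in>sections G W. B W m (n \<oplus>\<^bsub>sec G W\<^esub> n') W (restrict h W) x =
          B W m n W (restrict h W) x + B W m n' W (restrict h W) x) \<and>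
      (\<forall>f\<in>regular X W. B W (f \<odot>\<^bsub>sec F W\<^esub> m) n W (restrict h W) x = B W m (f \<odot>\<^bsub>sec G W\<^esub> n) W (restrict h W) x) \<and>
      (\<forall>W'. space_open X W' \<and> x \<in> W' \<and> W' \<subseteq> W \<longrightarrow>
          B W' (res F W W' m) (res G W W' n) W' (restrict h W') x = B W m n W (restrict h W) x)"
    by blast
qed

text \<open>The map F \<otimes> G \<rightarrow> T which the universal property attaches to
  \<open>B\<close>. It is given by its values on functions at points, because a section is a sum of
  pure tensors only locally.\<close>

definition contraction :: "'p set \<Rightarrow>
    ('p set \<Rightarrow> 'm \<Rightarrow> 'n \<Rightarrow> 'p set \<Rightarrow> ('p \<Rightarrow> complex) \<Rightarrow> 'p \<Rightarrow> complex) \<Rightarrow>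
    ('p, ('m, 'n) tensor) germ_section \<Rightarrow> 'p set \<Rightarrow> ('p \<Rightarrow> complex) \<Rightarrow> 'p \<Rightarrow> complex" where
  "contraction U B \<sigma> = (\<lambda>V\<in>opens_in X U. \<lambda>h\<in>regular X V. \<lambda>x\<in>V.
     pair_value (\<lambda>W m n. B W m n W (restrict h W)) V \<sigma> x)"

lemma contraction_value:
  assumes B: "der_pairing U B" and V: "space_open X V" "V \<subseteq> U" "h \<in> regular X V"
    and W: "space_open X W" "W \<subseteq> V" "x \<in> W" "Poly_Mapping.keys k \<subseteq> sections F W \<times> sections G W"
    and eq: "\<sigma> x = germ X (tensor_presheaf X F G) x W (tc W k)"
  shows "contraction U B \<sigma> V h x = frag_eval (\<lambda>(m, n). B W m n W (restrict h W) x) k"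
proof -
  have "x \<in> V" using W by auto
  then show ?thesis
    using pair_value_eq[where \<sigma> = \<sigma> and x = x, OF pairing_of_der_pairing[OF B V] W eq] V
    by (simp add: contraction_def opens_in_iff)
qed

lemma contraction_derivation:
  assumes B: "der_pairing U B" and U: "space_open X U" and s: "\<sigma> \<in> sections (tensor_sheaf X F G) U"
  shows "sheaf_derivation X U (contraction U B \<sigma>)"
  unfolding contraction_def
proof (rule sheaf_derivationI[OF U])
  let ?d = "\<lambda>V h. pair_value (\<lambda>W m n. B W m n W (restrict h W)) V \<sigma>"
  have val: "?d V h x = frag_eval (\<lambda>(m, n). B W m n W (restrict h W) x) k"
    if "space_open X V" "V \<subseteq> U" "h \<in> regular X V" "space_open X W" "W \<subseteq> V" "x \<in> W"
      "Poly_Mapping.keys k \<subseteq> sections F W \<times> sections G W"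
      "\<sigma> x = germ X (tensor_presheaf X F G) x W (tc W k)" for V h W x k
    using that by (intro pair_value_eq[OF pairing_of_der_pairing[OF B]]) auto
  have der: "sheaf_derivation X W (B W (fst i) (snd i))"
    if "space_open X W" "W \<subseteq> U" "Poly_Mapping.keys k \<subseteq> sections F W \<times> sections G W" "i \<in> Poly_Mapping.keys k" for W i k
    using der_pairingD(1)[OF B that(1,2), of "fst i" "snd i"] that(3,4) by auto
  fix V h assume V: "space_open X V" "V \<subseteq> U" and h: "h \<in> regular X V"
  show "(\<lambda>x\<in>V. ?d V h x) \<in> regular X V"
  proof (rule regular_local[OF V(1)])
    \<comment> \<open>Near \<open>x\<close> the section is one formal sum \<open>k\<close>, so the
      values form an integer combination of regular functions; regularity is local.\<close>
    fix x assume x: "x \<in> V"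
    then have "x \<in> U" using V by auto
    then obtain W k where W: "space_open X W" "x \<in> W" "W \<subseteq> U" "W \<subseteq> V"
      "Poly_Mapping.keys k \<subseteq> sections F W \<times> sections G W"
      "\<And>y. y \<in> W \<Longrightarrow> \<sigma> y = germ X (tensor_presheaf X F G) y W (tc W k)"
      using tensor_sheaf_local[OF s _ V(1) x] by blast
    have "(\<lambda>x\<in>W. frag_eval (\<lambda>i. B W (fst i) (snd i) W (restrict h W) x) k) \<in> regular X W"
      using W V h
      by (intro regular_frag_eval sheaf_derivationD(3)[OF der]) (auto simp: opens_in_iff intro!: regular_restrict[of V])
    also have "(\<lambda>x\<in>W. frag_eval (\<lambda>i. B W (fst i) (snd i) W (restrict h W) x) k) = restrict (\<lambda>x\<in>V. ?d V h x) W"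
    proof
      fix y show "(\<lambda>x\<in>W. frag_eval (\<lambda>i. B W (fst i) (snd i) W (restrict h W) x) k) y = restrict (\<lambda>x\<in>V. ?d V h x) W y"
        using val[OF V h W(1,4) _ W(5) W(6), of y] W(4) by (auto simp: split_def)
    qed
    finally show "\<exists>W. space_open X W \<and> x \<in> W \<and> W \<subseteq> V \<and> restrict (\<lambda>x\<in>V. ?d V h x) W \<in> regular X W"
      using W by blast
  qed simp
  \<comment> \<open>At a point the contraction is an integer combination of the derivations
    \<open>B W m n\<close>, and the rules for derivations pass to integer combinations.\<close>
  { fix x assume x: "x \<in> V"
    then have "x \<in> U" using V by auto
    then obtain W k where W: "space_open X W" "x \<in> W" "W \<subseteq> U" "W \<subseteq> V"
      "Poly_Mapping.keys k \<subseteq> sections F W \<times> sections G W"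
      "\<And>y. y \<in> W \<Longrightarrow> \<sigma> y = germ X (tensor_presheaf X F G) y W (tc W k)"
      using tensor_sheaf_local[OF s _ V(1) x] by blast
    have hW: "restrict g W \<in> regular X W" if "g \<in> regular X V" for g
      using that V W by (intro regular_restrict[of V]) auto
    have v: "?d V g x = frag_eval (\<lambda>i. B W (fst i) (snd i) W (restrict g W) x) k" if "g \<in> regular X V" for g
      using val[OF V that W(1,4,2,5) W(6)[OF W(2)]] by (simp add: split_def)
    note dv = derivation_value[OF der[OF W(1,3,5)] W(1) subset_refl hW hW W(2)]
    have ra: "restrict (\<lambda>x\<in>V. h x + g x) W = (\<lambda>x\<in>W. restrict h W x + restrict g W x)"
      "restrict (\<lambda>x\<in>V. h x * g x) W = (\<lambda>x\<in>W. restrict h W x * restrict g W x)"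
      "restrict (\<lambda>x\<in>V. c * h x) W = (\<lambda>x\<in>W. c * restrict h W x)" for g c
      using W(4) by (auto simp: fun_eq_iff)
    show "?d V (\<lambda>x\<in>V. h x + g x) x = ?d V h x + ?d V g x" if g: "g \<in> regular X V" for g
      unfolding v[OF regular_add[OF V(1) h g]] v[OF h] v[OF g] ra
      by (subst frag_eval_add_fun[symmetric], rule frag_eval_cong) (rule dv(1)[OF _ h g])
    show "?d V (\<lambda>x\<in>V. h x * g x) x = h x * ?d V g x + g x * ?d V h x" if g: "g \<in> regular X V" for g
      unfolding v[OF regular_mult[OF V(1) h g]] v[OF h] v[OF g] ra
      by (subst frag_eval_scale[symmetric], subst frag_eval_scale[symmetric], subst frag_eval_add_fun[symmetric],
          rule frag_eval_cong) (use dv(2)[OF _ h g] W(2) in simp)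
    show "?d V (\<lambda>x\<in>V. c * h x) x = c * ?d V h x" for c
      unfolding v[OF regular_scale[OF V(1) h]] v[OF h] ra
      by (subst frag_eval_scale[symmetric], rule frag_eval_cong) (rule dv(3)[OF _ h h])
  }
  fix V' x assume V': "space_open X V'" "V' \<subseteq> V" "x \<in> V'"
  then have "x \<in> U" using V by auto
  then obtain W k where W: "space_open X W" "x \<in> W" "W \<subseteq> U" "W \<subseteq> V'"
    "Poly_Mapping.keys k \<subseteq> sections F W \<times> sections G W"
    "\<And>y. y \<in> W \<Longrightarrow> \<sigma> y = germ X (tensor_presheaf X F G) y W (tc W k)"
    using tensor_sheaf_local[OF s _ V'(1,3)] by blast
  have rr: "restrict (restrict h V') W = restrict h W" using W(4) by (simp add: Int_absorb1)
  show "?d V' (restrict h V') x = ?d V h x"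
    using val[OF V'(1) _ regular_restrict[OF V(1) V'(1,2) h] W(1,4,2,5) W(6)[OF W(2)]]
      val[OF V h W(1) _ W(2,5) W(6)[OF W(2)]] V V' W(4) rr by auto
qed

lemma contraction_cong:
  assumes "\<And>x. x \<in> U \<Longrightarrow> \<sigma> x = \<tau> x" shows "contraction U B \<sigma> = contraction U B \<tau>"
  unfolding contraction_def pair_value_def using assms
  by (intro restrict_ext) (auto simp: opens_in_iff subset_iff)

lemma contraction_restrict:
  assumes "V \<subseteq> U"
  shows "contraction V B (restrict \<sigma> V) = restrict (contraction U B \<sigma>) (opens_in X V)"
proof -
  have "contraction V B (restrict \<sigma> V) = contraction V B \<sigma>"
    by (rule contraction_cong) simp
  also have "\<dots> = restrict (contraction U B \<sigma>) (opens_in X V)"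
    unfolding contraction_def using assms by (auto simp: opens_in_iff fun_eq_iff)
  finally show ?thesis .
qed

end

lemma (in module_pair) contraction_sheaf_hom:
  assumes B: "\<And>U. space_open X U \<Longrightarrow> der_pairing U B"
  shows "sheaf_hom X (tensor_sheaf X F G) (tangent_sheaf X) (\<lambda>U. contraction U B)"
  unfolding sheaf_hom_def
proof (intro conjI allI impI ballI funcsetI)
  note pT = prelinear_tensor
  note pS = prelinear_sheafify[OF pT]
  fix U \<sigma> assume U: "space_open X U" and s: "\<sigma> \<in> sections (tensor_sheaf X F G) U"
  have s': "\<sigma> \<in> sections (sheafify X (tensor_presheaf X F G)) U" using s by (simp add: tensor_sheaf_def)
  show "contraction U B \<sigma> \<in> sections (tangent_sheaf X) U"
    using contraction_derivation[OF B[OF U] U s] by (simp add: tangent_simps)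
  show "contraction U B (\<sigma> \<oplus>\<^bsub>sec (tensor_sheaf X F G) U\<^esub> \<tau>) =
      contraction U B \<sigma> \<oplus>\<^bsub>sec (tangent_sheaf X) U\<^esub> contraction U B \<tau>"
    if t: "\<tau> \<in> sections (tensor_sheaf X F G) U" for \<tau>
  proof -
    have t': "\<tau> \<in> sections (sheafify X (tensor_presheaf X F G)) U" using t by (simp add: tensor_sheaf_def)
    have st: "\<sigma> \<oplus>\<^bsub>sec (tensor_sheaf X F G) U\<^esub> \<tau> \<in> sections (tensor_sheaf X F G) U"
      using prelinear_presheafD(3)[OF pS U s' t'] by (simp add: tensor_sheaf_def)
    show ?thesis
    proof (rule sheaf_derivation_eqI)
      show "sheaf_derivation X U (contraction U B (\<sigma> \<oplus>\<^bsub>sec (tensor_sheaf X F G) U\<^esub> \<tau>))"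
        by (rule contraction_derivation[OF B[OF U] U st])
      show "sheaf_derivation X U (contraction U B \<sigma> \<oplus>\<^bsub>sec (tangent_sheaf X) U\<^esub> contraction U B \<tau>)"
        using contraction_derivation[OF B[OF U] U] s t by (intro tangent_closed[OF U]) auto
      fix V h x assume V: "space_open X V" "V \<subseteq> U" "h \<in> regular X V" "x \<in> V"
      then have x: "x \<in> U" by auto
      obtain W1 k where W1: "space_open X W1" "x \<in> W1" "W1 \<subseteq> U" "W1 \<subseteq> V"
        "Poly_Mapping.keys k \<subseteq> sections F W1 \<times> sections G W1"
        "\<And>y. y \<in> W1 \<Longrightarrow> \<sigma> y = germ X (tensor_presheaf X F G) y W1 (tc W1 k)"
        using tensor_sheaf_local[OF s x V(1,4)] by blast
      obtain W l where W: "space_open X W" "x \<in> W" "W \<subseteq> U" "W \<subseteq> W1"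
        "Poly_Mapping.keys l \<subseteq> sections F W \<times> sections G W"
        "\<And>y. y \<in> W \<Longrightarrow> \<tau> y = germ X (tensor_presheaf X F G) y W (tc W l)"
        using tensor_sheaf_local[OF t x W1(1,2)] by blast
      \<comment> \<open>\<open>\<sigma>\<close> and \<open>\<tau>\<close> are represented on
        different open sets; \<open>k\<close> is moved to the smaller one, so that the sum is
        represented by the sum of the formal sums.\<close>
      define k' where "k' = frag_map2 (res F W1 W) (res G W1 W) k"
      have k': "Poly_Mapping.keys k' \<subseteq> sections F W \<times> sections G W"
        unfolding k'_def by (rule keys_res[OF W1(1) W(1,4) W1(5)])
      have sx: "\<sigma> x = germ X (tensor_presheaf X F G) x W (tc W k')"
        using germ_restrict[OF set_presheaf_tensor W1(1) W(1,4,2) tc_in_tensor[OF W1(1,5)]] W1(6)[OF W1(2)]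
        by (simp add: res_tensor W1 W k'_def)
      have stx: "(\<sigma> \<oplus>\<^bsub>sec (tensor_sheaf X F G) U\<^esub> \<tau>) x = germ X (tensor_presheaf X F G) x W (tc W (k' + l))"
        using x germ_add_germ_same[OF pT W(1,2) tc_in_tensor[OF W(1) k'] tc_in_tensor[OF W(1,5)]]
        by (simp add: tensor_sheaf_def sheafify_simps sx W(6)[OF W(2)] add_tensor W k')
      have kl: "Poly_Mapping.keys (k' + l) \<subseteq> sections F W \<times> sections G W"
        using k' W(5) Poly_Mapping.keys_add[of k' l] by blast
      have WV: "W \<subseteq> V" using W W1 by auto
      show "contraction U B (\<sigma> \<oplus>\<^bsub>sec (tensor_sheaf X F G) U\<^esub> \<tau>) V h x =
          (contraction U B \<sigma> \<oplus>\<^bsub>sec (tangent_sheaf X) U\<^esub> contraction U B \<tau>) V h x"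
        unfolding tangent_simps(3)[OF V]
          contraction_value[where \<sigma> = "\<sigma> \<oplus>\<^bsub>sec (tensor_sheaf X F G) U\<^esub> \<tau>" and x = x, OF B[OF U] V(1-3) W(1) WV W(2) kl stx]
          contraction_value[where \<sigma> = "\<sigma>" and x = x, OF B[OF U] V(1-3) W(1) WV W(2) k' sx]
          contraction_value[where \<sigma> = "\<tau>" and x = x, OF B[OF U] V(1-3) W(1) WV W(2) W(5) W(6)[OF W(2)]]
        by (rule frag_eval_add)
    qed
  qed
  show "contraction U B (f \<odot>\<^bsub>sec (tensor_sheaf X F G) U\<^esub> \<sigma>) =
      f \<odot>\<^bsub>sec (tangent_sheaf X) U\<^esub> contraction U B \<sigma>"
    if f: "f \<in> regular X U" for f
  proof -
    have fs: "f \<odot>\<^bsub>sec (tensor_sheaf X F G) U\<^esub> \<sigma> \<in> sections (tensor_sheaf X F G) U"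
      using prelinear_presheafD(4)[OF pS U f s'] by (simp add: tensor_sheaf_def)
    show ?thesis
    proof (rule sheaf_derivation_eqI)
      show "sheaf_derivation X U (contraction U B (f \<odot>\<^bsub>sec (tensor_sheaf X F G) U\<^esub> \<sigma>))"
        by (rule contraction_derivation[OF B[OF U] U fs])
      show "sheaf_derivation X U (f \<odot>\<^bsub>sec (tangent_sheaf X) U\<^esub> contraction U B \<sigma>)"
        using contraction_derivation[OF B[OF U] U s] f by (intro tangent_closed[OF U]) auto
      fix V h x assume V: "space_open X V" "V \<subseteq> U" "h \<in> regular X V" "x \<in> V"
      then have x: "x \<in> U" by auto
      obtain W k where W: "space_open X W" "x \<in> W" "W \<subseteq> U" "W \<subseteq> V"
        "Poly_Mapping.keys k \<subseteq> sections F W \<times> sections G W"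
        "\<And>y. y \<in> W \<Longrightarrow> \<sigma> y = germ X (tensor_presheaf X F G) y W (tc W k)"
        using tensor_sheaf_local[OF s x V(1,4)] by blast
      define fW where "fW = restrict f W"
      have fW: "fW \<in> regular X W" unfolding fW_def by (rule regular_restrict[OF U W(1,3) f])
      \<comment> \<open>Scalars act on the left entries, and linearity of \<open>B\<close> there
        produces the factor \<open>f x\<close>.\<close>
      define k' where "k' = frag_map2 (\<lambda>m. fW \<odot>\<^bsub>sec F W\<^esub> m) (\<lambda>n. n) k"
      have k': "Poly_Mapping.keys k' \<subseteq> sections F W \<times> sections G W"
        unfolding k'_def using prelinear_presheafD(4)[OF prelinear_left W(1) fW] by (intro keys_frag_map2[OF W(5)]) auto
      have UW: "U \<inter> W = W" using W by auto
      have fsx: "(f \<odot>\<^bsub>sec (tensor_sheaf X F G) U\<^esub> \<sigma>) x = germ X (tensor_presheaf X F G) x W (tc W k')"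
        using x germ_smult_germ[OF pT U x f W(1,2) tc_in_tensor[OF W(1,5)]]
        by (simp add: tensor_sheaf_def sheafify_simps W(6)[OF W(2)] UW smult_tensor[OF W(1) fW]
            set_presheafD(2)[OF set_presheaf_tensor W(1) tc_in_tensor[OF W(1,5)]] k'_def flip: fW_def)
      have hW: "restrict h W \<in> regular X W" by (rule regular_restrict[OF V(1) W(1,4) V(3)])
      have "frag_eval (\<lambda>(m, n). B W m n W (restrict h W) x) k' =
          frag_eval (\<lambda>i. f x * (case i of (m, n) \<Rightarrow> B W m n W (restrict h W) x)) k"
        unfolding k'_def frag_eval_map2
      proof (rule frag_eval_cong)
        fix i assume "i \<in> Poly_Mapping.keys k"
        then obtain m n where i: "i = (m, n)" "m \<in> sections F W" "n \<in> sections G W" using W(5) by auto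
        have "B W (fW \<odot>\<^bsub>sec F W\<^esub> m) n W (restrict h W) x = fW x * B W m n W (restrict h W) x"
          by (rule der_pairingD(4)[OF B[OF U] W(1,3) i(2,3) W(1) subset_refl hW W(2) fW])
        then show "(case i of (m, n) \<Rightarrow> case (fW \<odot>\<^bsub>sec F W\<^esub> m, n) of (m, n) \<Rightarrow> B W m n W (restrict h W) x) =
            f x * (case i of (m, n) \<Rightarrow> B W m n W (restrict h W) x)"
          using W(2) i by (simp add: fW_def)
      qed
      then show "contraction U B (f \<odot>\<^bsub>sec (tensor_sheaf X F G) U\<^esub> \<sigma>) V h x =
          (f \<odot>\<^bsub>sec (tangent_sheaf X) U\<^esub> contraction U B \<sigma>) V h x"
        unfolding tangent_simps(4)[OF V]
          contraction_value[where \<sigma> = "f \<odot>\<^bsub>sec (tensor_sheaf X F G) U\<^esub> \<sigma>" and x = x, OF B[OF U] V(1-3) W(1,4,2) k' fsx]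
          contraction_value[where \<sigma> = "\<sigma>" and x = x, OF B[OF U] V(1-3) W(1,4,2,5) W(6)[OF W(2)]]
        by (simp add: frag_eval_scale)
    qed
  qed
next
  fix U V \<sigma> assume "space_open X U \<and> space_open X V \<and> V \<subseteq> U"
  then show "contraction V B (res (tensor_sheaf X F G) U V \<sigma>) = res (tangent_sheaf X) U V (contraction U B \<sigma>)"
    by (simp add: tensor_sheaf_def sheafify_simps tangent_simps contraction_restrict)
qed

section \<open>Twisted ideal sheaves embed into the tangent sheaf\<close>

lemma ideal_sheaf_simps:
  "sections (ideal_sheaf X I) U = I U" "\<zero>\<^bsub>sec (ideal_sheaf X I) U\<^esub> = (\<lambda>x\<in>U. 0)"
  "f \<oplus>\<^bsub>sec (ideal_sheaf X I) U\<^esub> g = (\<lambda>x\<in>U. f x + g x)"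
  "f \<odot>\<^bsub>sec (ideal_sheaf X I) U\<^esub> g = (\<lambda>x\<in>U. f x * g x)"
  "res (ideal_sheaf X I) U V f = restrict f V"
  by (simp_all add: ideal_sheaf_def subsheaf_def structure_sheaf_def mk_module_def)

text \<open>A nonzero derivation has some \<open>D V h\<close> that is not identically zero. Regular
  functions on \<open>V\<close> have no zero divisors, so \<open>f\<close> vanishes on
  \<open>V\<close>, and by the identity principle on all of \<open>U\<close>.\<close>

lemma (in irreducible_function_space) tangent_torsion_free:
  assumes U: "space_open X U" and D: "sheaf_derivation X U D" "D \<noteq> \<zero>\<^bsub>sec (tangent_sheaf X) U\<^esub>"
    and f: "f \<in> regular X U"
    and z: "\<And>V h x. space_open X V \<Longrightarrow> V \<subseteq> U \<Longrightarrow> h \<in> regular X V \<Longrightarrow> x \<in> V \<Longrightarrow> f x * D V h x = 0"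
  shows "\<forall>x\<in>U. f x = 0"
proof -
  obtain V h y where V: "space_open X V" "V \<subseteq> U" "h \<in> regular X V" "y \<in> V"
    "D V h y \<noteq> \<zero>\<^bsub>sec (tangent_sheaf X) U\<^esub> V h y"
    using sheaf_derivation_eqI[OF D(1) tangent_closed(1)[OF U]] D(2) by blast
  then have ne: "D V h y \<noteq> 0" by (simp add: tangent_simps)
  have "(\<forall>x\<in>V. restrict f V x = 0) \<or> (\<forall>x\<in>V. D V h x = 0)"
    using V z by (intro regular_domain[OF V(1)] regular_restrict[OF U V(1,2) f] sheaf_derivationD(3)[OF D(1)])
      (auto simp: opens_in_iff)
  then have "f x = 0" if "x \<in> V" for x using ne V(4) that by auto
  then show ?thesis using identity_principle[OF U f V(1,2)] V(4) by blast
qed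

section \<open>The map from the line bundle to the tangent sheaf\<close>

locale line_bundle_section = irreducible_function_space X for X :: "'p space_with_functions" +
  fixes A :: "('p, 'a) module_presheaf"
    and s :: "('p, ('p set \<Rightarrow> ('p \<Rightarrow> complex) \<Rightarrow> 'p \<Rightarrow> complex, 'p set \<Rightarrow> 'a \<Rightarrow> 'p \<Rightarrow> complex) tensor) germ_section"
  assumes line_bundle: "line_bundle X A"
    and s: "s \<in> sections (tensor_sheaf X (tangent_sheaf X) (dual_sheaf X A)) (topspace (topo X))"
    and s_nonzero: "s \<noteq> \<zero>\<^bsub>sec (tensor_sheaf X (tangent_sheaf X) (dual_sheaf X A)) (topspace (topo X))\<^esub>"
begin

lemma modules_A: "presheaf_of_modules X A"
  using line_bundle by (simp add: line_bundle_def sheaf_of_modules_def)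

lemma prelinear_A: "prelinear_presheaf X A"
  by (rule prelinear_if_presheaf_of_modules[OF modules_A])

sublocale TA: module_pair X "tangent_sheaf X" "dual_sheaf X A"
  by unfold_locales (rule prelinear_tangent prelinear_dual prelinear_A presheaf_of_modules_tangent)+

lemmas A_closed = prelinear_presheafD[OF prelinear_A]
lemmas A_res = prelinear_presheaf_resD[OF prelinear_A]
lemmas A_set = set_presheafD[OF prelinear_imp_set_presheaf[OF prelinear_A]]

text \<open>\<open>a\<^sub>0\<close> is a generator and \<open>\<psi>\<close> the coordinate with
  respect to it. Requiring \<open>\<psi>\<close> to be a section of the dual sheaf makes it at once
  a generator of the dual over \<open>U\<close>, see \<open>dual_generated\<close>.\<close>

definition trivialization :: "'p set \<Rightarrow> ('p set \<Rightarrow> 'a \<Rightarrow> 'p \<Rightarrow> complex) \<Rightarrow> 'a \<Rightarrow> bool" where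
  "trivialization U \<psi> a\<^sub>0 \<longleftrightarrow> space_open X U \<and> a\<^sub>0 \<in> sections A U \<and> \<psi> U a\<^sub>0 = (\<lambda>x\<in>U. 1) \<and>
     \<psi> \<in> sections (dual_sheaf X A) U \<and>
     (\<forall>V. space_open X V \<and> V \<subseteq> U \<longrightarrow> (\<forall>a\<in>sections A V. a = \<psi> V a \<odot>\<^bsub>sec A V\<^esub> res A U V a\<^sub>0))"

lemma trivialization_exists:
  assumes "x \<in> topspace (topo X)"
  shows "\<exists>U \<psi> a\<^sub>0. x \<in> U \<and> trivialization U \<psi> a\<^sub>0"
proof -
  obtain U where U: "space_open X U" "x \<in> U"
    and "isomorphic_sheaves (open_subspace X U) A (structure_sheaf (open_subspace X U))"
    using line_bundle assms unfolding line_bundle_def by blast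
  then obtain \<psi> where hom: "sheaf_hom (open_subspace X U) A (structure_sheaf X) \<psi>"
    and bij: "\<And>V. space_open X V \<Longrightarrow> V \<subseteq> U \<Longrightarrow> bij_betw (\<psi> V) (sections A V) (regular X V)"
    unfolding isomorphic_sheaves_def by (auto simp: space_open_open_subspace structure_sheaf_simps)
  have h: "\<psi> V a \<in> regular X V"
    "b \<in> sections A V \<Longrightarrow> \<psi> V (a \<oplus>\<^bsub>sec A V\<^esub> b) = (\<lambda>x\<in>V. \<psi> V a x + \<psi> V b x)"
    "f \<in> regular X V \<Longrightarrow> \<psi> V (f \<odot>\<^bsub>sec A V\<^esub> a) = (\<lambda>x\<in>V. f x * \<psi> V a x)"
    "space_open X W \<Longrightarrow> W \<subseteq> V \<Longrightarrow> \<psi> W (res A V W a) = restrict (\<psi> V a) W"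
    if "space_open X V" "V \<subseteq> U" "a \<in> sections A V" for V a b f W
    using hom that unfolding sheaf_hom_def
    by (simp_all add: space_open_open_subspace[OF U(1)] structure_sheaf_simps Pi_iff subset_trans[of W V U])
  have cl: "a \<oplus>\<^bsub>sec A V\<^esub> b \<in> sections A V" "f \<odot>\<^bsub>sec A V\<^esub> a \<in> sections A V"
    if "space_open X V" "a \<in> sections A V" "b \<in> sections A V" "f \<in> regular X V" for V a b f
    using A_closed that by auto
  \<comment> \<open>The generator is the section that the local isomorphism sends to 1.\<close>
  have "(\<lambda>x\<in>U. 1) \<in> \<psi> U ` sections A U"
    using bij[OF U(1) subset_refl] regular_const[OF U(1), of 1] by (simp add: bij_betw_def)
  then obtain a\<^sub>0 where a0: "a\<^sub>0 \<in> sections A U" "\<psi> U a\<^sub>0 = (\<lambda>x\<in>U. 1)" by auto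
  \<comment> \<open>Sections of the dual sheaf are extensional in both arguments; an arbitrary sheaf
    homomorphism is cut down to that form.\<close>
  define \<psi>' where "\<psi>' = (\<lambda>V\<in>opens_in X U. \<lambda>a\<in>sections A V. \<psi> V a)"
  have psi': "\<psi>' V a = \<psi> V a" if "space_open X V" "V \<subseteq> U" "a \<in> sections A V" for V a
    using that by (simp add: \<psi>'_def opens_in_iff)
  have "\<psi>' \<in> sections (dual_sheaf X A) U"
    unfolding sections_dual[OF U(1)]
  proof (intro conjI allI impI ballI)
    fix V a W assume "space_open X V \<and> V \<subseteq> U" "a \<in> sections A V" "space_open X W \<and> W \<subseteq> V"
    moreover from this have "W \<subseteq> U" by auto
    ultimately show "\<psi>' W (res A V W a) = restrict (\<psi>' V a) W"
      by (simp add: psi' A_set(1)[of V W] h(4))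
  qed (auto simp: psi' h A_closed(3,4), simp_all add: \<psi>'_def opens_in_iff)
  moreover have "a = \<psi>' V a \<odot>\<^bsub>sec A V\<^esub> res A U V a\<^sub>0"
    if V: "space_open X V \<and> V \<subseteq> U" and a: "a \<in> sections A V" for V a
  proof -
    have r: "res A U V a\<^sub>0 \<in> sections A V" using A_set(1)[OF U(1) _ _ a0(1)] V by blast
    \<comment> \<open>The section \<open>a\<close> and its claimed expansion have the same image,
      and \<open>\<psi> V\<close> is injective.\<close>
    have "\<psi> V (\<psi> V a \<odot>\<^bsub>sec A V\<^esub> res A U V a\<^sub>0) = (\<lambda>x\<in>V. \<psi> V a x * restrict (\<psi> U a\<^sub>0) V x)"
      using h(3)[OF _ _ r h(1)] h(4)[OF U(1) subset_refl a0(1), of V] V a by simp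
    also have "\<dots> = \<psi> V a"
      using V h(1)[of V a] a regular_extensional[of V "\<psi> V a"]
      by (auto simp: a0 subset_iff fun_eq_iff extensional_def)
    finally have "\<psi> V a \<odot>\<^bsub>sec A V\<^esub> res A U V a\<^sub>0 = a"
      using bij[of V] V a cl(2)[OF _ r r h(1)] by (auto simp: bij_betw_def dest: inj_onD)
    then show ?thesis using V a by (simp add: psi')
  qed
  ultimately show ?thesis
    using U a0 by (intro exI[of _ U] exI[of _ \<psi>'] exI[of _ a\<^sub>0]) (auto simp: trivialization_def psi')
qed

lemma trivialization_restrict:
  assumes t: "trivialization U \<psi> a\<^sub>0" and V: "space_open X V" "V \<subseteq> U"
  shows "trivialization V (restrict \<psi> (opens_in X V)) (res A U V a\<^sub>0)"
proof -
  have U: "space_open X U" "a\<^sub>0 \<in> sections A U" "\<psi> U a\<^sub>0 = (\<lambda>x\<in>U. 1)" "\<psi> \<in> sections (dual_sheaf X A) U"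
    using t by (auto simp: trivialization_def)
  have "\<psi> V (res A U V a\<^sub>0) = (\<lambda>x\<in>V. 1)"
    using dualD(4)[OF U(4,1,1) subset_refl U(2) V] U(3) V(2) by (simp add: Int_absorb1)
  moreover have "a = \<psi> W a \<odot>\<^bsub>sec A W\<^esub> res A V W (res A U V a\<^sub>0)"
    if W: "space_open X W" "W \<subseteq> V" and a: "a \<in> sections A W" for W a
    using t W a V U(2) unfolding trivialization_def by (simp add: A_set(3))
  moreover have "restrict \<psi> (opens_in X V) \<in> sections (dual_sheaf X A) V"
    by (rule dual_closed(4)[OF prelinear_A U(1) V U(4)])
  ultimately show ?thesis
    using U V A_set(1)[OF U(1) V U(2)] by (simp add: trivialization_def opens_in_iff)
qed

text \<open>Applying \<open>\<phi>\<close> to the expansion of a section a as \<psi>(a) times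
  \<open>a\<^sub>0\<close> gives \<phi>(a) = \<psi>(a) c, where c is the value of
  \<open>\<phi>\<close> at \<open>a\<^sub>0\<close>.\<close>

lemma dual_generated:
  assumes t: "trivialization U \<psi> a\<^sub>0" and \<phi>: "\<phi> \<in> sections (dual_sheaf X A) U"
  shows "\<phi> = \<phi> U a\<^sub>0 \<odot>\<^bsub>sec (dual_sheaf X A) U\<^esub> \<psi>" "\<phi> U a\<^sub>0 \<in> regular X U"
proof -
  have U: "space_open X U" "a\<^sub>0 \<in> sections A U" "\<psi> \<in> sections (dual_sheaf X A) U"
    and gen: "\<And>V a. space_open X V \<Longrightarrow> V \<subseteq> U \<Longrightarrow> a \<in> sections A V \<Longrightarrow> a = \<psi> V a \<odot>\<^bsub>sec A V\<^esub> res A U V a\<^sub>0"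
    using t by (auto simp: trivialization_def)
  show r: "\<phi> U a\<^sub>0 \<in> regular X U" by (rule dualD(1)[OF \<phi> U(1,1) subset_refl U(2)])
  show "\<phi> = \<phi> U a\<^sub>0 \<odot>\<^bsub>sec (dual_sheaf X A) U\<^esub> \<psi>"
  proof (rule dual_eqI[OF \<phi> dual_closed(3)[OF prelinear_A U(1) r U(3)] U(1)])
    fix V a assume V: "space_open X V" "V \<subseteq> U" "a \<in> sections A V"
    have r0: "res A U V a\<^sub>0 \<in> sections A V" by (rule A_set(1)[OF U(1) V(1,2) U(2)])
    have "\<phi> V a = \<phi> V (\<psi> V a \<odot>\<^bsub>sec A V\<^esub> res A U V a\<^sub>0)" using gen[OF V] by simp
    also have "\<dots> = (\<lambda>x\<in>V. \<psi> V a x * \<phi> V (res A U V a\<^sub>0) x)"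
      by (rule dualD(3)[OF \<phi> U(1) V(1,2) r0 dualD(1)[OF U(3,1) V]])
    also have "\<phi> V (res A U V a\<^sub>0) = restrict (\<phi> U a\<^sub>0) V"
      by (rule dualD(4)[OF \<phi> U(1,1) subset_refl U(2) V(1,2)])
    finally show "\<phi> V a = (\<phi> U a\<^sub>0 \<odot>\<^bsub>sec (dual_sheaf X A) U\<^esub> \<psi>) V a"
      using V by (auto simp: dual_simps intro!: restrict_ext)
  qed
qed

lemma restrict_s: "space_open X W \<Longrightarrow> restrict s W \<in> sections (tensor_sheaf X (tangent_sheaf X) (dual_sheaf X A)) W"
  using sheafify_restrict[OF TA.set_presheaf_tensor, of "topspace (topo X)" W s] s openin_subset
  by (auto simp: tensor_sheaf_def)

text \<open>The homomorphism from \<open>A\<close> to the tangent sheaf that corresponds to \<open>s\<close>.\<close>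

definition evaluate :: "'p set \<Rightarrow> 'a \<Rightarrow> 'p set \<Rightarrow> ('p \<Rightarrow> complex) \<Rightarrow> 'p \<Rightarrow> complex" where
  "evaluate W a = TA.contraction W
     (\<lambda>W' D \<phi>. \<phi> W' (res A W W' a) \<odot>\<^bsub>sec (tangent_sheaf X) W'\<^esub> D) (restrict s W)"

lemma evaluate_pairing:
  assumes W: "space_open X W" and a: "a \<in> sections A W"
  shows "TA.der_pairing W (\<lambda>W' D \<phi>. \<phi> W' (res A W W' a) \<odot>\<^bsub>sec (tangent_sheaf X) W'\<^esub> D)"
  unfolding TA.der_pairing_def
proof (intro allI impI ballI conjI)
  fix U D \<phi> assume U': "space_open X U \<and> U \<subseteq> W" and D: "D \<in> sections (tangent_sheaf X) U"
    and \<phi>: "\<phi> \<in> sections (dual_sheaf X A) U"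
  then have U: "space_open X U" "U \<subseteq> W" by auto
  have r: "res A W U a \<in> sections A U" by (rule A_set(1)[OF W U a])
  show "sheaf_derivation X U (\<phi> U (res A W U a) \<odot>\<^bsub>sec (tangent_sheaf X) U\<^esub> D)"
    using D dualD(1)[OF \<phi> U(1,1) subset_refl r] by (intro tangent_closed[OF U(1)]) (auto simp: tangent_simps)
  fix V h x assume "space_open X V \<and> V \<subseteq> U \<and> h \<in> regular X V \<and> x \<in> V"
  then have V: "space_open X V" "V \<subseteq> U" "h \<in> regular X V" "x \<in> V" and xU: "x \<in> U" by auto
  show "(\<phi> U (res A W U a) \<odot>\<^bsub>sec (tangent_sheaf X) U\<^esub> (D \<oplus>\<^bsub>sec (tangent_sheaf X) U\<^esub> D')) V h x =
      (\<phi> U (res A W U a) \<odot>\<^bsub>sec (tangent_sheaf X) U\<^esub> D) V h x +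
      (\<phi> U (res A W U a) \<odot>\<^bsub>sec (tangent_sheaf X) U\<^esub> D') V h x" for D'
    using V by (simp add: tangent_simps algebra_simps)
  show "((\<phi> \<oplus>\<^bsub>sec (dual_sheaf X A) U\<^esub> \<phi>') U (res A W U a) \<odot>\<^bsub>sec (tangent_sheaf X) U\<^esub> D) V h x =
      (\<phi> U (res A W U a) \<odot>\<^bsub>sec (tangent_sheaf X) U\<^esub> D) V h x +
      (\<phi>' U (res A W U a) \<odot>\<^bsub>sec (tangent_sheaf X) U\<^esub> D) V h x" for \<phi>'
    using V xU U r by (simp add: tangent_simps dual_simps algebra_simps)
  show "(\<phi> U (res A W U a) \<odot>\<^bsub>sec (tangent_sheaf X) U\<^esub> (f \<odot>\<^bsub>sec (tangent_sheaf X) U\<^esub> D)) V h x =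
      f x * (\<phi> U (res A W U a) \<odot>\<^bsub>sec (tangent_sheaf X) U\<^esub> D) V h x"
    "((f \<odot>\<^bsub>sec (dual_sheaf X A) U\<^esub> \<phi>) U (res A W U a) \<odot>\<^bsub>sec (tangent_sheaf X) U\<^esub> D) V h x =
      f x * (\<phi> U (res A W U a) \<odot>\<^bsub>sec (tangent_sheaf X) U\<^esub> D) V h x" for f
    using V xU U r by (simp_all add: tangent_simps dual_simps)
  fix W' assume "space_open X W' \<and> V \<subseteq> W' \<and> W' \<subseteq> U"
  then have W': "space_open X W'" "V \<subseteq> W'" "W' \<subseteq> U" by auto
  have "\<phi> W' (res A W W' a) = \<phi> W' (res A U W' (res A W U a))"
    using A_set(3)[OF W U(1) W'(1,3) U(2) a] by simp
  also have "\<dots> = restrict (\<phi> U (res A W U a)) W'"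
    by (rule dualD(4)[OF \<phi> U(1,1) subset_refl r W'(1,3)])
  finally show "(res (dual_sheaf X A) U W' \<phi> W' (res A W W' a) \<odot>\<^bsub>sec (tangent_sheaf X) W'\<^esub>
        res (tangent_sheaf X) U W' D) V h x =
      (\<phi> U (res A W U a) \<odot>\<^bsub>sec (tangent_sheaf X) U\<^esub> D) V h x"
    using V W' by (auto simp: tangent_simps dual_simps opens_in_iff)
qed

lemma evaluate_derivation:
  assumes "space_open X W" "a \<in> sections A W" shows "sheaf_derivation X W (evaluate W a)"
  unfolding evaluate_def
  by (rule TA.contraction_derivation[OF evaluate_pairing[OF assms] assms(1) restrict_s[OF assms(1)]])

lemma evaluate_value:
  assumes W: "space_open X W" "a \<in> sections A W" and V: "space_open X V" "V \<subseteq> W" "h \<in> regular X V"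
    and U: "space_open X U" "U \<subseteq> V" "x \<in> U"
    and k: "Poly_Mapping.keys k \<subseteq> sections (tangent_sheaf X) U \<times> sections (dual_sheaf X A) U"
    and eq: "s x = germ X (tensor_presheaf X (tangent_sheaf X) (dual_sheaf X A)) x U (TA.tc U k)"
  shows "evaluate W a V h x = frag_eval (\<lambda>(D, \<phi>). \<phi> U (res A W U a) x * D U (restrict h U) x) k"
proof -
  have x: "x \<in> W" using U V by auto
  have "restrict s W x = germ X (tensor_presheaf X (tangent_sheaf X) (dual_sheaf X A)) x U (TA.tc U k)"
    using eq x by simp
  note TA.contraction_value[where \<sigma> = "restrict s W" and x = x, OF evaluate_pairing[OF W] V U k this]
  moreover have "restrict h U \<in> regular X U" by (rule regular_restrict[OF V(1) U(1,2) V(3)])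
  ultimately show ?thesis
    unfolding evaluate_def using U by (auto simp: tangent_simps intro!: frag_eval_cong)
qed

lemma s_local:
  assumes "space_open X V" "x \<in> V"
  obtains U k where "space_open X U" "x \<in> U" "U \<subseteq> V"
    "Poly_Mapping.keys k \<subseteq> sections (tangent_sheaf X) U \<times> sections (dual_sheaf X A) U"
    "s x = germ X (tensor_presheaf X (tangent_sheaf X) (dual_sheaf X A)) x U (TA.tc U k)"
proof -
  have "x \<in> topspace (topo X)" using assms openin_subset by blast
  from TA.tensor_sheaf_local[OF s this assms] show thesis using that by metis
qed

text \<open>Near each point \<open>s\<close> is a formal sum of pairs (D, \<phi>) and the evaluation
  is the sum of the \<phi>(a) D, where each \<phi> is linear and compatible with
  restriction.\<close>

lemma evaluate_linear:
  assumes W: "space_open X W" "a \<in> sections A W" and V: "space_open X V" "V \<subseteq> W" "h \<in> regular X V" "x \<in> V"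
  shows "b \<in> sections A W \<Longrightarrow> evaluate W (a \<oplus>\<^bsub>sec A W\<^esub> b) V h x = evaluate W a V h x + evaluate W b V h x"
    "f \<in> regular X W \<Longrightarrow> evaluate W (f \<odot>\<^bsub>sec A W\<^esub> a) V h x = f x * evaluate W a V h x"
    "space_open X W' \<Longrightarrow> V \<subseteq> W' \<Longrightarrow> W' \<subseteq> W \<Longrightarrow> evaluate W' (res A W W' a) V h x = evaluate W a V h x"
proof -
  obtain U k where U: "space_open X U" "x \<in> U" "U \<subseteq> V"
    "Poly_Mapping.keys k \<subseteq> sections (tangent_sheaf X) U \<times> sections (dual_sheaf X A) U"
    "s x = germ X (tensor_presheaf X (tangent_sheaf X) (dual_sheaf X A)) x U (TA.tc U k)"
    using s_local[OF V(1,4)] .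
  have UW: "U \<subseteq> W" using U V by auto
  have rU: "res A W U c \<in> sections A U" if "c \<in> sections A W" for c by (rule A_set(1)[OF W(1) U(1) UW that])
  note val = evaluate_value[OF W(1) _ V(1-3) U(1,3,2,4,5)]
  show "evaluate W (a \<oplus>\<^bsub>sec A W\<^esub> b) V h x = evaluate W a V h x + evaluate W b V h x"
    if b: "b \<in> sections A W"
    unfolding val[OF W(2)] val[OF b] val[OF A_closed(3)[OF W b]] frag_eval_add_fun[symmetric]
  proof (rule frag_eval_cong)
    fix i assume "i \<in> Poly_Mapping.keys k"
    then obtain D \<phi> where i: "i = (D, \<phi>)" "\<phi> \<in> sections (dual_sheaf X A) U" using U(4) by auto
    show "(case i of (D, \<phi>) \<Rightarrow> \<phi> U (res A W U (a \<oplus>\<^bsub>sec A W\<^esub> b)) x * D U (restrict h U) x) =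
        (case i of (D, \<phi>) \<Rightarrow> \<phi> U (res A W U a) x * D U (restrict h U) x) +
        (case i of (D, \<phi>) \<Rightarrow> \<phi> U (res A W U b) x * D U (restrict h U) x)"
      using dualD(2)[OF i(2) U(1,1) subset_refl rU[OF W(2)] rU[OF b]] U(2)
      by (simp add: i(1) A_res(1)[OF W(1) U(1) UW W(2) b] algebra_simps)
  qed
  show "evaluate W (f \<odot>\<^bsub>sec A W\<^esub> a) V h x = f x * evaluate W a V h x" if f: "f \<in> regular X W"
    unfolding val[OF W(2)] val[OF A_closed(4)[OF W(1) f W(2)]] frag_eval_scale[symmetric]
  proof (rule frag_eval_cong)
    fix i assume "i \<in> Poly_Mapping.keys k"
    then obtain D \<phi> where i: "i = (D, \<phi>)" "\<phi> \<in> sections (dual_sheaf X A) U" using U(4) by auto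
    show "(case i of (D, \<phi>) \<Rightarrow> \<phi> U (res A W U (f \<odot>\<^bsub>sec A W\<^esub> a)) x * D U (restrict h U) x) =
        f x * (case i of (D, \<phi>) \<Rightarrow> \<phi> U (res A W U a) x * D U (restrict h U) x)"
      using dualD(3)[OF i(2) U(1,1) subset_refl rU[OF W(2)] regular_restrict[OF W(1) U(1) UW f]] U(2)
      by (simp add: i(1) A_res(2)[OF W(1) U(1) UW f W(2)])
  qed
  show "evaluate W' (res A W W' a) V h x = evaluate W a V h x"
    if W': "space_open X W'" "V \<subseteq> W'" "W' \<subseteq> W"
  proof -
    have "U \<subseteq> W'" using W' U by auto
    then show ?thesis
      using evaluate_value[OF W'(1) A_set(1)[OF W(1) W'(1,3) W(2)] V(1) W'(2) V(3) U(1,3,2,4,5)] val[OF W(2)]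
        A_set(3)[OF W(1) W'(1) U(1) _ W'(3) W(2)] by simp
  qed
qed

lemma evaluate_restrict:
  assumes "space_open X W" "a \<in> sections A W" "space_open X W'" "W' \<subseteq> W"
  shows "evaluate W' (res A W W' a) = restrict (evaluate W a) (opens_in X W')"
proof (rule sheaf_derivation_eqI)
  show "sheaf_derivation X W' (evaluate W' (res A W W' a))"
    by (rule evaluate_derivation[OF assms(3) A_set(1)[OF assms(1,3,4,2)]])
  show "sheaf_derivation X W' (restrict (evaluate W a) (opens_in X W'))"
    by (rule tangent_closed(4)[OF assms(1,3,4) evaluate_derivation[OF assms(1,2)]])
qed (use assms evaluate_linear(3)[OF assms(1,2)] in \<open>auto simp: opens_in_iff\<close>)

text \<open>Some germ of \<open>s\<close> is nonzero. Near that point the dual of \<open>A\<close>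
  has a generator \<psi>, so \<open>s\<close> is a pure tensor D \<otimes> \<psi> with D nonzero,
  and evaluation at the generator of \<open>A\<close> on which \<psi> is 1 recovers D.\<close>

lemma evaluate_nonzero_somewhere:
  "\<exists>U \<psi> a\<^sub>0. U \<noteq> {} \<and> trivialization U \<psi> a\<^sub>0 \<and> evaluate U a\<^sub>0 \<noteq> \<zero>\<^bsub>sec (tangent_sheaf X) U\<^esub>"
proof -
  let ?P = "tensor_presheaf X (tangent_sheaf X) (dual_sheaf X A)" and ?T = "topspace (topo X)"
  have "\<exists>x\<in>?T. s x \<noteq> germ X ?P x ?T \<zero>\<^bsub>sec ?P ?T\<^esub>"
  proof (rule ccontr)
    assume "\<not> ?thesis"
    then have "s = (\<lambda>x\<in>?T. germ X ?P x ?T \<zero>\<^bsub>sec ?P ?T\<^esub>)"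
      using s by (intro extensionalityI[of _ ?T]) (auto simp: tensor_sheaf_def sections_sheafify)
    then show False using s_nonzero by (simp add: tensor_sheaf_def sheafify_simps)
  qed
  then obtain x where x: "x \<in> ?T" "s x \<noteq> germ X ?P x ?T \<zero>\<^bsub>sec ?P ?T\<^esub>" by blast
  obtain U \<psi> a\<^sub>0 where U: "x \<in> U" "trivialization U \<psi> a\<^sub>0" using trivialization_exists[OF x(1)] by blast
  then have Uo: "space_open X U" "a\<^sub>0 \<in> sections A U" by (auto simp: trivialization_def)
  obtain W k where W: "space_open X W" "x \<in> W" "W \<subseteq> ?T" "W \<subseteq> U"
    "Poly_Mapping.keys k \<subseteq> sections (tangent_sheaf X) W \<times> sections (dual_sheaf X A) W"
    and k: "\<And>y. y \<in> W \<Longrightarrow> s y = germ X ?P y W (TA.tc W k)"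
    using TA.tensor_sheaf_local[OF s x(1) Uo(1) U(1)] by blast
  define \<psi>' a\<^sub>0' where "\<psi>' = restrict \<psi> (opens_in X W)" and "a\<^sub>0' = res A U W a\<^sub>0"
  have t: "trivialization W \<psi>' a\<^sub>0'"
    unfolding \<psi>'_def a\<^sub>0'_def by (rule trivialization_restrict[OF U(2) W(1,4)])
  then have a0: "a\<^sub>0' \<in> sections A W" "\<psi>' W a\<^sub>0' = (\<lambda>x\<in>W. 1)" "\<psi>' \<in> sections (dual_sheaf X A) W"
    by (auto simp: trivialization_def)
  interpret m: Module.module "function_ring X W" "sec (tangent_sheaf X) W"
    using presheaf_of_modules_tangent W(1) by (simp add: presheaf_of_modules_def)
  have "\<exists>D\<in>sections (tangent_sheaf X) W. TA.tc W k = TA.tc W (frag_of (D, \<psi>'))"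
    unfolding TA.tc_def
  proof (rule premodule_pair.tcl_cyclic[OF TA.premodule_pair[OF W(1)] _ a0(3) _ W(5)])
    show "\<exists>E\<in>sections (tangent_sheaf X) W. D \<oplus>\<^bsub>sec (tangent_sheaf X) W\<^esub> E = \<zero>\<^bsub>sec (tangent_sheaf X) W\<^esub>"
      if "D \<in> sections (tangent_sheaf X) W" for D
      using that m.M.r_neg m.M.a_inv_closed by blast
    show "\<exists>f\<in>carrier (function_ring X W). \<phi> = f \<odot>\<^bsub>sec (dual_sheaf X A) W\<^esub> \<psi>'"
      if "\<phi> \<in> sections (dual_sheaf X A) W" for \<phi>
      using dual_generated[OF t that] by auto
  qed
  then obtain D where D: "D \<in> sections (tangent_sheaf X) W" "TA.tc W k = TA.tc W (frag_of (D, \<psi>'))" by blast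
  have "D \<noteq> \<zero>\<^bsub>sec (tangent_sheaf X) W\<^esub>"
  proof
    assume "D = \<zero>\<^bsub>sec (tangent_sheaf X) W\<^esub>"
    then have "TA.tc W k = TA.tc W 0"
      using D(2) premodule_pair.tcl_pure_zero_left[OF TA.premodule_pair[OF W(1)] a0(3)] by (simp add: TA.tc_def)
    then have "s x = germ X ?P x W \<zero>\<^bsub>sec ?P W\<^esub>" using k W by (simp add: TA.zero_tensor)
    also have "\<dots> = germ X ?P x ?T \<zero>\<^bsub>sec ?P ?T\<^esub>"
      using germ_restrict[OF TA.set_presheaf_tensor _ W(1,3,2) prelinear_presheafD(1)[OF TA.prelinear_tensor]]
        prelinear_presheaf_resD(3)[OF TA.prelinear_tensor _ W(1,3)] by simp
    finally show False using x by simp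
  qed
  moreover have "evaluate W a\<^sub>0' = D"
  proof (rule sheaf_derivation_eqI[OF evaluate_derivation[OF W(1) a0(1)]])
    show "sheaf_derivation X W D" using D by (simp add: tangent_simps)
    fix V h y assume V: "space_open X V" "V \<subseteq> W" "h \<in> regular X V" "y \<in> V"
    then have y: "y \<in> W" by auto
    have kk: "Poly_Mapping.keys (frag_of (D, \<psi>')) \<subseteq> sections (tangent_sheaf X) W \<times> sections (dual_sheaf X A) W"
      using D a0 by auto
    define k' where "k' = frag_of (res (tangent_sheaf X) W V D, res (dual_sheaf X A) W V \<psi>')"
    have k'eq: "k' = frag_map2 (res (tangent_sheaf X) W V) (res (dual_sheaf X A) W V) (frag_of (D, \<psi>'))"
      by (simp add: k'_def)
    have k': "Poly_Mapping.keys k' \<subseteq> sections (tangent_sheaf X) V \<times> sections (dual_sheaf X A) V"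
      unfolding k'eq by (rule TA.keys_res[OF W(1) V(1,2) kk])
    have "s y = germ X ?P y V (TA.tc V k')"
      using germ_restrict[OF TA.set_presheaf_tensor W(1) V(1,2,4) TA.tc_in_tensor[OF W(1) kk]] k[OF y] D(2)
      by (simp add: TA.res_tensor[OF W(1) V(1,2)] k'eq)
    from evaluate_value[OF W(1) a0(1) V(1-3) V(1) subset_refl V(4) k' this]
    have "evaluate W a\<^sub>0' V h y = \<psi>' V (res A W V a\<^sub>0') y * D V h y"
      using V regular_extensional[OF V(1,3)]
      by (simp add: k'_def tangent_simps dual_simps opens_in_iff extensional_restrict)
    also have "\<psi>' V (res A W V a\<^sub>0') y = 1"
      using dualD(4)[OF a0(3) W(1,1) subset_refl a0(1) V(1,2)] a0(2) V y by simp
    finally show "evaluate W a\<^sub>0' V h y = D V h y" by simp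
  qed
  ultimately show ?thesis using t W(2) by blast
qed

text \<open>Nonvanishing on one open set spreads to all of them. If the evaluation vanished at a
  generator over \<open>U\<close>, it would vanish at every section over an open subset of
  \<open>U\<close>, in particular on the overlap with the set where it is known to be nonzero,
  contradicting the identity principle for derivations.\<close>

lemma evaluate_generator_nonzero:
  assumes t: "trivialization U \<psi> a\<^sub>0" and ne: "U \<noteq> {}"
  shows "evaluate U a\<^sub>0 \<noteq> \<zero>\<^bsub>sec (tangent_sheaf X) U\<^esub>"
proof
  assume z: "evaluate U a\<^sub>0 = \<zero>\<^bsub>sec (tangent_sheaf X) U\<^esub>"
  obtain V \<psi>' b where V: "V \<noteq> {}" "trivialization V \<psi>' b" "evaluate V b \<noteq> \<zero>\<^bsub>sec (tangent_sheaf X) V\<^esub>"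
    using evaluate_nonzero_somewhere by blast
  have o: "space_open X U" "space_open X V" "a\<^sub>0 \<in> sections A U" "b \<in> sections A V"
    using t V by (auto simp: trivialization_def)
  define W where "W = V \<inter> U"
  have W: "space_open X W" "W \<subseteq> V" "W \<subseteq> U" "W \<noteq> {}" unfolding W_def using o opens_meet V ne by auto
  have rb: "res A V W b \<in> sections A W" by (rule A_set(1)[OF o(2) W(1,2) o(4)])
  have ra: "res A U W a\<^sub>0 \<in> sections A W" by (rule A_set(1)[OF o(1) W(1,3) o(3)])
  \<comment> \<open>On the overlap \<open>b\<close> is the multiple of \<open>a\<^sub>0\<close> by
    \<open>g\<close>, and \<open>evaluate\<close> is linear over functions.\<close>
  define g where "g = \<psi> W (res A V W b)"
  have g: "g \<in> regular X W" "res A V W b = g \<odot>\<^bsub>sec A W\<^esub> res A U W a\<^sub>0"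
    using t W rb dualD(1)[of \<psi> A U W "res A V W b"] unfolding trivialization_def g_def by auto
  have "restrict (evaluate V b) (opens_in X W) = \<zero>\<^bsub>sec (tangent_sheaf X) W\<^esub>"
  proof (rule sheaf_derivation_eqI[OF tangent_closed(4)[OF o(2) W(1,2) evaluate_derivation[OF o(2,4)]] tangent_closed(1)[OF W(1)]])
    fix N h x assume N: "space_open X N" "N \<subseteq> W" "h \<in> regular X N" "x \<in> N"
    then have NU: "N \<subseteq> U" using W by auto
    have "restrict (evaluate V b) (opens_in X W) N h x = evaluate W (res A V W b) N h x"
      by (simp add: evaluate_restrict[OF o(2,4) W(1,2)])
    also have "\<dots> = g x * evaluate W (res A U W a\<^sub>0) N h x"
      unfolding g(2) by (rule evaluate_linear(2)[OF W(1) ra N g(1)])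
    also have "evaluate W (res A U W a\<^sub>0) N h x = evaluate U a\<^sub>0 N h x"
      by (rule evaluate_linear(3)[OF o(1,3) N(1) NU N(3,4) W(1) N(2) W(3)])
    also have "\<dots> = 0" unfolding z by (rule tangent_simps(2)[OF N(1) NU N(3,4)])
    finally show "restrict (evaluate V b) (opens_in X W) N h x = \<zero>\<^bsub>sec (tangent_sheaf X) W\<^esub> N h x"
      using N by (simp add: tangent_simps)
  qed
  then have "evaluate V b = \<zero>\<^bsub>sec (tangent_sheaf X) V\<^esub>"
    by (rule derivation_identity_principle[OF evaluate_derivation[OF o(2,4)] o(2) W(1,2,4)])
  then show False using V by simp
qed

end

section \<open>The ideal sheaf tensored with the line bundle\<close>

locale twisted_ideal = line_bundle_section X A s
  for X :: "'p space_with_functions" and A :: "('p, 'a) module_presheaf" and s +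
  fixes I :: "'p set \<Rightarrow> ('p \<Rightarrow> complex) set"
  assumes modules_ideal: "presheaf_of_modules X (ideal_sheaf X I)"
    and ideal_regular: "space_open X U \<Longrightarrow> f \<in> I U \<Longrightarrow> f \<in> regular X U"
begin

sublocale IA: module_pair X "ideal_sheaf X I" A
  by unfold_locales (rule prelinear_if_presheaf_of_modules modules_ideal prelinear_A)+

definition embed_pairing :: "'p set \<Rightarrow> ('p \<Rightarrow> complex) \<Rightarrow> 'a \<Rightarrow> 'p set \<Rightarrow> ('p \<Rightarrow> complex) \<Rightarrow> 'p \<Rightarrow> complex" where
  "embed_pairing W f a = f \<odot>\<^bsub>sec (tangent_sheaf X) W\<^esub> evaluate W a"

definition embed :: "'p set \<Rightarrow> ('p, ('p \<Rightarrow> complex, 'a) tensor) germ_section \<Rightarrow> 'p set \<Rightarrow> ('p \<Rightarrow> complex) \<Rightarrow> 'p \<Rightarrow> complex" where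
  "embed U = IA.contraction U embed_pairing"

lemma der_pairing_embed: "IA.der_pairing U embed_pairing"
  unfolding IA.der_pairing_def embed_pairing_def ideal_sheaf_simps
proof (intro allI impI ballI conjI)
  fix W f a assume W': "space_open X W \<and> W \<subseteq> U" and f: "f \<in> I W" and a: "a \<in> sections A W"
  then have W: "space_open X W" by simp
  show "sheaf_derivation X W (f \<odot>\<^bsub>sec (tangent_sheaf X) W\<^esub> evaluate W a)"
    by (rule tangent_closed(3)[OF W ideal_regular[OF W f] evaluate_derivation[OF W a]])
  fix V h x assume "space_open X V \<and> V \<subseteq> W \<and> h \<in> regular X V \<and> x \<in> V"
  then have V: "space_open X V" "V \<subseteq> W" "h \<in> regular X V" "x \<in> V" and xW: "x \<in> W" by auto
  note ev = evaluate_linear[OF W a V]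
  show "((\<lambda>x\<in>W. f x + g x) \<odot>\<^bsub>sec (tangent_sheaf X) W\<^esub> evaluate W a) V h x =
      (f \<odot>\<^bsub>sec (tangent_sheaf X) W\<^esub> evaluate W a) V h x + (g \<odot>\<^bsub>sec (tangent_sheaf X) W\<^esub> evaluate W a) V h x" for g
    using V xW by (simp add: tangent_simps algebra_simps)
  show "(f \<odot>\<^bsub>sec (tangent_sheaf X) W\<^esub> evaluate W (a \<oplus>\<^bsub>sec A W\<^esub> b)) V h x =
      (f \<odot>\<^bsub>sec (tangent_sheaf X) W\<^esub> evaluate W a) V h x + (f \<odot>\<^bsub>sec (tangent_sheaf X) W\<^esub> evaluate W b) V h x"
    if "b \<in> sections A W" for b
    using V ev(1)[OF that] by (simp add: tangent_simps algebra_simps)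
  show "((\<lambda>x\<in>W. g x * f x) \<odot>\<^bsub>sec (tangent_sheaf X) W\<^esub> evaluate W a) V h x =
      g x * (f \<odot>\<^bsub>sec (tangent_sheaf X) W\<^esub> evaluate W a) V h x"
    "(f \<odot>\<^bsub>sec (tangent_sheaf X) W\<^esub> evaluate W (g \<odot>\<^bsub>sec A W\<^esub> a)) V h x =
      g x * (f \<odot>\<^bsub>sec (tangent_sheaf X) W\<^esub> evaluate W a) V h x" if "g \<in> regular X W" for g
    using V xW ev(2)[OF that] by (simp_all add: tangent_simps algebra_simps)
  show "(restrict f W' \<odot>\<^bsub>sec (tangent_sheaf X) W'\<^esub> evaluate W' (res A W W' a)) V h x =
      (f \<odot>\<^bsub>sec (tangent_sheaf X) W\<^esub> evaluate W a) V h x" if "space_open X W' \<and> V \<subseteq> W' \<and> W' \<subseteq> W" for W'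
    using V that ev(3)[of W'] by (auto simp: tangent_simps)
qed

lemma embed_sheaf_hom: "sheaf_hom X (tensor_sheaf X (ideal_sheaf X I) A) (tangent_sheaf X) embed"
proof -
  have "embed = (\<lambda>U. IA.contraction U embed_pairing)" by (rule ext) (rule embed_def)
  then show ?thesis using IA.contraction_sheaf_hom[OF der_pairing_embed] by simp
qed

text \<open>The representative f \<otimes> a lives on \<open>W\<close>, whereas contraction is
  computed on a neighbourhood inside \<open>V\<close>; so the tensor is first restricted to
  \<open>V\<close>.\<close>

lemma embed_pure:
  assumes U: "space_open X V" "V \<subseteq> U" and W: "space_open X W" "V \<subseteq> W" and h: "h \<in> regular X V" "x \<in> V"
    and fa: "f \<in> I W" "a \<in> sections A W"
    and eq: "\<sigma> x = germ X (tensor_presheaf X (ideal_sheaf X I) A) x W (IA.tc W (frag_of (f, a)))"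
  shows "embed U \<sigma> V h x = f x * evaluate W a V h x"
proof -
  have kk: "Poly_Mapping.keys (frag_of (f, a)) \<subseteq> sections (ideal_sheaf X I) W \<times> sections A W"
    using fa by (simp add: ideal_sheaf_simps)
  define k' where "k' = frag_of (res (ideal_sheaf X I) W V f, res A W V a)"
  have k'eq: "k' = frag_map2 (res (ideal_sheaf X I) W V) (res A W V) (frag_of (f, a))"
    by (simp add: k'_def)
  have k': "Poly_Mapping.keys k' \<subseteq> sections (ideal_sheaf X I) V \<times> sections A V"
    unfolding k'eq by (rule IA.keys_res[OF W(1) U(1) W(2) kk])
  have "\<sigma> x = germ X (tensor_presheaf X (ideal_sheaf X I) A) x V (IA.tc V k')"
    using germ_restrict[OF IA.set_presheaf_tensor W(1) U(1) W(2) h(2) IA.tc_in_tensor[OF W(1) kk]] eq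
    by (simp add: IA.res_tensor[OF W(1) U(1) W(2)] k'eq)
  from IA.contraction_value[where \<sigma> = \<sigma> and x = x, OF der_pairing_embed U h(1) U(1) subset_refl h(2) k' this]
  show ?thesis
    using U h evaluate_linear(3)[OF W(1) fa(2) U(1) W(2) h U(1) subset_refl W(2)] regular_extensional[OF U(1) h(1)]
    by (simp add: embed_def k'_def embed_pairing_def tangent_simps ideal_sheaf_simps extensional_restrict)
qed

text \<open>Locally the line bundle has a generator b, so the section is f \<otimes> b. Its image f
  s(b) vanishes while s(b) is nonzero, and since the tangent sheaf has no torsion, f = 0.\<close>

lemma embed_injective:
  assumes U: "space_open X U" and \<sigma>: "\<sigma> \<in> sections (tensor_sheaf X (ideal_sheaf X I) A) U"
    and z: "embed U \<sigma> = \<zero>\<^bsub>sec (tangent_sheaf X) U\<^esub>"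
  shows "\<sigma> = \<zero>\<^bsub>sec (tensor_sheaf X (ideal_sheaf X I) A) U\<^esub>"
proof -
  let ?P = "tensor_presheaf X (ideal_sheaf X I) A"
  have "\<sigma> x = germ X ?P x U \<zero>\<^bsub>sec ?P U\<^esub>" if x: "x \<in> U" for x
  proof -
    obtain N \<psi> a\<^sub>0 where N: "x \<in> N" "trivialization N \<psi> a\<^sub>0"
      using trivialization_exists x openin_subset[OF U] by blast
    then have No: "space_open X N" by (simp add: trivialization_def)
    obtain W k where W: "space_open X W" "x \<in> W" "W \<subseteq> U" "W \<subseteq> N"
      "Poly_Mapping.keys k \<subseteq> sections (ideal_sheaf X I) W \<times> sections A W"
      and k: "\<And>y. y \<in> W \<Longrightarrow> \<sigma> y = germ X ?P y W (IA.tc W k)"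
      using IA.tensor_sheaf_local[OF \<sigma> x No N(1)] by blast
    obtain \<psi>' b where t: "trivialization W \<psi>' b" using trivialization_restrict[OF N(2) W(1,4)] by blast
    then have b: "b \<in> sections A W" "\<psi>' \<in> sections (dual_sheaf X A) W"
      and gen: "\<And>a. a \<in> sections A W \<Longrightarrow> a = \<psi>' W a \<odot>\<^bsub>sec A W\<^esub> res A W W b"
      using W(1) by (auto simp: trivialization_def)
    interpret m: Module.module "function_ring X W" "sec (ideal_sheaf X I) W"
      using modules_ideal W(1) by (simp add: presheaf_of_modules_def)
    have "\<exists>f\<in>sections (ideal_sheaf X I) W. IA.tc W k = IA.tc W (frag_of (f, b))"
      unfolding IA.tc_def
    proof (rule premodule_pair.tcl_cyclic[OF IA.premodule_pair[OF W(1)] _ b(1) _ W(5)])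
      show "\<exists>g\<in>sections (ideal_sheaf X I) W. f \<oplus>\<^bsub>sec (ideal_sheaf X I) W\<^esub> g = \<zero>\<^bsub>sec (ideal_sheaf X I) W\<^esub>"
        if "f \<in> sections (ideal_sheaf X I) W" for f
        using that m.M.r_neg m.M.a_inv_closed by blast
      show "\<exists>f\<in>carrier (function_ring X W). a = f \<odot>\<^bsub>sec A W\<^esub> b" if "a \<in> sections A W" for a
        using gen[OF that] dualD(1)[OF b(2) W(1,1) subset_refl that] A_set(2)[OF W(1) b(1)] by auto
    qed
    then obtain f where f: "f \<in> I W" "IA.tc W k = IA.tc W (frag_of (f, b))" by (auto simp: ideal_sheaf_simps)
    have "\<forall>x\<in>W. f x = 0"
    proof (rule tangent_torsion_free[OF W(1) evaluate_derivation[OF W(1) b(1)]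
          evaluate_generator_nonzero[OF t] ideal_regular[OF W(1) f(1)]])
      show "W \<noteq> {}" using W by auto
      fix V h y assume V: "space_open X V" "V \<subseteq> W" "h \<in> regular X V" "y \<in> V"
      then have y: "y \<in> W" and VU: "V \<subseteq> U" using W by auto
      have "f y * evaluate W b V h y = embed U \<sigma> V h y"
        using k[OF y] f(2) by (intro embed_pure[OF V(1) VU W(1) V(2-4) f(1) b(1), symmetric]) simp
      also have "\<dots> = 0" unfolding z by (rule tangent_simps(2)[OF V(1) VU V(3,4)])
      finally show "f y * evaluate W b V h y = 0" .
    qed
    then have "f = \<zero>\<^bsub>sec (ideal_sheaf X I) W\<^esub>"
      unfolding ideal_sheaf_simps
      by (intro regular_eqI[OF W(1) ideal_regular[OF W(1) f(1)] regular_const[OF W(1)]]) simp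
    then have "IA.tc W k = IA.tc W 0"
      using f(2) premodule_pair.tcl_pure_zero_left[OF IA.premodule_pair[OF W(1)] b(1)] by (simp add: IA.tc_def)
    then have "\<sigma> x = germ X ?P x W \<zero>\<^bsub>sec ?P W\<^esub>" using k W by (simp add: IA.zero_tensor)
    also have "\<dots> = germ X ?P x U \<zero>\<^bsub>sec ?P U\<^esub>"
      using germ_restrict[OF IA.set_presheaf_tensor U W(1,3,2) prelinear_presheafD(1)[OF IA.prelinear_tensor U]]
        prelinear_presheaf_resD(3)[OF IA.prelinear_tensor U W(1,3)] by simp
    finally show ?thesis .
  qed
  then show ?thesis
    using \<sigma> unfolding tensor_sheaf_def sheafify_simps
    by (intro extensionalityI[of _ U]) (auto simp: sections_sheafify)
qed

text \<open>The witness is f \<otimes> b with b a generator of \<open>A\<close> near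
  \<open>x\<close>: were its image zero, torsion-freeness would give f = 0, against
  \<open>f x \<noteq> 0\<close>. What is returned is a nonzero value at a point \<open>y\<close>,
  which survives shrinking of the open set around \<open>y\<close>.\<close>

lemma embed_nonzero:
  assumes U: "space_open X U" and f: "f \<in> I U" "x \<in> U" "f x \<noteq> 0"
  obtains W \<sigma> V h y where "space_open X W" "\<sigma> \<in> sections (tensor_sheaf X (ideal_sheaf X I) A) W"
    "space_open X V" "V \<subseteq> W" "h \<in> regular X V" "y \<in> V" "embed W \<sigma> V h y \<noteq> 0"
proof -
  let ?P = "tensor_presheaf X (ideal_sheaf X I) A"
  obtain N \<psi> a\<^sub>0 where N: "x \<in> N" "trivialization N \<psi> a\<^sub>0"
    using trivialization_exists f openin_subset[OF U] by blast
  then have No: "space_open X N" by (simp add: trivialization_def)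
  define W where "W = U \<inter> N"
  have W: "space_open X W" "x \<in> W" "W \<subseteq> U" "W \<subseteq> N" unfolding W_def using U No N f by auto
  obtain \<psi>' b where t: "trivialization W \<psi>' b" using trivialization_restrict[OF N(2) W(1,4)] by blast
  then have b: "b \<in> sections A W" by (auto simp: trivialization_def)
  have fW: "restrict f W \<in> I W"
    using set_presheafD(1)[OF prelinear_imp_set_presheaf[OF IA.prelinear_left] U W(1,3), of f] f(1)
    by (simp add: ideal_sheaf_simps)
  have kk: "Poly_Mapping.keys (frag_of (restrict f W, b)) \<subseteq> sections (ideal_sheaf X I) W \<times> sections A W"
    using fW b by (simp add: ideal_sheaf_simps)
  define \<sigma> where "\<sigma> = (\<lambda>y\<in>W. germ X ?P y W (IA.tc W (frag_of (restrict f W, b))))"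
  have s: "\<sigma> \<in> sections (tensor_sheaf X (ideal_sheaf X I) A) W"
    unfolding \<sigma>_def tensor_sheaf_def by (rule germs_in_sheafify[OF W(1) IA.tc_in_tensor[OF W(1) kk]])
  have "\<exists>V h y. space_open X V \<and> V \<subseteq> W \<and> h \<in> regular X V \<and> y \<in> V \<and> restrict f W y * evaluate W b V h y \<noteq> 0"
  proof (rule ccontr)
    assume "\<not> ?thesis"
    then have "\<forall>y\<in>W. restrict f W y = 0"
      using W by (intro tangent_torsion_free[OF W(1) evaluate_derivation[OF W(1) b]
            evaluate_generator_nonzero[OF t] ideal_regular[OF W(1) fW]]) auto
    then show False using W f by simp
  qed
  then obtain V h y where V: "space_open X V" "V \<subseteq> W" "h \<in> regular X V" "y \<in> V"
    "restrict f W y * evaluate W b V h y \<noteq> 0" by blast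
  moreover have "embed W \<sigma> V h y = restrict f W y * evaluate W b V h y"
    using V by (intro embed_pure[OF V(1,2) W(1) V(2-4) fW b]) (auto simp: \<sigma>_def)
  ultimately show thesis using that[OF W(1) s V(1-4)] by simp
qed

end

section \<open>Co-Higgs fields from sections and homomorphisms to the tangent sheaf\<close>

context Module.module
begin

text \<open>Cross-multiplying the two memberships eliminates \<open>m\<close> and leaves (a d - c b)
  e in \<open>N\<close>, so the coefficient is zero. Thus the fraction b / a depends only on
  \<open>m\<close>.\<close>

lemma submodule_fraction_unique:
  assumes N: "submodule N R M" and e: "e \<in> carrier M" and eN: "\<And>b. b \<in> carrier R \<Longrightarrow> b \<odot>\<^bsub>M\<^esub> e \<in> N \<Longrightarrow> b = \<zero>"
    and m: "m \<in> carrier M" and R: "a \<in> carrier R" "b \<in> carrier R" "c \<in> carrier R" "d \<in> carrier R"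
    and 1: "a \<odot>\<^bsub>M\<^esub> m \<oplus>\<^bsub>M\<^esub> b \<odot>\<^bsub>M\<^esub> e \<in> N" and 2: "c \<odot>\<^bsub>M\<^esub> m \<oplus>\<^bsub>M\<^esub> d \<odot>\<^bsub>M\<^esub> e \<in> N"
  shows "a \<otimes> d = c \<otimes> b"
proof -
  note NE = submoduleE[OF N]
  have "a \<odot>\<^bsub>M\<^esub> (c \<odot>\<^bsub>M\<^esub> m \<oplus>\<^bsub>M\<^esub> d \<odot>\<^bsub>M\<^esub> e) \<oplus>\<^bsub>M\<^esub> \<ominus>\<^bsub>M\<^esub> (c \<odot>\<^bsub>M\<^esub> (a \<odot>\<^bsub>M\<^esub> m \<oplus>\<^bsub>M\<^esub> b \<odot>\<^bsub>M\<^esub> e)) \<in> N"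
    by (rule NE(5)[OF NE(4)[OF R(1) 2] NE(3)[OF NE(4)[OF R(3) 1]]])
  also have "a \<odot>\<^bsub>M\<^esub> (c \<odot>\<^bsub>M\<^esub> m \<oplus>\<^bsub>M\<^esub> d \<odot>\<^bsub>M\<^esub> e) = (a \<otimes> d) \<odot>\<^bsub>M\<^esub> e \<oplus>\<^bsub>M\<^esub> (a \<otimes> c) \<odot>\<^bsub>M\<^esub> m"
    using e m R by (simp add: smult_r_distr smult_assoc1 M.a_comm)
  also have "c \<odot>\<^bsub>M\<^esub> (a \<odot>\<^bsub>M\<^esub> m \<oplus>\<^bsub>M\<^esub> b \<odot>\<^bsub>M\<^esub> e) = (a \<otimes> c) \<odot>\<^bsub>M\<^esub> m \<oplus>\<^bsub>M\<^esub> (c \<otimes> b) \<odot>\<^bsub>M\<^esub> e"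
    using e m R by (simp add: smult_r_distr smult_assoc1 R.m_comm[of a c])
  also have "((a \<otimes> d) \<odot>\<^bsub>M\<^esub> e \<oplus>\<^bsub>M\<^esub> (a \<otimes> c) \<odot>\<^bsub>M\<^esub> m) \<oplus>\<^bsub>M\<^esub> \<ominus>\<^bsub>M\<^esub> ((a \<otimes> c) \<odot>\<^bsub>M\<^esub> m \<oplus>\<^bsub>M\<^esub> (c \<otimes> b) \<odot>\<^bsub>M\<^esub> e)
      = (a \<otimes> d) \<odot>\<^bsub>M\<^esub> e \<oplus>\<^bsub>M\<^esub> \<ominus>\<^bsub>M\<^esub> ((c \<otimes> b) \<odot>\<^bsub>M\<^esub> e)"
    using e m R by (simp add: M.minus_add M.a_assoc M.r_neg1 M.r_neg2)
  also have "\<dots> = (a \<otimes> d \<ominus> c \<otimes> b) \<odot>\<^bsub>M\<^esub> e"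
    using e R by (simp add: R.minus_eq smult_l_distr smult_l_minus)
  finally have "a \<otimes> d \<ominus> c \<otimes> b = \<zero>" using R by (intro eN) auto
  moreover have "a \<otimes> d = (a \<otimes> d \<ominus> c \<otimes> b) \<oplus> c \<otimes> b"
    using R by (simp add: R.minus_eq R.a_assoc R.l_neg)
  ultimately show ?thesis using R by simp
qed

text \<open>Addition of the fractions b / a and b' / a' over the common denominator a a'.\<close>

lemma submodule_fraction_add:
  assumes N: "submodule N R M" and e: "e \<in> carrier M"
    and m: "m \<in> carrier M" "m' \<in> carrier M"
    and R: "a \<in> carrier R" "b \<in> carrier R" "a' \<in> carrier R" "b' \<in> carrier R"
    and 1: "a \<odot>\<^bsub>M\<^esub> m \<oplus>\<^bsub>M\<^esub> b \<odot>\<^bsub>M\<^esub> e \<in> N" and 2: "a' \<odot>\<^bsub>M\<^esub> m' \<oplus>\<^bsub>M\<^esub> b' \<odot>\<^bsub>M\<^esub> e \<in> N"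
  shows "(a \<otimes> a') \<odot>\<^bsub>M\<^esub> (m \<oplus>\<^bsub>M\<^esub> m') \<oplus>\<^bsub>M\<^esub> (a' \<otimes> b \<oplus> a \<otimes> b') \<odot>\<^bsub>M\<^esub> e \<in> N"
proof -
  note NE = submoduleE[OF N]
  have "a' \<odot>\<^bsub>M\<^esub> (a \<odot>\<^bsub>M\<^esub> m \<oplus>\<^bsub>M\<^esub> b \<odot>\<^bsub>M\<^esub> e) \<oplus>\<^bsub>M\<^esub> a \<odot>\<^bsub>M\<^esub> (a' \<odot>\<^bsub>M\<^esub> m' \<oplus>\<^bsub>M\<^esub> b' \<odot>\<^bsub>M\<^esub> e) \<in> N"
    by (rule NE(5)[OF NE(4)[OF R(3) 1] NE(4)[OF R(1) 2]])
  also have "a' \<odot>\<^bsub>M\<^esub> (a \<odot>\<^bsub>M\<^esub> m \<oplus>\<^bsub>M\<^esub> b \<odot>\<^bsub>M\<^esub> e) = (a \<otimes> a') \<odot>\<^bsub>M\<^esub> m \<oplus>\<^bsub>M\<^esub> (a' \<otimes> b) \<odot>\<^bsub>M\<^esub> e"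
    using e m R by (simp add: smult_r_distr smult_assoc1 R.m_comm[of a a'])
  also have "a \<odot>\<^bsub>M\<^esub> (a' \<odot>\<^bsub>M\<^esub> m' \<oplus>\<^bsub>M\<^esub> b' \<odot>\<^bsub>M\<^esub> e) = (a \<otimes> a') \<odot>\<^bsub>M\<^esub> m' \<oplus>\<^bsub>M\<^esub> (a \<otimes> b') \<odot>\<^bsub>M\<^esub> e"
    using e m R by (simp add: smult_r_distr smult_assoc1)
  also have "((a \<otimes> a') \<odot>\<^bsub>M\<^esub> m \<oplus>\<^bsub>M\<^esub> (a' \<otimes> b) \<odot>\<^bsub>M\<^esub> e) \<oplus>\<^bsub>M\<^esub> ((a \<otimes> a') \<odot>\<^bsub>M\<^esub> m' \<oplus>\<^bsub>M\<^esub> (a \<otimes> b') \<odot>\<^bsub>M\<^esub> e)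
      = (a \<otimes> a') \<odot>\<^bsub>M\<^esub> (m \<oplus>\<^bsub>M\<^esub> m') \<oplus>\<^bsub>M\<^esub> (a' \<otimes> b \<oplus> a \<otimes> b') \<odot>\<^bsub>M\<^esub> e"
    using e m R by (simp add: smult_r_distr smult_l_distr M.a_ac)
  finally show ?thesis .
qed

lemma submodule_fraction_smult:
  assumes N: "submodule N R M" and e: "e \<in> carrier M" and m: "m \<in> carrier M"
    and R: "a \<in> carrier R" "b \<in> carrier R" "f \<in> carrier R"
    and 1: "a \<odot>\<^bsub>M\<^esub> m \<oplus>\<^bsub>M\<^esub> b \<odot>\<^bsub>M\<^esub> e \<in> N"
  shows "a \<odot>\<^bsub>M\<^esub> (f \<odot>\<^bsub>M\<^esub> m) \<oplus>\<^bsub>M\<^esub> (f \<otimes> b) \<odot>\<^bsub>M\<^esub> e \<in> N"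
proof -
  have "f \<odot>\<^bsub>M\<^esub> (a \<odot>\<^bsub>M\<^esub> m \<oplus>\<^bsub>M\<^esub> b \<odot>\<^bsub>M\<^esub> e) = a \<odot>\<^bsub>M\<^esub> (f \<odot>\<^bsub>M\<^esub> m) \<oplus>\<^bsub>M\<^esub> (f \<otimes> b) \<odot>\<^bsub>M\<^esub> e"
    using e m R by (simp add: smult_r_distr smult_assoc1[symmetric] R.m_comm[of f a])
  then show ?thesis using submoduleE(4)[OF N R(3) 1] by simp
qed

end

lemma sheaf_homD:
  assumes "sheaf_hom X F G \<phi>" "space_open X U" "s \<in> sections F U"
  shows "\<phi> U s \<in> sections G U"
    "t \<in> sections F U \<Longrightarrow> \<phi> U (s \<oplus>\<^bsub>sec F U\<^esub> t) = \<phi> U s \<oplus>\<^bsub>sec G U\<^esub> \<phi> U t"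
    "f \<in> regular X U \<Longrightarrow> \<phi> U (f \<odot>\<^bsub>sec F U\<^esub> s) = f \<odot>\<^bsub>sec G U\<^esub> \<phi> U s"
    "space_open X V \<Longrightarrow> V \<subseteq> U \<Longrightarrow> \<phi> V (res F U V s) = res G U V (\<phi> U s)"
  using assms unfolding sheaf_hom_def by (simp_all add: Pi_iff)

lemma sheaf_hom_zero:
  assumes F: "prelinear_presheaf X F" and G: "presheaf_of_modules X G"
    and \<phi>: "sheaf_hom X F G \<phi>" and U: "space_open X U"
  shows "\<phi> U \<zero>\<^bsub>sec F U\<^esub> = \<zero>\<^bsub>sec G U\<^esub>"
proof -
  interpret Module.module "function_ring X U" "sec G U"
    using G U by (simp add: presheaf_of_modules_def)
  note z = prelinear_presheafD(1,2)[OF F U]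
  have "\<phi> U \<zero>\<^bsub>sec F U\<^esub> \<oplus>\<^bsub>sec G U\<^esub> \<phi> U \<zero>\<^bsub>sec F U\<^esub> = \<phi> U \<zero>\<^bsub>sec F U\<^esub>"
    using sheaf_homD(2)[OF \<phi> U z(1,1)] z(2) by simp
  then show ?thesis using sheaf_homD(1)[OF \<phi> U z(1)] by (simp add: M.add.r_cancel_one)
qed

text \<open>Of the extension only two things are kept: a section \<open>e\<close> not annihilated by
  a nonzero function on any open set, and a map \<open>\<delta>\<close> to the tangent sheaf that
  kills it. Freeness of the kernel enters afterwards.\<close>

locale co_higgs_data = irreducible_function_space X for X :: "'p space_with_functions" +
  fixes E :: "('p, 'e) module_presheaf" and e :: 'e
    and \<delta> :: "'p set \<Rightarrow> 'e \<Rightarrow> 'p set \<Rightarrow> ('p \<Rightarrow> complex) \<Rightarrow> 'p \<Rightarrow> complex"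
  assumes modules_E: "presheaf_of_modules X E"
    and e: "e \<in> sections E (topspace (topo X))"
    and e_torsion_free: "space_open X U \<Longrightarrow> f \<in> regular X U \<Longrightarrow>
      f \<odot>\<^bsub>sec E U\<^esub> res E (topspace (topo X)) U e = \<zero>\<^bsub>sec E U\<^esub> \<Longrightarrow> x \<in> U \<Longrightarrow> f x = 0"
    and \<delta>: "sheaf_hom X E (tangent_sheaf X) \<delta>"
    and \<delta>_e: "\<delta> (topspace (topo X)) e = \<zero>\<^bsub>sec (tangent_sheaf X) (topspace (topo X))\<^esub>"
begin

abbreviation T where "T \<equiv> tangent_sheaf X"

abbreviation P where "P \<equiv> tensor_presheaf X E T"

lemma prelinear_E: "prelinear_presheaf X E"
  by (rule prelinear_if_presheaf_of_modules[OF modules_E])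

lemmas set_E = set_presheafD[OF prelinear_imp_set_presheaf[OF prelinear_E]]

sublocale ET: module_pair X E T
  by unfold_locales (rule prelinear_E prelinear_tangent modules_E)+

lemma prelinear_ET: "prelinear_presheaf X (tensor_sheaf X E T)"
  unfolding tensor_sheaf_def by (rule prelinear_sheafify[OF ET.prelinear_tensor])

sublocale ETT: prelinear_pair X "tensor_sheaf X E T" T
  by unfold_locales (rule prelinear_ET prelinear_tangent)+

definition eres :: "'p set \<Rightarrow> 'e" where
  "eres U = res E (topspace (topo X)) U e"

lemma eres:
  assumes "space_open X U"
  shows "eres U \<in> sections E U" "space_open X V \<Longrightarrow> V \<subseteq> U \<Longrightarrow> res E U V (eres U) = eres V"
  using assms e openin_subset[of "topo X" U] set_E by (auto simp: eres_def)

definition \<Phi> where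
  "\<Phi> U m = (\<lambda>x\<in>U. germ X P x U (ET.tc U (frag_of (eres U, \<delta> U m))))"

lemma pure_keys:
  assumes "space_open X U" "m \<in> sections E U"
  shows "Poly_Mapping.keys (frag_of (eres U, \<delta> U m)) \<subseteq> sections E U \<times> sections T U"
  using eres(1)[OF assms(1)] sheaf_homD(1)[OF \<delta> assms] by simp

lemma \<Phi>_hom: "sheaf_hom X E (tensor_sheaf X E T) \<Phi>"
  unfolding sheaf_hom_def
proof (intro conjI allI impI ballI funcsetI)
  fix U m assume U: "space_open X U" and m: "m \<in> sections E U"
  note k = pure_keys[OF U]
  note d = sheaf_homD(1)[OF \<delta> U]
  show "\<Phi> U m \<in> sections (tensor_sheaf X E T) U"
    unfolding \<Phi>_def tensor_sheaf_def by (rule germs_in_sheafify[OF U ET.tc_in_tensor[OF U k[OF m]]])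
  show "\<Phi> U (m \<oplus>\<^bsub>sec E U\<^esub> m') = \<Phi> U m \<oplus>\<^bsub>sec (tensor_sheaf X E T) U\<^esub> \<Phi> U m'" if m': "m' \<in> sections E U" for m'
  proof -
    have "ET.tc U (frag_of (eres U, \<delta> U m \<oplus>\<^bsub>sec T U\<^esub> \<delta> U m')) =
        ET.tc U (frag_of (eres U, \<delta> U m) + frag_of (eres U, \<delta> U m'))"
      unfolding ET.tc_def
      by (rule premodule_pair.tcl_pure_add_right[OF ET.premodule_pair[OF U] eres(1)[OF U] d[OF m] d[OF m']])
    then have "ET.tc U (frag_of (eres U, \<delta> U (m \<oplus>\<^bsub>sec E U\<^esub> m'))) =
        ET.tc U (frag_of (eres U, \<delta> U m)) \<oplus>\<^bsub>sec P U\<^esub> ET.tc U (frag_of (eres U, \<delta> U m'))"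
      by (simp only: sheaf_homD(2)[OF \<delta> U m m'] ET.add_tensor[OF U k[OF m] k[OF m']])
    moreover have "germ_add X P x (germ X P x U (ET.tc U (frag_of (eres U, \<delta> U m))))
        (germ X P x U (ET.tc U (frag_of (eres U, \<delta> U m')))) =
        germ X P x U (ET.tc U (frag_of (eres U, \<delta> U m)) \<oplus>\<^bsub>sec P U\<^esub> ET.tc U (frag_of (eres U, \<delta> U m')))"
      if "x \<in> U" for x
      by (rule germ_add_germ_same[OF ET.prelinear_tensor U that ET.tc_in_tensor[OF U k[OF m]] ET.tc_in_tensor[OF U k[OF m']]])
    ultimately show ?thesis
      unfolding \<Phi>_def tensor_sheaf_def sheafify_simps by (auto intro!: restrict_ext)
  qed
  show "\<Phi> U (f \<odot>\<^bsub>sec E U\<^esub> m) = f \<odot>\<^bsub>sec (tensor_sheaf X E T) U\<^esub> \<Phi> U m" if f: "f \<in> regular X U" for f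
  proof -
    \<comment> \<open>Scalars act on \<open>e\<close> in the presheaf but come out of
      \<open>\<delta>\<close> on the other side; the balancing relation moves them across.\<close>
    have "ET.tc U (frag_of (f \<odot>\<^bsub>sec E U\<^esub> eres U, \<delta> U m)) = ET.tc U (frag_of (eres U, f \<odot>\<^bsub>sec T U\<^esub> \<delta> U m))"
      unfolding ET.tc_def using f
      by (intro premodule_pair.tcl_pure_smult[OF ET.premodule_pair[OF U] _ eres(1)[OF U] d[OF m]]) simp
    then have "ET.tc U (frag_of (eres U, \<delta> U (f \<odot>\<^bsub>sec E U\<^esub> m))) = f \<odot>\<^bsub>sec P U\<^esub> ET.tc U (frag_of (eres U, \<delta> U m))"
      by (simp add: sheaf_homD(3)[OF \<delta> U m f] ET.smult_tensor[OF U f])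
    moreover have "germ_smult X P x U f (germ X P x U (ET.tc U (frag_of (eres U, \<delta> U m)))) =
        germ X P x U (f \<odot>\<^bsub>sec P U\<^esub> ET.tc U (frag_of (eres U, \<delta> U m)))" if "x \<in> U" for x
      by (rule germ_smult_germ_same[OF ET.prelinear_tensor U that f ET.tc_in_tensor[OF U k[OF m]]])
    ultimately show ?thesis
      unfolding \<Phi>_def tensor_sheaf_def sheafify_simps by (auto intro!: restrict_ext)
  qed
next
  fix U V m assume o: "space_open X U \<and> space_open X V \<and> V \<subseteq> U" and m: "m \<in> sections E U"
  then have U: "space_open X U" "space_open X V" "V \<subseteq> U" by auto
  have r: "res P U V (ET.tc U (frag_of (eres U, \<delta> U m))) = ET.tc V (frag_of (eres V, \<delta> V (res E U V m)))"
    by (simp add: ET.res_tensor[OF U] eres(2)[OF U] sheaf_homD(4)[OF \<delta> U(1) m U(2,3)])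
  show "\<Phi> V (res E U V m) = res (tensor_sheaf X E T) U V (\<Phi> U m)"
    unfolding \<Phi>_def tensor_sheaf_def sheafify_simps
  proof (rule ext)
    fix x
    show "(\<lambda>x\<in>V. germ X P x V (ET.tc V (frag_of (eres V, \<delta> V (res E U V m))))) x =
        restrict (\<lambda>x\<in>U. germ X P x U (ET.tc U (frag_of (eres U, \<delta> U m)))) V x"
      using germ_restrict[OF ET.set_presheaf_tensor U _ ET.tc_in_tensor[OF U(1) pure_keys[OF U(1) m]], of x] U(3) r
      by auto
  qed
qed

lemma \<delta>_eres: "space_open X U \<Longrightarrow> \<delta> U (eres U) = \<zero>\<^bsub>sec T U\<^esub>"
  using sheaf_homD(4)[OF \<delta> _ e, of U] \<delta>_e openin_subset[of "topo X" U]
    prelinear_presheaf_resD(3)[OF prelinear_tangent, of "topspace (topo X)" U]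
  by (simp add: eres_def)

lemma \<Phi>_zero:
  assumes U: "space_open X U" and z: "\<delta> U m = \<zero>\<^bsub>sec T U\<^esub>"
  shows "\<Phi> U m = \<zero>\<^bsub>sec (tensor_sheaf X E T) U\<^esub>"
  using premodule_pair.tcl_pure_zero_right[OF ET.premodule_pair[OF U] eres(1)[OF U]] z
  by (simp add: \<Phi>_def tensor_sheaf_def sheafify_simps ET.zero_tensor[OF U] ET.tc_def)

text \<open>The map on germs is a union over all representatives, not only over the pure tensor by
  which \<Phi>(m) is defined. Each representative is compared with that tensor on a smaller
  neighbourhood, where the image is \<Phi>(e) \<otimes> \<delta>(m) = 0 \<otimes>
  \<delta>(m).\<close>

lemma \<Phi>_squared_zero:
  assumes U: "space_open X U" and m: "m \<in> sections E U"
  shows "tensor_sheaf_map X (tensor_sheaf X E T) T \<Phi> (\<lambda>_ t. t) U (\<Phi> U m) =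
    \<zero>\<^bsub>sec (tensor_sheaf X (tensor_sheaf X E T) T) U\<^esub>"
proof -
  let ?Q = "tensor_presheaf X (tensor_sheaf X E T) T"
  define th where "th = (\<lambda>U. tensor_hom (function_ring X U) (sec (tensor_sheaf X E T) U) (sec T U) (\<Phi> U) (\<lambda>t. t))"
  have th: "th V (ET.tc V k) = ETT.tc V (frag_map2 (\<Phi> V) (\<lambda>t. t) k)" if V: "space_open X V" for V k
  proof -
    have 1: "semilinear (function_ring X V) (function_ring X V) (\<lambda>f. f) (sec E V) (sec (tensor_sheaf X E T) V) (\<Phi> V)"
      unfolding semilinear_def using sheaf_homD[OF \<Phi>_hom V] by auto
    have 2: "semilinear (function_ring X V) (function_ring X V) (\<lambda>f. f) (sec T V) (sec T V) (\<lambda>t. t)"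
      unfolding semilinear_def by auto
    show ?thesis
      unfolding th_def ET.tc_def ETT.tc_def
      by (rule premodule_pair.tensor_hom_tcl[OF ETT.premodule_pair[OF V] 1 2
            prelinear_presheafD(5)[OF prelinear_E V] prelinear_presheafD(5)[OF prelinear_tangent V]])
  qed
  have k_th: "Poly_Mapping.keys (frag_map2 (\<Phi> V) (\<lambda>t. t) k) \<subseteq> sections (tensor_sheaf X E T) V \<times> sections T V"
    if "space_open X V" "Poly_Mapping.keys k \<subseteq> sections E V \<times> sections T V" for V k
    using sheaf_homD(1)[OF \<Phi>_hom that(1)] by (intro keys_frag_map2[OF that(2)]) auto
  \<comment> \<open>Naturality of \<Phi> \<otimes> id under restriction is what permits this
    comparison.\<close>
  have th_res: "res ?Q V W (th V (ET.tc V k)) = th W (res P V W (ET.tc V k))"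
    if V: "space_open X V" "space_open X W" "W \<subseteq> V" and k: "Poly_Mapping.keys k \<subseteq> sections E V \<times> sections T V" for V W k
  proof -
    have "frag_map2 (\<lambda>m. res (tensor_sheaf X E T) V W (\<Phi> V m)) (res T V W) k =
        frag_map2 (\<lambda>m. \<Phi> W (res E V W m)) (res T V W) k"
      using sheaf_homD(4)[OF \<Phi>_hom V(1) _ V(2,3)] by (intro frag_map2_cong[OF k]) auto
    then show ?thesis
      using V by (simp add: th ET.res_tensor ETT.res_tensor frag_map2_compose)
  qed
  have "germ_map X ?Q th x (\<Phi> U m x) = germ X ?Q x U \<zero>\<^bsub>sec ?Q U\<^esub>" if x: "x \<in> U" for x
  proof -
    have "(\<Union>(V, c)\<in>germ X P x U (ET.tc U (frag_of (eres U, \<delta> U m))). germ X ?Q x V (th V c)) =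
        germ X ?Q x U \<zero>\<^bsub>sec ?Q U\<^esub>"
    proof (rule UN_germ_eq[OF ET.set_presheaf_tensor U x ET.tc_in_tensor[OF U pure_keys[OF U m]]])
      fix V c assume V: "space_open X V" "x \<in> V" and c: "c \<in> sections P V"
        and eq: "germ X P x V c = germ X P x U (ET.tc U (frag_of (eres U, \<delta> U m)))"
      obtain k where k: "c = ET.tc V k" "Poly_Mapping.keys k \<subseteq> sections E V \<times> sections T V"
        using c by (auto simp: ET.sections_tensor[OF V(1)])
      obtain W where W: "space_open X W" "x \<in> W" "W \<subseteq> V" "W \<subseteq> U"
        and r: "res P V W c = res P U W (ET.tc U (frag_of (eres U, \<delta> U m)))"
        using germ_local[OF ET.set_presheaf_tensor V c U x ET.tc_in_tensor[OF U pure_keys[OF U m]] eq] .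
      have "\<Phi> W (eres W) = \<zero>\<^bsub>sec (tensor_sheaf X E T) W\<^esub>" by (rule \<Phi>_zero[OF W(1) \<delta>_eres[OF W(1)]])
      moreover have "res T U W (\<delta> U m) \<in> sections T W"
        using set_presheafD(1)[OF prelinear_imp_set_presheaf[OF prelinear_tangent] U W(1,4) sheaf_homD(1)[OF \<delta> U m]] .
      ultimately have "ETT.tc W (frag_of (\<Phi> W (eres W), res T U W (\<delta> U m))) = ETT.tc W 0"
        using premodule_pair.tcl_pure_zero_left[OF ETT.premodule_pair[OF W(1)]] by (simp add: ETT.tc_def)
      then have "res ?Q V W (th V c) = \<zero>\<^bsub>sec ?Q W\<^esub>"
        using th_res[OF V(1) W(1,3) k(2)] r
        by (simp add: k(1) ET.res_tensor[OF U W(1,4)] th[OF W(1)] eres(2)[OF U W(1,4)] ETT.zero_tensor[OF W(1)])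
      also have "\<dots> = res ?Q U W \<zero>\<^bsub>sec ?Q U\<^esub>"
        by (simp add: ETT.zero_tensor U W ETT.res_tensor)
      finally show "germ X ?Q x V (th V c) = germ X ?Q x U \<zero>\<^bsub>sec ?Q U\<^esub>"
        using W ETT.tc_in_tensor[OF V(1) k_th[OF V(1) k(2)]] ETT.tc_in_tensor[OF U, of 0]
        by (subst germ_eq_iff[OF ETT.set_presheaf_tensor V _ U x])
          (auto simp: k(1) th[OF V(1)] ETT.zero_tensor[OF U] intro!: exI[of _ W])
    qed
    then show ?thesis using x by (simp add: germ_map_def \<Phi>_def)
  qed
  then show ?thesis
    unfolding tensor_sheaf_map_def sheafify_map_def tensor_sheaf_def[of X "tensor_sheaf X E T"] sheafify_simps
    by (auto simp: th_def intro!: restrict_ext)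
qed

text \<open>
  The functional \<open>l\<close> takes values in rational functions, which are represented by arbitrary
  functions modulo equality on some nonempty open set.
\<close>

lemma pure_tensor_zero:
  assumes W: "space_open X W" "W \<noteq> {}" and t: "t \<in> sections T W"
    and z: "ET.tc W (frag_of (eres W, t)) = ET.tc W 0" and h: "h \<in> regular X W" and x: "x \<in> W"
  shows "t W h x = 0"
proof -
  interpret m: Module.module "function_ring X W" "sec E W"
    using modules_E W by (simp add: presheaf_of_modules_def)
  let ?R = "function_ring X W" and ?M = "sec E W"
  note ew = eres(1)[OF W(1)]
  have tf: "a = \<zero>\<^bsub>?R\<^esub>" if "a \<in> carrier ?R" "a \<odot>\<^bsub>?M\<^esub> eres W = \<zero>\<^bsub>?M\<^esub>" for a
    using that e_torsion_free[OF W(1)] unfolding function_ring_simps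
    by (intro regular_eqI[OF W(1)]) (auto simp: eres_def intro!: regular_const[OF W(1)])
  have nt: "\<one>\<^bsub>?R\<^esub> \<noteq> \<zero>\<^bsub>?R\<^esub>"
    using x unfolding function_ring_simps by (metis restrict_apply' zero_neq_one)
  obtain N where N: "submodule N ?R ?M" and eN: "\<And>b. b \<in> carrier ?R \<Longrightarrow> b \<odot>\<^bsub>?M\<^esub> eres W \<in> N \<Longrightarrow> b = \<zero>\<^bsub>?R\<^esub>"
    and ex: "\<forall>m\<in>carrier ?M. \<exists>a\<in>carrier ?R. \<exists>b\<in>carrier ?R. a \<noteq> \<zero>\<^bsub>?R\<^esub> \<and> a \<odot>\<^bsub>?M\<^esub> m \<oplus>\<^bsub>?M\<^esub> b \<odot>\<^bsub>?M\<^esub> eres W \<in> N"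
    using m.maximal_complement_of_line[OF ew tf nt] by blast
  obtain a where "\<forall>m\<in>carrier ?M. a m \<in> carrier ?R \<and> (\<exists>b\<in>carrier ?R. a m \<noteq> \<zero>\<^bsub>?R\<^esub> \<and>
      a m \<odot>\<^bsub>?M\<^esub> m \<oplus>\<^bsub>?M\<^esub> b \<odot>\<^bsub>?M\<^esub> eres W \<in> N)"
    using ex by (metis (no_types, lifting))
  then obtain b where ab0: "\<forall>m\<in>carrier ?M. a m \<in> carrier ?R \<and> b m \<in> carrier ?R \<and> a m \<noteq> \<zero>\<^bsub>?R\<^esub> \<and>
      a m \<odot>\<^bsub>?M\<^esub> m \<oplus>\<^bsub>?M\<^esub> b m \<odot>\<^bsub>?M\<^esub> eres W \<in> N"
    by (metis (no_types, lifting))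
  then have ab: "a m \<in> carrier ?R" "b m \<in> carrier ?R" "a m \<noteq> \<zero>\<^bsub>?R\<^esub>"
    "a m \<odot>\<^bsub>?M\<^esub> m \<oplus>\<^bsub>?M\<^esub> b m \<odot>\<^bsub>?M\<^esub> eres W \<in> N" if "m \<in> carrier ?M" for m
    using that by auto
  \<comment> \<open>With a m + b e in \<open>N\<close>, the element m is congruent to - (b / a) e,
    so \<open>l\<close> is minus the coordinate along \<open>e\<close>; this is why it takes the
    value - 1 at \<open>e\<close>. Where the denominator vanishes the quotient is 0 by convention,
    so the value is meaningful only on \<open>dom m\<close>.\<close>
  define l where "l m x = b m x / a m x" for m x
  define dom where "dom m = {x \<in> W. a m x \<noteq> 0}" for m
  have dom: "space_open X (dom m)" "dom m \<subseteq> W" "dom m \<noteq> {}" if "m \<in> carrier ?M" for m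
  proof -
    show "space_open X (dom m)" unfolding dom_def using regular_nonzero_open[OF W(1)] ab(1)[OF that] by simp
    show "dom m \<noteq> {}"
    proof
      assume "dom m = {}"
      then have "a m = \<zero>\<^bsub>?R\<^esub>"
        using ab(1)[OF that] unfolding function_ring_simps dom_def
        by (intro regular_eqI[OF W(1)]) (auto intro!: regular_const[OF W(1)])
      then show False using ab(3)[OF that] by simp
    qed
  qed (auto simp: dom_def)
  \<comment> \<open>Any relation between \<open>m\<close> and \<open>e\<close> modulo
    \<open>N\<close> computes the functional, not only the one chosen by \<open>a\<close> and
    \<open>b\<close>.\<close>
  have key: "d y = c y * l m y"
    if "m \<in> carrier ?M" "c \<in> carrier ?R" "d \<in> carrier ?R" "c \<odot>\<^bsub>?M\<^esub> m \<oplus>\<^bsub>?M\<^esub> d \<odot>\<^bsub>?M\<^esub> eres W \<in> N" "y \<in> dom m"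
    for m c d y
  proof -
    have "a m \<otimes>\<^bsub>?R\<^esub> d = c \<otimes>\<^bsub>?R\<^esub> b m"
      by (rule m.submodule_fraction_unique[OF N ew eN that(1) ab(1,2)[OF that(1)] that(2,3) ab(4)[OF that(1)] that(4)])
    then have "(\<lambda>x\<in>W. a m x * d x) y = (\<lambda>x\<in>W. c x * b m x) y" by (simp only: function_ring_simps)
    then show ?thesis using that(5) by (simp add: dom_def l_def field_simps)
  qed
  \<comment> \<open>Validity on some nonempty open subset is the counterpart of an identity of
    rational functions. By irreducibility two such properties hold together on a nonempty open
    set.\<close>
  define gen where "gen Q \<longleftrightarrow> (\<exists>V. space_open X V \<and> V \<noteq> {} \<and> V \<subseteq> W \<and> (\<forall>x\<in>V. Q x))" for Q
  have gen2: "gen Q''" if "gen Q" "gen Q'" "\<And>x. x \<in> W \<Longrightarrow> Q x \<Longrightarrow> Q' x \<Longrightarrow> Q'' x" for Q Q' Q''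
  proof -
    obtain V V' where V: "space_open X V" "V \<noteq> {}" "V \<subseteq> W" "\<forall>x\<in>V. Q x"
      and V': "space_open X V'" "V' \<noteq> {}" "V' \<subseteq> W" "\<forall>x\<in>V'. Q' x"
      using \<open>gen Q\<close> \<open>gen Q'\<close> unfolding gen_def by blast
    have "V \<inter> V' \<noteq> {}" by (rule opens_meet[OF V(1) V'(1) V(2) V'(2)])
    then show ?thesis unfolding gen_def using V V' that(3) by (intro exI[of _ "V \<inter> V'"]) auto
  qed
  have gen_dom: "gen (\<lambda>x. x \<in> dom m)" if "m \<in> carrier ?M" for m
    unfolding gen_def using dom[OF that] by blast
  have gen_add: "gen (\<lambda>x. l (m \<oplus>\<^bsub>?M\<^esub> m') x = l m x + l m' x)" if m: "m \<in> carrier ?M" "m' \<in> carrier ?M" for m m'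
  proof (rule gen2[OF gen2[OF gen_dom[OF m(1)] gen_dom[OF m(2)], of "\<lambda>x. x \<in> dom m \<and> x \<in> dom m'"]
        gen_dom[OF m.M.a_closed[OF m]]])
    fix x assume xW: "x \<in> W" and x: "x \<in> dom m \<and> x \<in> dom m'" and x': "x \<in> dom (m \<oplus>\<^bsub>?M\<^esub> m')"
    note f = m.submodule_fraction_add[OF N ew m ab(1,2)[OF m(1)] ab(1,2)[OF m(2)] ab(4)[OF m(1)] ab(4)[OF m(2)]]
    have "(a m' \<otimes>\<^bsub>?R\<^esub> b m \<oplus>\<^bsub>?R\<^esub> a m \<otimes>\<^bsub>?R\<^esub> b m') x = (a m \<otimes>\<^bsub>?R\<^esub> a m') x * l (m \<oplus>\<^bsub>?M\<^esub> m') x"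
      using ab(1,2)[OF m(1)] ab(1,2)[OF m(2)] by (intro key[OF _ _ _ f x']) (use m in \<open>auto simp del: carrier_function_ring\<close>)
    then have "a m' x * b m x + a m x * b m' x = a m x * a m' x * l (m \<oplus>\<^bsub>?M\<^esub> m') x"
      using xW by (simp add: function_ring_simps)
    then show "l (m \<oplus>\<^bsub>?M\<^esub> m') x = l m x + l m' x"
      using x by (simp add: dom_def l_def[of m] l_def[of m'] field_simps)
  qed auto
  have gen_smult: "gen (\<lambda>x. l (f \<odot>\<^bsub>?M\<^esub> m) x = f x * l m x)" if f: "f \<in> carrier ?R" and m: "m \<in> carrier ?M" for f m
  proof (rule gen2[OF gen_dom[OF m] gen_dom[OF m.smult_closed[OF f m]]])
    fix x assume xW: "x \<in> W" and x: "x \<in> dom m" and x': "x \<in> dom (f \<odot>\<^bsub>?M\<^esub> m)"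
    note s = m.submodule_fraction_smult[OF N ew m ab(1,2)[OF m] f ab(4)[OF m]]
    have "(f \<otimes>\<^bsub>?R\<^esub> b m) x = a m x * l (f \<odot>\<^bsub>?M\<^esub> m) x"
      using ab(1,2)[OF m] by (intro key[OF _ _ _ s x']) (use f m in \<open>auto simp del: carrier_function_ring\<close>)
    then have "f x * b m x = a m x * l (f \<odot>\<^bsub>?M\<^esub> m) x"
      using xW by (simp add: function_ring_simps)
    then show "l (f \<odot>\<^bsub>?M\<^esub> m) x = f x * l m x"
      using x by (simp add: dom_def l_def[of m] field_simps)
  qed
  have gen_e: "gen (\<lambda>x. l (eres W) x = - 1)"
  proof (rule gen2[OF gen_dom[OF ew] gen_dom[OF ew]])
    fix x assume xW: "x \<in> W" and x: "x \<in> dom (eres W)"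
    \<comment> \<open>The relation 1 e + (- 1) e = 0 lies in every submodule.\<close>
    have "\<one>\<^bsub>?R\<^esub> \<odot>\<^bsub>?M\<^esub> eres W \<oplus>\<^bsub>?M\<^esub> (\<ominus>\<^bsub>?R\<^esub> \<one>\<^bsub>?R\<^esub>) \<odot>\<^bsub>?M\<^esub> eres W = \<zero>\<^bsub>?M\<^esub>"
      using ew by (simp add: m.smult_l_minus m.M.r_neg del: carrier_function_ring)
    also have "\<dots> \<in> N" using subgroup.one_closed[OF submodule.axioms(1)[OF N]] by simp
    finally have "(\<ominus>\<^bsub>?R\<^esub> \<one>\<^bsub>?R\<^esub>) x = \<one>\<^bsub>?R\<^esub> x * l (eres W) x"
      using ew x by (intro key) (auto simp del: carrier_function_ring)
    moreover have "(\<ominus>\<^bsub>?R\<^esub> \<one>\<^bsub>?R\<^esub>) x + \<one>\<^bsub>?R\<^esub> x = 0"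
    proof -
      have "(\<ominus>\<^bsub>?R\<^esub> \<one>\<^bsub>?R\<^esub> \<oplus>\<^bsub>?R\<^esub> \<one>\<^bsub>?R\<^esub>) x = \<zero>\<^bsub>?R\<^esub> x" by (simp add: m.R.l_neg del: carrier_function_ring)
      then show ?thesis using xW by (simp add: function_ring_simps(3,4))
    qed
    moreover have "\<one>\<^bsub>?R\<^esub> x = 1" using xW by (simp add: function_ring_simps)
    ultimately show "l (eres W) x = - 1" by (simp add: eq_neg_iff_add_eq_0)
  qed
  \<comment> \<open>The pairing (m, n) \<mapsto> l(m) n(h): generically it kills all relations, so
    it can be evaluated on the vanishing tensor e \<otimes> t.\<close>
  define B where "B x i = (case i of (m, n) \<Rightarrow> l m x * n W h x)" for x and i :: "'e \<times> ('p set \<Rightarrow> ('p \<Rightarrow> complex) \<Rightarrow> 'p \<Rightarrow> complex)"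
  have "gen (\<lambda>x. frag_eval (B x) k = 0)" if "k \<in> tensor_relations ?R ?M (sec T W)" for k
    using prelinear_presheafD(5)[OF prelinear_E W(1)] prelinear_presheafD(5)[OF prelinear_tangent W(1)] that
  proof (induction rule: tensor_relations_induct)
    case zero
    then show ?case using W by (auto simp: gen_def)
  next
    case (diff k k')
    then show ?case by (rule gen2) (simp add: frag_eval_diff)
  next
    case (add_left m m' n)
    from gen_add[OF this(1,2)] show ?case
      by (rule gen2[OF _ gen_dom[OF add_left(1)]]) (simp add: frag_eval_diff frag_eval_add B_def algebra_simps)
  next
    case (add_right m n n')
    \<comment> \<open>The identity holds at every point of \<open>W\<close>; \<open>gen_dom\<close>
      only supplies a nonempty open set.\<close>
    show ?case
      by (rule gen2[OF gen_dom[OF add_right(1)] gen_dom[OF add_right(1)]])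
        (simp add: frag_eval_diff frag_eval_add B_def tangent_simps W h algebra_simps)
  next
    case (smult f m n)
    from gen_smult[OF this(1,2)] show ?case
      by (rule gen2[OF _ gen_dom[OF smult(2)]]) (simp add: frag_eval_diff B_def tangent_simps W h)
  qed
  from this[of "frag_of (eres W, t) - 0"] z
  have "gen (\<lambda>x. l (eres W) x * t W h x = 0)" by (simp add: ET.tc_eq_iff[OF W(1)] B_def)
  from gen2[OF gen_e this, of "\<lambda>x. t W h x = 0"]
  obtain V where V: "space_open X V" "V \<noteq> {}" "V \<subseteq> W" "\<And>x. x \<in> V \<Longrightarrow> t W h x = 0"
    unfolding gen_def by auto
  \<comment> \<open>Unlike the values of \<open>l\<close>, this is a regular function on all of
    \<open>W\<close>, so vanishing on a nonempty open set suffices.\<close>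
  have "t W h \<in> regular X W"
    using sheaf_derivationD(3)[of W t W h] t h W(1) by (simp add: tangent_simps opens_in_iff)
  from identity_principle[OF W(1) this V(1,3,2) V(4) x] show ?thesis .
qed

text \<open>Vanishing of \<Phi>(m) is known germ by germ. At each point it gives a neighbourhood on
  which e \<otimes> \<delta>(m) is zero in the presheaf tensor product, and there
  \<open>pure_tensor_zero\<close> applies.\<close>

lemma \<Phi>_zero_iff:
  assumes U: "space_open X U" and m: "m \<in> sections E U"
  shows "\<Phi> U m = \<zero>\<^bsub>sec (tensor_sheaf X E T) U\<^esub> \<longleftrightarrow> \<delta> U m = \<zero>\<^bsub>sec T U\<^esub>"
proof
  assume z: "\<Phi> U m = \<zero>\<^bsub>sec (tensor_sheaf X E T) U\<^esub>"
  have D: "sheaf_derivation X U (\<delta> U m)" using sheaf_homD(1)[OF \<delta> U m] by (simp add: tangent_simps)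
  show "\<delta> U m = \<zero>\<^bsub>sec T U\<^esub>"
  proof (rule sheaf_derivation_eqI[OF D tangent_closed(1)[OF U]])
    fix V h x assume V: "space_open X V" "V \<subseteq> U" "h \<in> regular X V" "x \<in> V"
    then have x: "x \<in> U" by auto
    have "germ X P x U (ET.tc U (frag_of (eres U, \<delta> U m))) = germ X P x U (ET.tc U 0)"
      using fun_cong[OF z, of x] x by (simp add: \<Phi>_def tensor_sheaf_def sheafify_simps ET.zero_tensor[OF U])
    then obtain W where W: "space_open X W" "x \<in> W" "W \<subseteq> U"
      and r: "res P U W (ET.tc U (frag_of (eres U, \<delta> U m))) = res P U W (ET.tc U 0)"
      using germ_local[OF ET.set_presheaf_tensor U x ET.tc_in_tensor[OF U pure_keys[OF U m]] U x ET.tc_in_tensor[OF U, of 0]]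
      by auto
    \<comment> \<open>\<open>h\<close> is given on \<open>V\<close> and the vanishing of the tensor
      on \<open>W\<close>; both are available on the intersection.\<close>
    define N where "N = W \<inter> V"
    have N: "space_open X N" "x \<in> N" "N \<subseteq> W" "N \<subseteq> V" "N \<subseteq> U" unfolding N_def using V W by auto
    have "res P U N (ET.tc U (frag_of (eres U, \<delta> U m))) = res P W N (res P U W (ET.tc U (frag_of (eres U, \<delta> U m))))"
      using set_presheafD(3)[OF ET.set_presheaf_tensor U W(1) N(1,3) W(3) ET.tc_in_tensor[OF U pure_keys[OF U m]]] by simp
    also have "\<dots> = ET.tc N 0" unfolding r by (simp add: ET.res_tensor U W N)
    finally have q: "ET.tc N (frag_of (eres N, res T U N (\<delta> U m))) = ET.tc N 0"
      by (simp add: ET.res_tensor U N eres(2)[OF U])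
    have q': "res T U N (\<delta> U m) \<in> sections T N"
      using set_presheafD(1)[OF prelinear_imp_set_presheaf[OF prelinear_tangent] U N(1,5) sheaf_homD(1)[OF \<delta> U m]] .
    have "N \<noteq> {}" using N(2) by blast
    from pure_tensor_zero[OF N(1) this q' q regular_restrict[OF V(1) N(1,4) V(3)] N(2)]
    have "res T U N (\<delta> U m) N (restrict h N) x = 0" .
    then have "\<delta> U m N (restrict h N) x = 0" using N by (simp add: tangent_simps opens_in_iff)
    then have "\<delta> U m V h x = 0" using derivation_restrict[OF D V(1,2) N(1,4) V(3) N(2)] by simp
    then show "\<delta> U m V h x = \<zero>\<^bsub>sec T U\<^esub> V h x" using V by (simp add: tangent_simps)
  qed
qed (rule \<Phi>_zero[OF U])

lemma two_nilpotent:
  assumes "space_open X U" "m \<in> sections E U" "\<delta> U m \<noteq> \<zero>\<^bsub>sec T U\<^esub>"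
  shows "two_nilpotent_co_Higgs X E \<Phi>"
  unfolding two_nilpotent_co_Higgs_def Let_def
proof (intro conjI allI impI ballI)
  show "sheaf_hom X E (tensor_sheaf X E T) \<Phi>" by (rule \<Phi>_hom)
  show "\<exists>U. space_open X U \<and> (\<exists>e\<in>sections E U. \<Phi> U e \<noteq> \<zero>\<^bsub>sec (tensor_sheaf X E T) U\<^esub>)"
    by (intro exI[of _ U] conjI bexI[of _ m]) (simp_all add: assms \<Phi>_zero_iff[OF assms(1,2)])
qed (rule \<Phi>_squared_zero)

end

section \<open>Extensions by a free sheaf\<close>

lemma free_sheaf_simps:
  "sections (free_sheaf X n) U = ({..<n} \<rightarrow>\<^sub>E regular X U)"
  "\<zero>\<^bsub>sec (free_sheaf X n) U\<^esub> = (\<lambda>i\<in>{..<n}. \<lambda>x\<in>U. 0)"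
  "a \<oplus>\<^bsub>sec (free_sheaf X n) U\<^esub> b = (\<lambda>i\<in>{..<n}. \<lambda>x\<in>U. a i x + b i x)"
  "f \<odot>\<^bsub>sec (free_sheaf X n) U\<^esub> a = (\<lambda>i\<in>{..<n}. \<lambda>x\<in>U. f x * a i x)"
  "res (free_sheaf X n) U V a = (\<lambda>i\<in>{..<n}. restrict (a i) V)"
  by (simp_all add: free_sheaf_def mk_module_def)

context function_space
begin

lemma prelinear_free: "prelinear_presheaf X (free_sheaf X n)"
proof -
  have "set_presheaf X (free_sheaf X n)"
    unfolding set_presheaf_def free_sheaf_simps
  proof (intro conjI allI impI ballI funcsetI)
    fix U V a assume "space_open X U \<and> space_open X V \<and> V \<subseteq> U" "a \<in> {..<n} \<rightarrow>\<^sub>E regular X U"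
    then show "(\<lambda>i\<in>{..<n}. restrict (a i) V) \<in> {..<n} \<rightarrow>\<^sub>E regular X V"
      by (auto intro!: regular_restrict[of U])
  next
    fix U a assume U: "space_open X U" and a: "a \<in> {..<n} \<rightarrow>\<^sub>E regular X U"
    show "(\<lambda>i\<in>{..<n}. restrict (a i) U) = a"
    proof
      fix i show "(\<lambda>i\<in>{..<n}. restrict (a i) U) i = a i"
        using regular_extensional[OF U, of "a i"] a by (cases "i < n") (auto simp: extensional_restrict PiE_iff extensional_def[of "{..<n}"])
    qed
  next
    fix U V W a assume "space_open X U \<and> space_open X V \<and> space_open X W \<and> W \<subseteq> V \<and> V \<subseteq> U"
    then show "(\<lambda>i\<in>{..<n}. restrict ((\<lambda>i\<in>{..<n}. restrict (a i) V) i) W) = (\<lambda>i\<in>{..<n}. restrict (a i) W)"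
      by (auto simp: Int_absorb1 intro!: restrict_ext)
  qed
  moreover have "premodule (function_ring X U) (sec (free_sheaf X n) U)" if "space_open X U" for U
    unfolding premodule_def free_sheaf_simps using that regular_const[OF that, of 0]
    by (auto intro!: regular_add regular_mult restrict_ext)
  moreover have "semilinear (function_ring X U) (function_ring X V) (\<lambda>f. restrict f V)
      (sec (free_sheaf X n) U) (sec (free_sheaf X n) V) (res (free_sheaf X n) U V)"
    if UV: "space_open X U" "space_open X V" "V \<subseteq> U" for U V
    unfolding semilinear_def free_sheaf_simps
  proof (intro conjI ballI funcsetI)
    fix a assume "a \<in> {..<n} \<rightarrow>\<^sub>E regular X U"
    then show "(\<lambda>i\<in>{..<n}. restrict (a i) V) \<in> {..<n} \<rightarrow>\<^sub>E regular X V"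
      by (auto intro!: regular_restrict[OF UV])
  next
    fix f assume "f \<in> carrier (function_ring X U)"
    then show "restrict f V \<in> carrier (function_ring X V)" using regular_restrict[OF UV] by simp
  qed (use UV in \<open>auto simp: fun_eq_iff restrict_def\<close>)
  moreover have "res (free_sheaf X n) U V \<zero>\<^bsub>sec (free_sheaf X n) U\<^esub> = \<zero>\<^bsub>sec (free_sheaf X n) V\<^esub>"
    if "V \<subseteq> U" for U V
    unfolding free_sheaf_simps using that by (auto simp: fun_eq_iff restrict_def)
  ultimately show ?thesis by (simp add: prelinear_presheaf_def)
qed

text \<open>The inverses of the bijections \<open>\<alpha> U\<close> are linear and natural because
  \<alpha> is.\<close>

lemma isomorphic_subsheaf:
  assumes F: "prelinear_presheaf X F" and \<alpha>: "sheaf_hom X F G \<alpha>"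
    and bij: "\<And>U. space_open X U \<Longrightarrow> bij_betw (\<alpha> U) (sections F U) (S U)"
  shows "isomorphic_sheaves X (subsheaf G S) F"
  unfolding isomorphic_sheaves_def
proof (intro exI conjI allI impI)
  let ?\<phi> = "\<lambda>U. inv_into (sections F U) (\<alpha> U)"
  have inv: "?\<phi> U (\<alpha> U a) = a" if "space_open X U" "a \<in> sections F U" for U a
    using bij[OF that(1)] that(2) by (simp add: bij_betw_def)
  have S: "\<exists>a\<in>sections F U. m = \<alpha> U a" if "space_open X U" "m \<in> S U" for U m
    using bij[OF that(1)] that(2) by (auto simp: bij_betw_def)
  show "sheaf_hom X (subsheaf G S) F ?\<phi>"
    unfolding sheaf_hom_def subsheaf_def
  proof (simp, intro conjI allI impI ballI)
    fix U assume U: "space_open X U"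
    show "?\<phi> U \<in> S U \<rightarrow> sections F U"
      using bij_betw_inv_into[OF bij[OF U]] by (auto simp: bij_betw_def)
    fix m assume "m \<in> S U"
    then obtain a where a: "a \<in> sections F U" "m = \<alpha> U a" using S[OF U] by blast
    { fix m' assume "m' \<in> S U"
      then obtain a' where a': "a' \<in> sections F U" "m' = \<alpha> U a'" using S[OF U] by blast
      show "?\<phi> U (m \<oplus>\<^bsub>sec G U\<^esub> m') = ?\<phi> U m \<oplus>\<^bsub>sec F U\<^esub> ?\<phi> U m'"
        using inv[OF U prelinear_presheafD(3)[OF F U a(1) a'(1)]] sheaf_homD(2)[OF \<alpha> U a(1) a'(1)]
        by (simp add: a a' inv[OF U]) }
    { fix f assume f: "f \<in> regular X U"
      show "?\<phi> U (f \<odot>\<^bsub>sec G U\<^esub> m) = f \<odot>\<^bsub>sec F U\<^esub> ?\<phi> U m"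
        using inv[OF U prelinear_presheafD(4)[OF F U f a(1)]] sheaf_homD(3)[OF \<alpha> U a(1) f]
        by (simp add: a inv[OF U]) }
  next
    fix U V m assume o: "space_open X U \<and> space_open X V \<and> V \<subseteq> U" and "m \<in> S U"
    then obtain a where a: "a \<in> sections F U" "m = \<alpha> U a" using S by blast
    have U: "space_open X U" "space_open X V" "V \<subseteq> U" using o by auto
    show "?\<phi> V (res G U V m) = res F U V (?\<phi> U m)"
      using inv[OF U(2) set_presheafD(1)[OF prelinear_imp_set_presheaf[OF F] U a(1)]]
        sheaf_homD(4)[OF \<alpha> U(1) a(1) U(2,3)]
      by (simp add: a inv[OF U(1)])
  qed
  show "bij_betw (?\<phi> U) (sections (subsheaf G S) U) (sections F U)" if "space_open X U" for U
    using bij_betw_inv_into[OF bij[OF that]] by (simp add: subsheaf_def)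
qed

text \<open>Membership in the image sheaf is a local condition; here the whole open set serves as
  neighbourhood, so exactness applies to \<alpha>(a) itself.\<close>

lemma exact_composite_zero:
  assumes ex: "short_exact X F E H \<alpha> \<beta>" and E: "prelinear_presheaf X E"
    and U: "space_open X U" and a: "a \<in> sections F U"
  shows "\<beta> U (\<alpha> U a) = \<zero>\<^bsub>sec H U\<^esub>"
proof -
  have \<alpha>: "sheaf_hom X F E \<alpha>" using ex by (simp add: short_exact_def)
  have m: "\<alpha> U a \<in> sections E U" by (rule sheaf_homD(1)[OF \<alpha> U a])
  then have "\<alpha> U a \<in> image_sections X F E \<alpha> U"
    using a U set_presheafD(2)[OF prelinear_imp_set_presheaf[OF E] U m]
    by (auto simp: image_sections_def opens_in_iff intro!: exI[of _ U])
  then show ?thesis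
    using ex U by (simp add: short_exact_def exact_at_def kernel_sheaf_def subsheaf_def)
qed

text \<open>Exactness provides preimages only locally. They agree on overlaps by injectivity of
  \<alpha>, and they glue coordinatewise because regular functions do; separatedness of
  \<open>E\<close> identifies the image of the glued section.\<close>

lemma bij_betw_kernel_of_free:
  assumes ex: "short_exact X (free_sheaf X n) E H \<alpha> \<beta>" and E: "sheaf_of_modules X E"
    and U: "space_open X U"
  shows "bij_betw (\<alpha> U) (sections (free_sheaf X n) U) {m \<in> sections E U. \<beta> U m = \<zero>\<^bsub>sec H U\<^esub>}"
proof -
  let ?F = "free_sheaf X n"
  have \<alpha>: "sheaf_hom X ?F E \<alpha>" and inj: "\<And>V. space_open X V \<Longrightarrow> inj_on (\<alpha> V) (sections ?F V)"
    using ex by (auto simp: short_exact_def injective_hom_def)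
  have "presheaf_of_modules X E" using E by (simp add: sheaf_of_modules_def)
  then have pE: "prelinear_presheaf X E" by (rule prelinear_if_presheaf_of_modules)
  note sE = set_presheafD[OF prelinear_imp_set_presheaf[OF pE]]
  note sF = set_presheafD[OF prelinear_imp_set_presheaf[OF prelinear_free[of n]]]
  have "m \<in> \<alpha> U ` sections ?F U" if m: "m \<in> sections E U" "\<beta> U m = \<zero>\<^bsub>sec H U\<^esub>" for m
  proof -
    have "m \<in> image_sections X ?F E \<alpha> U"
      using ex U m by (simp add: short_exact_def exact_at_def kernel_sheaf_def subsheaf_def)
    then have L: "\<forall>x\<in>U. \<exists>V\<in>opens_in X U. x \<in> V \<and> res E U V m \<in> \<alpha> V ` sections ?F V"
      by (simp add: image_sections_def)
    have "\<exists>V a. space_open X V \<and> V \<subseteq> U \<and> x \<in> V \<and> a \<in> sections ?F V \<and> res E U V m = \<alpha> V a" if "x \<in> U" for x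
    proof -
      from bspec[OF L that] obtain V a where "V \<in> opens_in X U" "x \<in> V" "a \<in> sections ?F V" "res E U V m = \<alpha> V a"
        by auto
      then show ?thesis by (auto simp: opens_in_iff)
    qed
    then obtain V a where Va: "\<And>x. x \<in> U \<Longrightarrow> space_open X (V x) \<and> V x \<subseteq> U \<and> x \<in> V x \<and>
        a x \<in> sections ?F (V x) \<and> res E U (V x) m = \<alpha> (V x) (a x)"
      by metis
    then have V: "space_open X (V x)" "V x \<subseteq> U" "x \<in> V x" and a: "a x \<in> sections ?F (V x)"
      and ma: "res E U (V x) m = \<alpha> (V x) (a x)" if "x \<in> U" for x
      using that by auto
    have agree: "a x i z = a y i z" if "x \<in> U" "y \<in> U" "z \<in> V x" "z \<in> V y" "i < n" for x y z i
    proof -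
      let ?W = "V x \<inter> V y"
      have W: "space_open X ?W" using V that by auto
      have "\<alpha> ?W (res ?F (V t) ?W (a t)) = res E U ?W m" if "t \<in> U" "?W \<subseteq> V t" for t
        using sheaf_homD(4)[OF \<alpha> V(1)[OF that(1)] a[OF that(1)] W that(2)] ma[OF that(1)]
          sE(3)[OF U V(1)[OF that(1)] W that(2) V(2)[OF that(1)] m(1)] by simp
      then have "\<alpha> ?W (res ?F (V x) ?W (a x)) = \<alpha> ?W (res ?F (V y) ?W (a y))" using that by simp
      then have "res ?F (V x) ?W (a x) = res ?F (V y) ?W (a y)"
        by (rule inj_onD[OF inj[OF W]]) (use V a W that in \<open>auto intro!: sF(1)\<close>)
      then have "(\<lambda>i\<in>{..<n}. restrict (a x i) ?W) i z = (\<lambda>i\<in>{..<n}. restrict (a y i) ?W) i z"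
        by (simp only: free_sheaf_simps)
      then show ?thesis using that by simp
    qed
    \<comment> \<open>At the point \<open>z\<close> the preimage chosen for \<open>z\<close> itself
      is used; \<open>agree\<close> makes this independent of the choice.\<close>
    define b where "b = (\<lambda>i\<in>{..<n}. \<lambda>z\<in>U. a z i z)"
    have bV: "restrict (b i) (V x) = a x i" if "x \<in> U" "i < n" for x i
    proof (rule extensionalityI[of _ "V x"])
      show "a x i \<in> extensional (V x)"
        using a[OF that(1)] that(2) regular_extensional[OF V(1)[OF that(1)]] by (auto simp: free_sheaf_simps)
      fix z assume "z \<in> V x"
      then show "restrict (b i) (V x) z = a x i z"
        using agree[of z x z i] V that by (auto simp: b_def)
    qed simp
    have b: "b \<in> sections ?F U"
      unfolding free_sheaf_simps
    proof (rule PiE_I)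
      fix i assume i: "i \<in> {..<n}"
      show "b i \<in> regular X U"
      proof (rule regular_local[OF U])
        show "b i \<in> extensional U" using i by (simp add: b_def)
        fix x assume x: "x \<in> U"
        have "restrict (b i) (V x) \<in> regular X (V x)"
          using bV[OF x, of i] a[OF x] i by (auto simp: free_sheaf_simps)
        then show "\<exists>W. space_open X W \<and> x \<in> W \<and> W \<subseteq> U \<and> restrict (b i) W \<in> regular X W"
          using V[OF x] by blast
      qed
    qed (simp add: b_def)
    have "res E U (V x) (\<alpha> U b) = res E U (V x) m" if x: "x \<in> U" for x
    proof -
      have "res ?F U (V x) b = a x"
      proof
        fix i
        \<comment> \<open>Outside the index range both families take the default value
          \<open>undefined\<close>, as equality of functions demands.\<close>
        have "a x i = undefined" if "\<not> i < n"
          using PiE_arb[of "a x" "{..<n}" _ i] a[OF x] that by (simp add: free_sheaf_simps)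
        then show "res ?F U (V x) b i = a x i"
          using bV[OF x, of i] by (simp add: free_sheaf_simps)
      qed
      then show ?thesis
        using sheaf_homD(4)[OF \<alpha> U b V(1,2)[OF x]] ma[OF x] by simp
    qed
    then have eq: "\<forall>W\<in>V ` U. res E U W (\<alpha> U b) = res E U W m" by blast
    have cover: "\<Union>(V ` U) = U" using V by auto
    have "\<forall>\<U>. (\<forall>W\<in>\<U>. space_open X W) \<longrightarrow>
        (\<forall>s\<in>sections E (\<Union>\<U>). \<forall>t\<in>sections E (\<Union>\<U>).
           (\<forall>W\<in>\<U>. res E (\<Union>\<U>) W s = res E (\<Union>\<U>) W t) \<longrightarrow> s = t)"
      using E unfolding sheaf_of_modules_def by blast
    from this[rule_format, of "V ` U" "\<alpha> U b" m, unfolded cover]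
    have "\<alpha> U b = m"
      using eq m(1) sheaf_homD(1)[OF \<alpha> U b] V(1) by blast
    then show ?thesis using b by blast
  qed
  then show ?thesis
    using inj[OF U] exact_composite_zero[OF ex pE U] sheaf_homD(1)[OF \<alpha> U]
    by (auto simp: bij_betw_def)
qed

end

text \<open>The argument for an arbitrary irreducible space with functions: projective varieties
  enter through the locale, and codimension two through a section of the ideal that is not
  zero.\<close>

lemma (in irreducible_function_space) co_higgs_of_extension:
  assumes A: "line_bundle X A"
    and s: "s \<in> sections (tensor_sheaf X (tangent_sheaf X) (dual_sheaf X A)) (topspace (topo X))"
      "s \<noteq> \<zero>\<^bsub>sec (tensor_sheaf X (tangent_sheaf X) (dual_sheaf X A)) (topspace (topo X))\<^esub>"
    and I: "presheaf_of_modules X (ideal_sheaf X I)" "\<And>U. space_open X U \<Longrightarrow> I U \<subseteq> regular X U"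
    and I_nonzero: "space_open X U\<^sub>0" "f\<^sub>0 \<in> I U\<^sub>0" "x\<^sub>0 \<in> U\<^sub>0" "f\<^sub>0 x\<^sub>0 \<noteq> 0"
    and E: "sheaf_of_modules X E" and n: "0 < n"
    and ex: "short_exact X (free_sheaf X n) E (tensor_sheaf X (ideal_sheaf X I) A) \<alpha> \<beta>"
  shows "\<exists>\<Phi>. two_nilpotent_co_Higgs X E \<Phi> \<and>
    isomorphic_sheaves X (kernel_sheaf E (tensor_sheaf X E (tangent_sheaf X)) \<Phi>) (free_sheaf X n)"
proof -
  let ?F = "free_sheaf X n" and ?top = "topspace (topo X)" and ?T = "tangent_sheaf X"
  let ?H = "tensor_sheaf X (ideal_sheaf X I) A"
  interpret twisted_ideal X A s I
    using A s I by unfold_locales auto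
  have mE: "presheaf_of_modules X E" using E by (simp add: sheaf_of_modules_def)
  have pE: "prelinear_presheaf X E" by (rule prelinear_if_presheaf_of_modules[OF mE])
  have pH: "prelinear_presheaf X ?H"
    unfolding tensor_sheaf_def by (rule prelinear_sheafify[OF IA.prelinear_tensor])
  have \<alpha>: "sheaf_hom X ?F E \<alpha>" and \<beta>: "sheaf_hom X E ?H \<beta>"
    and inj: "\<And>V. space_open X V \<Longrightarrow> inj_on (\<alpha> V) (sections ?F V)"
    and surj: "\<And>V. space_open X V \<Longrightarrow> image_sections X E ?H \<beta> V = sections ?H V"
    using ex by (auto simp: short_exact_def injective_hom_def surjective_hom_def)
  \<comment> \<open>The first basis section of the free sheaf; \<open>0 < n\<close> guarantees that
    there is one.\<close>
  define \<epsilon> where "\<epsilon> U = (\<lambda>i\<in>{..<n}. \<lambda>x\<in>U. if i = 0 then 1 else 0 :: complex)" for U :: "'a set"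
  have \<epsilon>: "\<epsilon> U \<in> sections ?F U" if "space_open X U" for U
    using regular_const[OF that, of 1] regular_const[OF that, of 0] by (auto simp: free_sheaf_simps \<epsilon>_def)
  have res_\<epsilon>: "res ?F ?top U (\<epsilon> ?top) = \<epsilon> U" if "space_open X U" for U
    using openin_subset[OF that] by (auto simp: free_sheaf_simps \<epsilon>_def fun_eq_iff restrict_def)
  have top: "space_open X ?top" by simp
  define e where "e = \<alpha> ?top (\<epsilon> ?top)"
  define \<delta> where "\<delta> U m = embed U (\<beta> U m)" for U m
  have e: "e \<in> sections E ?top" unfolding e_def by (rule sheaf_homD(1)[OF \<alpha> top \<epsilon>[OF top]])
  have eU: "res E ?top U e = \<alpha> U (\<epsilon> U)" if "space_open X U" for U
    using sheaf_homD(4)[OF \<alpha> top \<epsilon>[OF top] that openin_subset[OF that]] res_\<epsilon>[OF that] by (simp add: e_def)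
  have \<delta>: "sheaf_hom X E ?T \<delta>"
    unfolding sheaf_hom_def \<delta>_def
  proof (intro conjI allI impI ballI funcsetI)
    fix U m assume U: "space_open X U" and m: "m \<in> sections E U"
    note b = sheaf_homD[OF \<beta> U m] and g = sheaf_homD[OF embed_sheaf_hom U]
    show "embed U (\<beta> U m) \<in> sections ?T U" by (rule g(1)[OF b(1)])
    show "embed U (\<beta> U (m \<oplus>\<^bsub>sec E U\<^esub> m')) = embed U (\<beta> U m) \<oplus>\<^bsub>sec ?T U\<^esub> embed U (\<beta> U m')"
      if "m' \<in> sections E U" for m'
      using g(2)[OF b(1) sheaf_homD(1)[OF \<beta> U that]] b(2)[OF that] by simp
    show "embed U (\<beta> U (f \<odot>\<^bsub>sec E U\<^esub> m)) = f \<odot>\<^bsub>sec ?T U\<^esub> embed U (\<beta> U m)" if "f \<in> regular X U" for f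
      using g(3)[OF b(1) that] b(3)[OF that] by simp
  next
    fix U V m assume o: "space_open X U \<and> space_open X V \<and> V \<subseteq> U" and m: "m \<in> sections E U"
    then show "embed V (\<beta> V (res E U V m)) = res ?T U V (embed U (\<beta> U m))"
      using sheaf_homD(4)[OF \<beta> _ m, of V] sheaf_homD(4)[OF embed_sheaf_hom _ sheaf_homD(1)[OF \<beta> _ m], of V] by simp
  qed
  have embed_zero: "embed U \<zero>\<^bsub>sec ?H U\<^esub> = \<zero>\<^bsub>sec ?T U\<^esub>" if "space_open X U" for U
    by (rule sheaf_hom_zero[OF pH presheaf_of_modules_tangent embed_sheaf_hom that])
  have \<delta>_iff: "\<delta> U m = \<zero>\<^bsub>sec ?T U\<^esub> \<longleftrightarrow> \<beta> U m = \<zero>\<^bsub>sec ?H U\<^esub>" if "space_open X U" "m \<in> sections E U" for U m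
    unfolding \<delta>_def using embed_injective[OF that(1) sheaf_homD(1)[OF \<beta> that]] embed_zero[OF that(1)] by metis
  interpret C: co_higgs_data X E e \<delta>
  proof unfold_locales
    show "\<delta> ?top e = \<zero>\<^bsub>sec ?T ?top\<^esub>"
      using \<delta>_iff[OF top e] exact_composite_zero[OF ex pE top \<epsilon>[OF top]] by (simp add: e_def)
    fix U f x assume U: "space_open X U" and f: "f \<in> regular X U"
      and z: "f \<odot>\<^bsub>sec E U\<^esub> res E ?top U e = \<zero>\<^bsub>sec E U\<^esub>" and x: "x \<in> U"
    note F = prelinear_presheafD[OF prelinear_free[of n] U]
    \<comment> \<open>Torsion-freeness of \<open>e\<close> is that of the free sheaf, transported by
      injectivity of \<alpha>: the coordinate 0 of f times the basis section is f.\<close>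
    have "\<alpha> U (f \<odot>\<^bsub>sec ?F U\<^esub> \<epsilon> U) = \<alpha> U \<zero>\<^bsub>sec ?F U\<^esub>"
      using sheaf_homD(3)[OF \<alpha> U \<epsilon>[OF U] f] z eU[OF U] sheaf_hom_zero[OF prelinear_free mE \<alpha> U] by simp
    then have "f \<odot>\<^bsub>sec ?F U\<^esub> \<epsilon> U = \<zero>\<^bsub>sec ?F U\<^esub>"
      by (rule inj_onD[OF inj[OF U] _ F(4)[OF f \<epsilon>[OF U]] F(1)])
    then have "(f \<odot>\<^bsub>sec ?F U\<^esub> \<epsilon> U) 0 x = \<zero>\<^bsub>sec ?F U\<^esub> 0 x" by simp
    then show "f x = 0" using n x by (simp add: free_sheaf_simps \<epsilon>_def)
  qed (use mE e \<delta> in auto)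
  obtain W \<sigma> V h y where W: "space_open X W" "\<sigma> \<in> sections ?H W"
    and V: "space_open X V" "V \<subseteq> W" "h \<in> regular X V" "y \<in> V" and ne: "embed W \<sigma> V h y \<noteq> 0"
    using embed_nonzero[OF I_nonzero] .
  \<comment> \<open>\<beta> is onto only locally, so a preimage is taken near \<open>y\<close>, the
    point where the image of \<sigma> is known to be nonzero.\<close>
  have "\<sigma> \<in> image_sections X E ?H \<beta> W" using surj W by simp
  then have loc: "\<forall>x\<in>W. \<exists>N\<in>opens_in X W. x \<in> N \<and> res ?H W N \<sigma> \<in> \<beta> N ` sections E N"
    by (simp add: image_sections_def)
  have "y \<in> W" using V by auto
  from bspec[OF loc this] obtain N m where N: "space_open X N" "N \<subseteq> W" "y \<in> N"
    and m: "m \<in> sections E N" "res ?H W N \<sigma> = \<beta> N m"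
    by (auto simp: opens_in_iff)
  have "\<delta> N m \<noteq> \<zero>\<^bsub>sec ?T N\<^esub>"
  proof
    assume z: "\<delta> N m = \<zero>\<^bsub>sec ?T N\<^esub>"
    have VN: "space_open X (V \<inter> N)" using V N by auto
    have h': "restrict h (V \<inter> N) \<in> regular X (V \<inter> N)" by (rule regular_restrict[OF V(1) VN _ V(3)]) auto
    have "sheaf_derivation X W (embed W \<sigma>)"
      using sheaf_homD(1)[OF embed_sheaf_hom W] by (simp add: tangent_simps)
    then have "embed W \<sigma> V h y = embed W \<sigma> (V \<inter> N) (restrict h (V \<inter> N)) y"
      using V N VN by (intro derivation_restrict[symmetric]) auto
    also have "\<dots> = res ?T W N (embed W \<sigma>) (V \<inter> N) (restrict h (V \<inter> N)) y"
      using VN by (simp add: tangent_simps opens_in_iff)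
    also have "res ?T W N (embed W \<sigma>) = \<delta> N m"
      unfolding \<delta>_def m(2)[symmetric] by (rule sheaf_homD(4)[OF embed_sheaf_hom W N(1,2), symmetric])
    also have "\<delta> N m (V \<inter> N) (restrict h (V \<inter> N)) y = 0"
      unfolding z using VN h' V N by (intro tangent_simps) auto
    finally show False using ne by simp
  qed
  then have "two_nilpotent_co_Higgs X E C.\<Phi>" by (rule C.two_nilpotent[OF N(1) m(1)])
  moreover have "isomorphic_sheaves X (kernel_sheaf E (tensor_sheaf X E ?T) C.\<Phi>) ?F"
    unfolding kernel_sheaf_def
  proof (rule isomorphic_subsheaf[OF prelinear_free \<alpha>])
    fix U assume U: "space_open X U"
    \<comment> \<open>The kernels of \<Phi>, \<delta> and \<beta> coincide, and the last one is the
      image of \<alpha>.\<close>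
    have "{m \<in> sections E U. C.\<Phi> U m = \<zero>\<^bsub>sec (tensor_sheaf X E ?T) U\<^esub>} = {m \<in> sections E U. \<beta> U m = \<zero>\<^bsub>sec ?H U\<^esub>}"
      using C.\<Phi>_zero_iff[OF U] \<delta>_iff[OF U] by auto
    then show "bij_betw (\<alpha> U) (sections ?F U) {m \<in> sections E U. C.\<Phi> U m = \<zero>\<^bsub>sec (tensor_sheaf X E ?T) U\<^esub>}"
      using bij_betw_kernel_of_free[OF ex E U] by simp
  qed
  ultimately show ?thesis by blast
qed

section \<open>Projective varieties\<close>

text \<open>Each exponent is at most d. Finiteness matters because a sum over an infinite index set
  is 0 by convention.\<close>

lemma finite_exponents: "finite {\<alpha> :: 'n::finite \<Rightarrow> nat. (\<Sum>i\<in>UNIV. \<alpha> i) = d}"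
proof (rule finite_subset)
  show "{\<alpha> :: 'n \<Rightarrow> nat. (\<Sum>i\<in>UNIV. \<alpha> i) = d} \<subseteq> (\<Pi>\<^sub>E i\<in>UNIV. {..d})"
    by (auto simp: member_le_sum)
  show "finite (\<Pi>\<^sub>E i\<in>(UNIV :: 'n set). {..d})" by (intro finite_PiE) auto
qed

section \<open>Closure of forms under sums and products\<close>

lemma form_scale: "form d F \<Longrightarrow> form d (\<lambda>v. c * F v)"
  unfolding form_def
proof (elim exE)
  fix a assume "\<forall>v. F v = (\<Sum>\<alpha> | (\<Sum>i\<in>UNIV. \<alpha> i) = d. a \<alpha> * (\<Prod>i\<in>UNIV. v $ i ^ \<alpha> i))"
  then show "\<exists>a. \<forall>v. c * F v = (\<Sum>\<alpha> | (\<Sum>i\<in>UNIV. \<alpha> i) = d. a \<alpha> * (\<Prod>i\<in>UNIV. v $ i ^ \<alpha> i))"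
    by (intro exI[of _ "\<lambda>\<alpha>. c * a \<alpha>"]) (simp add: sum_distrib_left mult.assoc)
qed

lemma form_add: "form d F \<Longrightarrow> form d G \<Longrightarrow> form d (\<lambda>v. F v + G v)"
  unfolding form_def
proof (elim exE)
  fix a b assume "\<forall>v. F v = (\<Sum>\<alpha> | (\<Sum>i\<in>UNIV. \<alpha> i) = d. a \<alpha> * (\<Prod>i\<in>UNIV. v $ i ^ \<alpha> i))"
    "\<forall>v. G v = (\<Sum>\<alpha> | (\<Sum>i\<in>UNIV. \<alpha> i) = d. b \<alpha> * (\<Prod>i\<in>UNIV. v $ i ^ \<alpha> i))"
  then show "\<exists>a. \<forall>v. F v + G v = (\<Sum>\<alpha> | (\<Sum>i\<in>UNIV. \<alpha> i) = d. a \<alpha> * (\<Prod>i\<in>UNIV. v $ i ^ \<alpha> i))"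
    by (intro exI[of _ "\<lambda>\<alpha>. a \<alpha> + b \<alpha>"]) (simp add: sum.distrib distrib_right)
qed

lemma form_monomial:
  assumes "(\<Sum>i\<in>UNIV. \<alpha> i) = d" shows "form d (\<lambda>v. \<Prod>i\<in>UNIV. v $ i ^ \<alpha> i)"
  unfolding form_def
proof (intro exI allI)
  fix v :: "complex ^ 'a"
  have "(\<Sum>\<beta> | (\<Sum>i\<in>UNIV. \<beta> i) = d. (if \<beta> = \<alpha> then 1 else 0) * (\<Prod>i\<in>UNIV. v $ i ^ \<beta> i)) =
      (\<Sum>\<beta> | (\<Sum>i\<in>UNIV. \<beta> i) = d. if \<beta> = \<alpha> then (\<Prod>i\<in>UNIV. v $ i ^ \<alpha> i) else 0)"
    by (intro sum.cong) auto
  then show "(\<Prod>i\<in>UNIV. v $ i ^ \<alpha> i) =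
      (\<Sum>\<beta> | (\<Sum>i\<in>UNIV. \<beta> i) = d. (if \<beta> = \<alpha> then 1 else 0) * (\<Prod>i\<in>UNIV. v $ i ^ \<beta> i))"
    using assms by (simp add: finite_exponents)
qed

lemma form_const: "form 0 (\<lambda>v. c)"
  using form_scale[OF form_monomial[of "\<lambda>_. 0" 0], of c] by simp

lemma form_sum:
  assumes "finite S" "\<And>j. j \<in> S \<Longrightarrow> form d (F j)" shows "form d (\<lambda>v. \<Sum>j\<in>S. F j v)"
  using assms
proof (induction S rule: finite_induct)
  case empty
  have "form d (\<lambda>v :: complex ^ 'b. 0)" unfolding form_def by (rule exI[of _ "\<lambda>_. 0"]) simp
  then show ?case by simp
qed (simp add: form_add)

text \<open>The product stays a double sum of monomials of degree d + d', and forms are closed under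
  sums; coefficients need not be collected by exponent.\<close>

lemma form_mult:
  assumes "form d F" "form d' G" shows "form (d + d') (\<lambda>v. F v * G v)"
proof -
  obtain a b where F: "\<And>v. F v = (\<Sum>\<alpha> | (\<Sum>i\<in>UNIV. \<alpha> i) = d. a \<alpha> * (\<Prod>i\<in>UNIV. v $ i ^ \<alpha> i))"
    and G: "\<And>v. G v = (\<Sum>\<beta> | (\<Sum>i\<in>UNIV. \<beta> i) = d'. b \<beta> * (\<Prod>i\<in>UNIV. v $ i ^ \<beta> i))"
    using assms unfolding form_def by blast
  have "form (d + d') (\<lambda>v. \<Sum>\<alpha> | (\<Sum>i\<in>UNIV. \<alpha> i) = d. \<Sum>\<beta> | (\<Sum>i\<in>UNIV. \<beta> i) = d'.
      a \<alpha> * b \<beta> * (\<Prod>i\<in>UNIV. v $ i ^ (\<alpha> i + \<beta> i)))"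
    by (intro form_sum finite_exponents form_scale form_monomial) (auto simp: sum.distrib)
  moreover have "(\<lambda>v. \<Sum>\<alpha> | (\<Sum>i\<in>UNIV. \<alpha> i) = d. \<Sum>\<beta> | (\<Sum>i\<in>UNIV. \<beta> i) = d'.
      a \<alpha> * b \<beta> * (\<Prod>i\<in>UNIV. v $ i ^ (\<alpha> i + \<beta> i))) = (\<lambda>v. F v * G v)"
    unfolding F G by (simp add: sum_product power_add prod.distrib algebra_simps)
  ultimately show ?thesis by simp
qed

lemma zariski_basic_open:
  "form d F \<Longrightarrow> openin zariski {p \<in> proj_space. \<forall>v\<in>p - {0}. F v \<noteq> 0}"
  unfolding zariski_def by (rule topology_generated_by_Basis) blast

lemma topspace_zariski_subset: "topspace zariski \<subseteq> proj_space"
  unfolding zariski_def topology_generated_by_topspace by blast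

lemma proj_space_nonzero: "p \<in> proj_space \<Longrightarrow> \<exists>v\<in>p. v \<noteq> 0"
  unfolding proj_space_def by (auto intro!: exI[of _ 1])

section \<open>Regular functions and irreducibility on a projective variety\<close>

lemma variety_simps [simp]: "topo (variety V) = subtopology zariski V"
  by (simp add: variety_def)

lemma regular_variety:
  "f \<in> regular (variety V) U \<longleftrightarrow> f \<in> extensional U \<and> (\<forall>p\<in>U. \<exists>W F G d.
     openin (subtopology zariski V) W \<and> p \<in> W \<and> W \<subseteq> U \<and> form d F \<and> form d G \<and>
     (\<forall>q\<in>W. \<forall>v\<in>q - {0}. G v \<noteq> 0 \<and> f q = F v / G v))"
  by (simp add: variety_def)

lemma regular_variety_pair:
  assumes f: "f \<in> regular (variety V) U" and g: "g \<in> regular (variety V) U" and p: "p \<in> U"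
  obtains W d F G d' F' G' where "openin (subtopology zariski V) W" "p \<in> W" "W \<subseteq> U"
    "form d F" "form d G" "form d' F'" "form d' G'"
    "\<forall>q\<in>W. \<forall>v\<in>q - {0}. G v \<noteq> 0 \<and> f q = F v / G v \<and> G' v \<noteq> 0 \<and> g q = F' v / G' v"
proof -
  obtain W F G d where W: "openin (subtopology zariski V) W" "p \<in> W" "W \<subseteq> U" "form d F" "form d G"
    "\<forall>q\<in>W. \<forall>v\<in>q - {0}. G v \<noteq> 0 \<and> f q = F v / G v"
    using f p unfolding regular_variety by meson
  obtain W' F' G' d' where W': "openin (subtopology zariski V) W'" "p \<in> W'" "W' \<subseteq> U" "form d' F'" "form d' G'"
    "\<forall>q\<in>W'. \<forall>v\<in>q - {0}. G' v \<noteq> 0 \<and> g q = F' v / G' v"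
    using g p unfolding regular_variety by meson
  show thesis
    using W W' openin_Int[OF W(1) W'(1)] by (intro that[of "W \<inter> W'" d F G d' F' G']) auto
qed

lemma function_space_variety: "function_space (variety V)"
proof
  fix U f assume "space_open (variety V) U" "f \<in> regular (variety V) U"
  then show "f \<in> extensional U" by (simp add: regular_variety)
next
  fix U c assume "space_open (variety V) U"
  then have U: "openin (subtopology zariski V) U" by simp
  show "(\<lambda>x\<in>U. c) \<in> regular (variety V) U"
    unfolding regular_variety
  proof (intro conjI ballI)
    fix p assume "p \<in> U"
    \<comment> \<open>The constant is the quotient c / 1 of forms of degree 0.\<close>
    with U show "\<exists>W F G d. openin (subtopology zariski V) W \<and> p \<in> W \<and> W \<subseteq> U \<and> form d F \<and> form d G \<and>
        (\<forall>q\<in>W. \<forall>v\<in>q - {0}. G v \<noteq> 0 \<and> (\<lambda>x\<in>U. c) q = F v / G v)"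
      by (rule_tac x = U in exI, rule_tac x = "\<lambda>_. c" in exI, rule_tac x = "\<lambda>_. 1" in exI,
          rule_tac x = 0 in exI) (simp add: form_const)
  qed simp
next
  fix U f g assume U: "space_open (variety V) U" and f: "f \<in> regular (variety V) U" and g: "g \<in> regular (variety V) U"
  show "(\<lambda>x\<in>U. f x + g x) \<in> regular (variety V) U"
    unfolding regular_variety
  proof (intro conjI ballI)
    fix p assume p: "p \<in> U"
    obtain W d F G d' F' G' where W: "openin (subtopology zariski V) W" "p \<in> W" "W \<subseteq> U"
      "form d F" "form d G" "form d' F'" "form d' G'"
      and v: "\<forall>q\<in>W. \<forall>v\<in>q - {0}. G v \<noteq> 0 \<and> f q = F v / G v \<and> G' v \<noteq> 0 \<and> g q = F' v / G' v"
      using regular_variety_pair[OF f g p] .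
    \<comment> \<open>Numerator and denominator over the common denominator: all products have
      degree d + d', although d and d' may differ.\<close>
    have "form (d + d') (\<lambda>v. F v * G' v + G v * F' v)" "form (d + d') (\<lambda>v. G v * G' v)"
      using W by (auto intro!: form_add form_mult)
    moreover have "G v * G' v \<noteq> 0 \<and> (\<lambda>x\<in>U. f x + g x) q = (F v * G' v + G v * F' v) / (G v * G' v)"
      if "q \<in> W" "v \<in> q - {0}" for q v
    proof -
      have "q \<in> U" using that W by auto
      moreover have "f q = F v / G v" "g q = F' v / G' v" "G v \<noteq> 0" "G' v \<noteq> 0" using v that by auto
      ultimately show ?thesis by (simp add: add_frac_eq mult.commute)
    qed
    ultimately show "\<exists>W F G d. openin (subtopology zariski V) W \<and> p \<in> W \<and> W \<subseteq> U \<and> form d F \<and> form d G \<and>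
        (\<forall>q\<in>W. \<forall>v\<in>q - {0}. G v \<noteq> 0 \<and> (\<lambda>x\<in>U. f x + g x) q = F v / G v)"
      using W(1-3) by (intro exI[of _ W] exI[of _ "\<lambda>v. F v * G' v + G v * F' v"] exI[of _ "\<lambda>v. G v * G' v"]
          exI[of _ "d + d'"] conjI ballI) auto
  qed simp
  show "(\<lambda>x\<in>U. f x * g x) \<in> regular (variety V) U"
    unfolding regular_variety
  proof (intro conjI ballI)
    fix p assume p: "p \<in> U"
    obtain W d F G d' F' G' where W: "openin (subtopology zariski V) W" "p \<in> W" "W \<subseteq> U"
      "form d F" "form d G" "form d' F'" "form d' G'"
      and v: "\<forall>q\<in>W. \<forall>v\<in>q - {0}. G v \<noteq> 0 \<and> f q = F v / G v \<and> G' v \<noteq> 0 \<and> g q = F' v / G' v"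
      using regular_variety_pair[OF f g p] .
    have "form (d + d') (\<lambda>v. F v * F' v)" "form (d + d') (\<lambda>v. G v * G' v)"
      using W by (auto intro!: form_mult)
    moreover have "G v * G' v \<noteq> 0 \<and> (\<lambda>x\<in>U. f x * g x) q = (F v * F' v) / (G v * G' v)"
      if "q \<in> W" "v \<in> q - {0}" for q v
    proof -
      have "q \<in> U" using that W by auto
      moreover have "f q = F v / G v" "g q = F' v / G' v" "G v \<noteq> 0" "G' v \<noteq> 0" using v that by auto
      ultimately show ?thesis by simp
    qed
    ultimately show "\<exists>W F G d. openin (subtopology zariski V) W \<and> p \<in> W \<and> W \<subseteq> U \<and> form d F \<and> form d G \<and>
        (\<forall>q\<in>W. \<forall>v\<in>q - {0}. G v \<noteq> 0 \<and> (\<lambda>x\<in>U. f x * g x) q = F v / G v)"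
      using W(1-3) by (intro exI[of _ W] exI[of _ "\<lambda>v. F v * F' v"] exI[of _ "\<lambda>v. G v * G' v"]
          exI[of _ "d + d'"] conjI ballI) auto
  qed simp
next
  fix U U' f assume o: "space_open (variety V) U" "space_open (variety V) U'" "U' \<subseteq> U" and f: "f \<in> regular (variety V) U"
  show "restrict f U' \<in> regular (variety V) U'"
    unfolding regular_variety
  proof (intro conjI ballI)
    fix p assume p: "p \<in> U'"
    then have "p \<in> U" using o by auto
    then obtain W F G d where W: "openin (subtopology zariski V) W" "p \<in> W" "W \<subseteq> U" "form d F" "form d G"
      "\<forall>q\<in>W. \<forall>v\<in>q - {0}. G v \<noteq> 0 \<and> f q = F v / G v"
      using f unfolding regular_variety by meson
    have "openin (subtopology zariski V) (W \<inter> U')" using openin_Int[OF W(1)] o(2) by simp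
    then show "\<exists>W F G d. openin (subtopology zariski V) W \<and> p \<in> W \<and> W \<subseteq> U' \<and> form d F \<and> form d G \<and>
        (\<forall>q\<in>W. \<forall>v\<in>q - {0}. G v \<noteq> 0 \<and> restrict f U' q = F v / G v)"
      using W p by (intro exI[of _ "W \<inter> U'"] exI[of _ F] exI[of _ G] exI[of _ d]) auto
  qed simp
next
  fix U f assume U: "space_open (variety V) U" and f: "f \<in> extensional U"
    and loc: "\<And>x. x \<in> U \<Longrightarrow> \<exists>U'. space_open (variety V) U' \<and> x \<in> U' \<and> U' \<subseteq> U \<and> restrict f U' \<in> regular (variety V) U'"
  show "f \<in> regular (variety V) U"
    unfolding regular_variety
  proof (intro conjI ballI f)
    fix p assume "p \<in> U"
    then obtain U' where U': "p \<in> U'" "U' \<subseteq> U" "restrict f U' \<in> regular (variety V) U'" using loc by blast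
    then obtain W F G d where W: "openin (subtopology zariski V) W" "p \<in> W" "W \<subseteq> U'" "form d F" "form d G"
      "\<forall>q\<in>W. \<forall>v\<in>q - {0}. G v \<noteq> 0 \<and> restrict f U' q = F v / G v"
      unfolding regular_variety by meson
    then show "\<exists>W F G d. openin (subtopology zariski V) W \<and> p \<in> W \<and> W \<subseteq> U \<and> form d F \<and> form d G \<and>
        (\<forall>q\<in>W. \<forall>v\<in>q - {0}. G v \<noteq> 0 \<and> f q = F v / G v)"
      using U' by (intro exI[of _ W] exI[of _ F] exI[of _ G] exI[of _ d]) (auto simp: subset_iff)
  qed
qed

text \<open>Locally \<open>f\<close> is a quotient of forms and vanishes exactly where its numerator
  does. Irreducibility of \<open>V\<close> is stated with closed sets of the ambient space;
  complements in \<open>V\<close> turn it into a statement on open subsets.\<close>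

lemma irreducible_function_space_variety:
  assumes V: "irreducible_closed zariski V" shows "irreducible_function_space (variety V)"
proof -
  interpret function_space "variety V" by (rule function_space_variety)
  show ?thesis
  proof
    fix U f assume U: "space_open (variety V) U" and f: "f \<in> regular (variety V) U"
    show "space_open (variety V) {x \<in> U. f x \<noteq> 0}"
    proof (subst openin_subopen, intro ballI)
      fix p assume "p \<in> {x \<in> U. f x \<noteq> 0}"
      then have p: "p \<in> U" "f p \<noteq> 0" by auto
      obtain W F G d where W: "openin (subtopology zariski V) W" "p \<in> W" "W \<subseteq> U" "form d F" "form d G"
        "\<forall>q\<in>W. \<forall>v\<in>q - {0}. G v \<noteq> 0 \<and> f q = F v / G v"
        using f p unfolding regular_variety by meson
      define B where "B = {p \<in> proj_space. \<forall>v\<in>p - {0}. F v \<noteq> 0}"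
      have WP: "q \<in> proj_space" if "q \<in> W" for q
        using that openin_subset[OF W(1)] topspace_zariski_subset by (auto simp: topspace_subtopology)
      have "openin (subtopology zariski V) (V \<inter> B)"
        unfolding B_def by (rule openin_subtopology_Int2[OF zariski_basic_open[OF W(4)]])
      then have "openin (subtopology zariski V) (W \<inter> (V \<inter> B))" by (rule openin_Int[OF W(1)])
      moreover have "W \<subseteq> V" using openin_subset[OF W(1)] by (simp add: topspace_subtopology)
      moreover have "p \<in> B" unfolding B_def using W(2,6) WP p by force
      \<comment> \<open>A point is a line; the condition on its nonzero vectors has force only
        because such a vector exists.\<close>
      moreover have "f q \<noteq> 0" if "q \<in> W" "q \<in> B" for q
        using proj_space_nonzero[OF WP[OF that(1)]] W(6) that unfolding B_def by force
      ultimately show "\<exists>N. openin (topo (variety V)) N \<and> p \<in> N \<and> N \<subseteq> {x \<in> U. f x \<noteq> 0}"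
        using W(2,3) by (intro exI[of _ "W \<inter> (V \<inter> B)"]) auto
    qed
  next
    fix U W assume U: "space_open (variety V) U" and W: "space_open (variety V) W" and ne: "U \<noteq> {}" "W \<noteq> {}"
    have closed: "closedin zariski (V - N)" if "space_open (variety V) N" for N
    proof -
      have "closedin zariski V" using V by (simp add: irreducible_closed_def)
      moreover have "closedin (subtopology zariski V) (V - N)"
        using that \<open>closedin zariski V\<close> closedin_subset[OF \<open>closedin zariski V\<close>]
        by (metis Int_absorb1 Int_commute closedin_diff closedin_topspace topspace_subtopology variety_simps)
      ultimately show ?thesis using closedin_trans_full by blast
    qed
    have sub: "U \<subseteq> V" "W \<subseteq> V" using U W openin_subset by (force simp: topspace_subtopology)+
    show "U \<inter> W \<noteq> {}"
    proof
      assume "U \<inter> W = {}"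
      then have "V \<subseteq> (V - U) \<union> (V - W)" by auto
      then have "V \<subseteq> V - U \<or> V \<subseteq> V - W"
        using V closed[OF U] closed[OF W] unfolding irreducible_closed_def by blast
      then show False using sub ne by auto
    qed
  qed
qed

text \<open>The only closed set containing the whole space is the whole space, so a chain above it
  has one member and length 1 - 1 = 0.\<close>

lemma codimension_whole_space:
  assumes T: "irreducible_closed T (topspace T)" shows "codimension T (topspace T) \<le> 0"
proof -
  have "codimension T (topspace T) \<le> chain_length {D. irreducible_closed T D \<and> topspace T \<subseteq> D}"
    unfolding codimension_def using T by (intro INF_lower) auto
  also have "\<dots> \<le> 0"
    unfolding chain_length_def
  proof (rule SUP_least)
    fix \<C> assume "\<C> \<in> {\<C>. finite \<C> \<and> \<C> \<noteq> {} \<and> subset.chain {D. irreducible_closed T D \<and> topspace T \<subseteq> D} \<C>}"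
    then have "\<C> \<subseteq> {D. irreducible_closed T D \<and> topspace T \<subseteq> D}" by (simp add: subset.chain_def)
    also have "\<dots> \<subseteq> {topspace T}"
      using closedin_subset[of T] unfolding irreducible_closed_def by blast
    finally have "\<C> \<subseteq> {topspace T}" .
    then have "card \<C> \<le> 1" using card_mono[of "{topspace T}" \<C>] by simp
    then show "enat (card \<C> - 1) \<le> 0" by (simp add: enat_0_iff)
  qed
  finally show ?thesis .
qed

text \<open>If all sections of the ideal vanished everywhere, the underlying set of the subscheme
  would be all of \<open>V\<close>. It is nonempty, so its codimension would have to be 2, whereas
  that of the whole space is 0.\<close>

lemma lci_ideal_nonzero:
  assumes V: "irreducible_closed zariski V" and I: "lci_of_codim 2 (variety V) I"
  shows "\<exists>U f x. space_open (variety V) U \<and> f \<in> I U \<and> x \<in> U \<and> f x \<noteq> 0"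
proof (rule ccontr)
  assume no: "\<not> ?thesis"
  let ?T = "subtopology zariski V"
  have closed: "closedin zariski V" using V by (simp add: irreducible_closed_def)
  have top: "topspace ?T = V" using closedin_subset[OF closed] by (auto simp: topspace_subtopology)
  have "subscheme_points (variety V) I = V"
    unfolding subscheme_points_def using no by (auto simp: top simp del: topspace_subtopology)
  moreover have "V \<noteq> {}" using V by (simp add: irreducible_closed_def)
  ultimately have "codimension ?T V = enat 2"
    using I by (simp add: lci_of_codim_def)
  moreover have "irreducible_closed ?T V"
    using V closedin_trans_full[OF _ closed] unfolding irreducible_closed_def
    by (metis closedin_topspace top)
  ultimately show False
    using codimension_whole_space[of ?T] by (simp add: top enat_0_iff del: topspace_subtopology)
qed

theorem lemma2p6:
  fixes X :: "(complex ^ 'n) set space_with_functions"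
    and r :: nat
    and I_Z :: "(complex ^ 'n) set set \<Rightarrow> ((complex ^ 'n) set \<Rightarrow> complex) set"
    and A :: "((complex ^ 'n) set, 'a) module_presheaf"
    and E :: "((complex ^ 'n) set, 'e) module_presheaf"
  assumes "smooth_projective_variety X"
    and "r \<ge> 2"
    and "lci_of_codim 2 X I_Z"
    and "line_bundle X A"
    and "\<exists>s\<in>sections (tensor_sheaf X (tangent_sheaf X) (dual_sheaf X A)) (topspace (topo X)).
           s \<noteq> \<zero>\<^bsub>sec (tensor_sheaf X (tangent_sheaf X) (dual_sheaf X A)) (topspace (topo X))\<^esub>"
    and "torsion_free_sheaf X E"
    and "short_exact X (free_sheaf X (r - 1)) E (tensor_sheaf X (ideal_sheaf X I_Z) A) \<alpha> \<beta>"
  shows "\<exists>\<Phi>. two_nilpotent_co_Higgs X E \<Phi> \<and>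
           isomorphic_sheaves X (kernel_sheaf E (tensor_sheaf X E (tangent_sheaf X)) \<Phi>)
             (free_sheaf X (r - 1))"
proof -
  obtain V where V: "irreducible_closed zariski V" "X = variety V"
    using assms(1) by (auto simp: smooth_projective_variety_def)
  interpret irreducible_function_space X
    unfolding V(2) by (rule irreducible_function_space_variety[OF V(1)])
  obtain s where s: "s \<in> sections (tensor_sheaf X (tangent_sheaf X) (dual_sheaf X A)) (topspace (topo X))"
    "s \<noteq> \<zero>\<^bsub>sec (tensor_sheaf X (tangent_sheaf X) (dual_sheaf X A)) (topspace (topo X))\<^esub>"
    using assms(5) by blast
  obtain U f x where f: "space_open X U" "f \<in> I_Z U" "x \<in> U" "f x \<noteq> 0"
    using lci_ideal_nonzero[OF V(1)] assms(3) V(2) by blast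
  have I: "presheaf_of_modules X (ideal_sheaf X I_Z)" "\<And>U. space_open X U \<Longrightarrow> I_Z U \<subseteq> regular X U"
    using assms(3) by (auto simp: lci_of_codim_def closed_subscheme_def coherent_def sheaf_of_modules_def)
  have E: "sheaf_of_modules X E"
    using assms(6) by (simp add: torsion_free_sheaf_def coherent_def)
  \<comment> \<open>With r at least 2 the free part has a basis section, from which \<open>e\<close>
    is taken.\<close>
  have "0 < r - 1" using assms(2) by simp
  from co_higgs_of_extension[OF assms(4) s I f E this assms(7)] show ?thesis .
qed

end
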